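(* Let $g(n)$ be the number of intervals in the ascent lattice $\mathbb{D}_n$, and let $G:=\sum_{n\ge 1} g(n)t^n$. Then \[ G = Z(1-2Z+2Z^3), \] where $Z$ is the unique formal power series in $t$ (with constant term $0$) satisfying $Z=t(1+Z)(1+2Z)^2$. In particular, $G$ is algebraic of degree $3$ over $\mathbb{Q}(t)$. Moreover, as $n\to\infty$, \[ g(n)\sim \kappa\,\mu^n n^{-7/2},\qquad \mu=\frac{11+5\sqrt5}{2},\qquad \kappa=\frac38\sqrt{\frac{275+123\sqrt5}{10\pi}}. \]
   Context: A Dyck path of size $n$ is a lattice path from $(0,0)$ made of $n$ up steps $U=(1,1)$ and $n$ down steps $D=(1,-1)$, ending on the $x$-axis and never going strictly below it. An ascent is a maximal non-empty sequence of consecutive up steps. The ascent order on the set $\mathcal{D}_n$ of Dyck paths of size $n$ is the reflexive-transitive closure of the relation $P\to Q$ holding when $Q$ is obtained from $P$ by replacing a factor $DU^kD$ (for some $k\ge1$) by $U^kDD$. The resulting poset is denoted $\mathbb{D}_n$ (the ascent lattice). An interval is a pair $(P,Q)$ of elements with $P\le Q$. *)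

theory Defs
  imports
    "HOL-Computational_Algebra.Computational_Algebra"
    "HOL-Library.Landau_Symbols"
    "HOL-Analysis.Analysis"
begin

text \<open>A lattice path starting at the origin is encoded by its sequence of steps;
  \<open>Up\<close> stands for $(1,1)$ and \<open>Down\<close> for $(1,-1)$.\<close>

datatype step = Up | Down

fun step_val :: "step \<Rightarrow> int" where
  "step_val Up = 1"
| "step_val Down = -1"

text \<open>Ordinate of the endpoint of a path.\<close>

definition height :: "step list \<Rightarrow> int" where
  "height w = (\<Sum>s\<leftarrow>w. step_val s)"

definition dyck_paths :: "nat \<Rightarrow> step list set" where
  "dyck_paths n = {w. count_list w Up = n \<and> count_list w Down = n \<and> height w = 0
                      \<and> (\<forall>i\<le>length w. height (take i w) \<ge> 0)}"

definition ascent_step :: "step list \<Rightarrow> step list \<Rightarrow> bool" where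
  "ascent_step P Q \<longleftrightarrow>
     (\<exists>xs ys k. k \<ge> 1 \<and>
        P = xs @ [Down] @ replicate k Up @ [Down] @ ys \<and>
        Q = xs @ replicate k Up @ [Down, Down] @ ys)"

definition ascent_le :: "nat \<Rightarrow> step list \<Rightarrow> step list \<Rightarrow> bool" where
  "ascent_le n P Q \<longleftrightarrow> P \<in> dyck_paths n \<and> Q \<in> dyck_paths n \<and>
     (\<lambda>P' Q'. P' \<in> dyck_paths n \<and> Q' \<in> dyck_paths n \<and> ascent_step P' Q')\<^sup>*\<^sup>* P Q"

definition ascent_intervals :: "nat \<Rightarrow> (step list \<times> step list) set" where
  "ascent_intervals n =
     {(P, Q). P \<in> dyck_paths n \<and> Q \<in> dyck_paths n \<and> ascent_le n P Q}"

definition num_intervals :: "nat \<Rightarrow> nat" where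
  "num_intervals n = card (ascent_intervals n)"

text \<open>The sum starts at $n = 1$, so the interval of the empty path is not counted.\<close>

definition interval_gf :: "rat fps" where
  "interval_gf = Abs_fps (\<lambda>n. if n \<ge> 1 then of_nat (num_intervals n) else 0)"

text \<open>The field $K(t)$, as a subfield of the field $K((t))$ of formal Laurent series.\<close>

definition rational_fls :: "'a::field fls set" where
  "rational_fls =
     {fps_to_fls (fps_of_poly p) / fps_to_fls (fps_of_poly q) | p q. q \<noteq> 0}"

text \<open>\<open>p\<close> is the minimal polynomial of \<open>x\<close> over the subfield \<open>K\<close> of the ambient field.\<close>

definition is_minimal_poly :: "'a::field set \<Rightarrow> 'a \<Rightarrow> 'a poly \<Rightarrow> bool" where
  "is_minimal_poly K x p \<longleftrightarrow>
     (\<forall>i. coeff p i \<in> K) \<and> lead_coeff p = 1 \<and> poly p x = 0 \<and>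
     (\<forall>q. (\<forall>i. coeff q i \<in> K) \<and> q \<noteq> 0 \<and> poly q x = 0 \<longrightarrow> degree p \<le> degree q)"

definition algebraic_of_degree :: "'a::field set \<Rightarrow> 'a \<Rightarrow> nat \<Rightarrow> bool" where
  "algebraic_of_degree K x d \<longleftrightarrow> (\<exists>p. is_minimal_poly K x p \<and> degree p = d)"

end

theory Submission
  imports
    Defs
    "HOL-Library.Sublist"
    "HOL-Complex_Analysis.Complex_Analysis"
    "HOL-Probability.Probability"
    "HOL-Real_Asymp.Real_Asymp"
begin

text \<open>
  A path is encoded by the list \<open>\<alpha>\<close> that records, for each \<open>Down\<close>, the number of \<open>Up\<close> steps after it.
  A cover relation overwrites an entry of \<open>\<alpha>\<close> by its smaller right neighbour, so \<open>\<beta>\<close> lies above \<open>\<alpha>\<close> iff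
  each \<open>\<beta>\<^sub>i\<close> is at most \<open>\<alpha>\<^sub>i\<close> and occurs in \<open>\<alpha>\<close> at position \<open>i\<close> or further right. Building such pairs
  from the right, with two statistics marked by \<open>u = 1 + a\<close> and \<open>v = 1 + b\<close>, gives a series \<open>H(a,b)\<close> with
  \<open>(a b - t (1+a)(1+b)(1+a+b)) H(a,b) = a b + R(0) - R(a) - R(b)\<close> and \<open>R(0) = G\<close>.

  On the zero set of the kernel, \<open>R(a) + R(b) = a b + R(0)\<close>. There the maps \<open>(a,b) \<mapsto> (b, (1+b)/a)\<close> have
  order 5, and this makes \<open>a b\<close> decouple as \<open>f(a) + f(b)\<close> with \<open>f\<close> rational, so \<open>(R(a) - f(a) - R(0)/2)\<^sup>2\<close>
  is invariant under \<open>a \<leftrightarrow> b\<close>. A rational invariant \<open>J(a)\<close> with a simple pole at \<open>0\<close> removes the poles, and an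
  invariant without a pole does not depend on \<open>a\<close>. Evaluating at the two small points with \<open>a = b\<close> yields \<open>R(0)\<close>.

  The asymptotic estimate uses \<open>G'' = 6 (1+Z)\<^sup>3 (1+2Z)\<^sup>5\<close>: Lagrange inversion then expresses
  \<open>n (n-1) (n-2) g(n)\<close> as one coefficient of \<open>(13 + 16z) ((1+z)(1+2z)\<^sup>2)\<^sup>n\<close>, with no cancellation left,
  and Laplace's method applies to its Cauchy integral.
\<close>

section \<open>Dyck paths as lists\<close>

text \<open>The kernel is not solved for \<open>b\<close> by an algebraic series. Small reals
  \<open>a\<close>, \<open>b\<close> are chosen freely and determine \<open>t\<close>; the bound
  \<open>12 ^ n\<close> on the coefficients makes all series converge. The identity found for small
  positive reals returns to formal series because zeros of analytic functions are isolated.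

  For fixed \<open>a\<close> and \<open>t\<close> the kernel is quadratic in \<open>b\<close>, with
  roots \<open>a_2\<close> and \<open>a_5\<close> of product \<open>1 + a\<close>. Reversing the
  five-cycle about \<open>a_1\<close> exchanges them, so \<open>E = a_2 a_3 + a_4 a_5\<close> and
  \<open>O = a_1 a_2 + a_3 a_4 + a_5 a_1\<close> are rational in \<open>a\<close> and
  \<open>1 / t\<close>, the product of all five terms. Recentring at \<open>b\<close> gives
  \<open>a b = O(a) - E(b) = O(b) - E(a)\<close>, hence \<open>f = (O - E) / 2\<close>; the
  invariant is \<open>J = O + E\<close>. With \<open>y = R(a) - R(0) / 2\<close> the invariant
  square minus \<open>J^2 / 4\<close> is \<open>(y - O) (y + E)\<close>, which at 0 has only a
  simple pole, removed by a multiple of \<open>J\<close>.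

  On the diagonal the kernel is a cubic in \<open>a\<close> with two small roots. Calling the third
  root \<open>1 / (2 z)\<close> makes \<open>t\<close> rational in \<open>z\<close>, and
  \<open>z\<close> is the series Z.\<close>

fun ups_after :: "step list \<Rightarrow> nat list" where
  "ups_after [] = []"
| "ups_after (Up # w) = ups_after w"
| "ups_after (Down # w) = count_list w Up # ups_after w"

text \<open>Inverse of \<open>ups_after\<close>. The argument \<open>n\<close> counts the Up steps
  still to be written, of which \<open>c\<close> must remain behind the next Down step.\<close>

fun path_of :: "nat \<Rightarrow> nat list \<Rightarrow> step list" where
  "path_of n [] = replicate n Up"
| "path_of n (c # l) = replicate (n - c) Up @ Down # path_of c l"

text \<open>An entry \<open>c\<close> belongs to a Down step with \<open>length l\<close> Down steps
  behind it, so \<open>c \<le> length l\<close> is the Dyck condition for that suffix.\<close>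

fun ballot_list :: "nat list \<Rightarrow> bool" where
  "ballot_list [] \<longleftrightarrow> True"
| "ballot_list (c # l) \<longleftrightarrow> c \<le> length l \<and> (l \<noteq> [] \<longrightarrow> hd l \<le> c) \<and> ballot_list l"

lemma ups_after_replicate_Up: "ups_after (replicate k Up @ w) = ups_after w"
  by (induction k) auto

lemma ups_after_replicate: "ups_after (replicate k Up) = []"
  by (induction k) auto

lemma count_list_replicate: "count_list (replicate k x) y = (if x = y then k else 0)"
  by (induction k) auto

lemma length_ups_after: "length (ups_after w) = count_list w Down"
  by (induction w rule: ups_after.induct) auto

lemma ballot_list_hd_le:
  "ballot_list l \<Longrightarrow> x \<in> set l \<Longrightarrow> x \<le> hd l"
proof (induction l)
  case (Cons c l)
  then have "x = c \<or> x \<le> hd l" "l \<noteq> [] \<Longrightarrow> hd l \<le> c" by auto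
  then show ?case using Cons.prems by (cases l) auto
qed simp

lemma height_simps [simp]:
  "Defs.height [] = 0" "Defs.height (Up # w) = Defs.height w + 1" "Defs.height (Down # w) = Defs.height w - 1"
  by (auto simp: height_def)

lemma height_append [simp]: "Defs.height (u @ v) = Defs.height u + Defs.height v"
  by (simp add: height_def)

lemma height_eq_count: "Defs.height w = int (count_list w Up) - int (count_list w Down)"
proof (induction w)
  case (Cons a w) then show ?case by (cases a) auto
qed auto

text \<open>Appending \<open>[0]\<close> gives the list of a word without Down steps the head
  0.\<close>

lemma hd_ups_after_le: "hd (ups_after w @ [0]) \<le> count_list w Up"
  by (induction w rule: ups_after.induct) simp_all

lemma all_suffix_Cons:
  "(\<forall>v. suffix v (x # w) \<longrightarrow> P v) \<longleftrightarrow> P (x # w) \<and> (\<forall>v. suffix v w \<longrightarrow> P v)"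
  unfolding suffix_Cons by blast

text \<open>Among suffixes that begin in one run of Up steps the longest is the worst, so the
  suffixes directly behind a Down step and the whole word decide.\<close>

lemma ballot_list_ups_after:
  "(\<forall>v. suffix v w \<longrightarrow> count_list v Up \<le> count_list v Down) \<longleftrightarrow>
     ballot_list (ups_after w) \<and> count_list w Up \<le> count_list w Down"
proof (induction w rule: ups_after.induct)
  case 1
  show ?case by simp
next
  case (2 w)
  show ?case unfolding all_suffix_Cons 2 by simp linarith
next
  case (3 w)
  have "ups_after w \<noteq> [] \<longrightarrow> hd (ups_after w) \<le> count_list w Up"
    using hd_ups_after_le[of w] by (cases "ups_after w") simp_all
  then show ?case unfolding all_suffix_Cons 3 by (simp add: length_ups_after) linarith
qed

text \<open>The final height is 0, so a prefix is nonnegative exactly when the complementary suffix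
  has at most as many Up as Down steps.\<close>

lemma dyck_paths_iff:
  "w \<in> dyck_paths n \<longleftrightarrow>
     count_list w Up = n \<and> count_list w Down = n \<and> ballot_list (ups_after w)"
proof (cases "count_list w Up = n \<and> count_list w Down = n")
  case True
  then have h: "Defs.height w = 0" by (simp add: height_eq_count)
  have take: "Defs.height (take i w) \<ge> 0 \<longleftrightarrow> count_list (drop i w) Up \<le> count_list (drop i w) Down" for i
  proof -
    have "Defs.height (take i w) + Defs.height (drop i w) = 0"
      using h by (metis append_take_drop_id height_append)
    then show ?thesis using height_eq_count[of "drop i w"] by linarith
  qed
  have "(\<forall>i\<le>length w. Defs.height (take i w) \<ge> 0) \<longleftrightarrow>
        (\<forall>v. suffix v w \<longrightarrow> count_list v Up \<le> count_list v Down)"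
    (is "?L \<longleftrightarrow> ?R")
  proof
    assume L: ?L
    show ?R
    proof (intro allI impI)
      fix v assume "suffix v w"
      then obtain u where "w = u @ v" by (auto simp: suffix_def)
      then show "count_list v Up \<le> count_list v Down"
        using L[rule_format, of "length u"] take[of "length u"] by simp
    qed
  next
    assume ?R
    then show ?L using take suffix_drop by blast
  qed
  then show ?thesis
    using True h unfolding dyck_paths_def ballot_list_ups_after by simp
next
  case False
  then show ?thesis unfolding dyck_paths_def by blast
qed

lemma path_of_Suc: "hd (l @ [0]) \<le> n \<Longrightarrow> path_of (Suc n) l = Up # path_of n l"
  by (cases l) (auto simp: Suc_diff_le)

lemma path_of_ups_after: "path_of (count_list w Up) (ups_after w) = w"
proof (induction w rule: ups_after.induct)
  case (2 w)
  then show ?case using path_of_Suc[OF hd_ups_after_le] by simp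
qed simp_all

lemma path_of_props:
  "ballot_list l \<Longrightarrow> hd (l @ [0]) \<le> n \<Longrightarrow>
     ups_after (path_of n l) = l \<and> count_list (path_of n l) Up = n \<and>
     count_list (path_of n l) Down = length l"
proof (induction n l rule: path_of.induct)
  case (1 n)
  then show ?case by (simp add: count_list_replicate ups_after_replicate)
next
  case (2 n c l)
  then have "hd (l @ [0]) \<le> c" by (cases l) auto
  then show ?case using 2 by (simp add: ups_after_replicate_Up count_list_replicate)
qed

definition ballot_lists :: "nat \<Rightarrow> nat list set" where
  "ballot_lists n = {l. ballot_list l \<and> length l = n}"

lemma bij_betw_ups_after: "bij_betw ups_after (dyck_paths n) (ballot_lists n)"
proof (rule bij_betw_byWitness[where f' = "path_of n"])
  show "\<forall>w\<in>dyck_paths n. path_of n (ups_after w) = w"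
  proof
    fix w assume "w \<in> dyck_paths n"
    then show "path_of n (ups_after w) = w"
      using path_of_ups_after[of w] by (simp add: dyck_paths_iff)
  qed
  have *: "ups_after (path_of n l) = l \<and> path_of n l \<in> dyck_paths n" if "l \<in> ballot_lists n" for l
  proof -
    have "ballot_list l" "length l = n" using that by (simp_all add: ballot_lists_def)
    moreover from this have "hd (l @ [0]) \<le> n" by (cases l) simp_all
    ultimately show ?thesis
      using path_of_props[of l n] by (simp add: dyck_paths_iff)
  qed
  show "\<forall>l\<in>ballot_lists n. ups_after (path_of n l) = l"
    using * by blast
  show "path_of n ` ballot_lists n \<subseteq> dyck_paths n"
    using * by blast
  show "ups_after ` dyck_paths n \<subseteq> ballot_lists n"
  proof (intro subsetI, elim imageE)
    fix l w assume "l = ups_after w" "w \<in> dyck_paths n"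
    then show "l \<in> ballot_lists n"
      by (simp add: dyck_paths_iff ballot_lists_def length_ups_after)
  qed
qed

section \<open>The ascent order transported to lists\<close>

definition list_step :: "nat list \<Rightarrow> nat list \<Rightarrow> bool" where
  "list_step l l' \<longleftrightarrow> (\<exists>l1 l2 c d. c < d \<and> l = l1 @ [d, c] @ l2 \<and> l' = l1 @ [c, c] @ l2)"

lemma ups_after_append:
  "ups_after (u @ v) = map (\<lambda>c. c + count_list v Up) (ups_after u) @ ups_after v"
  by (induction u rule: ups_after.induct) auto

lemma list_step_ups_after:
  assumes "ascent_step P Q"
  shows "list_step (ups_after P) (ups_after Q)"
proof -
  obtain xs ys k where k: "k \<ge> 1"
    and P: "P = xs @ [Down] @ replicate k Up @ [Down] @ ys"
    and Q: "Q = xs @ replicate k Up @ [Down, Down] @ ys"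
    using assms unfolding ascent_step_def by blast
  let ?m = "map (\<lambda>c. c + (k + count_list ys Up)) (ups_after xs)"
  have "ups_after P = ?m @ [k + count_list ys Up, count_list ys Up] @ ups_after ys"
    by (simp add: P ups_after_append ups_after_replicate count_list_replicate)
  moreover have "ups_after Q = ?m @ [count_list ys Up, count_list ys Up] @ ups_after ys"
    by (simp add: Q ups_after_append ups_after_replicate count_list_replicate)
  moreover have "count_list ys Up < k + count_list ys Up" using k by simp
  ultimately show ?thesis unfolding list_step_def by blast
qed

lemma ballot_list_step: "list_step l l' \<Longrightarrow> ballot_list l \<Longrightarrow> ballot_list l'"
proof -
  assume "list_step l l'"
  then obtain l1 l2 c d where *: "c < d" "l = l1 @ [d, c] @ l2" "l' = l1 @ [c, c] @ l2"
    unfolding list_step_def by blast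
  have "ballot_list (l1 @ [d, c] @ l2) \<Longrightarrow> ballot_list (l1 @ [c, c] @ l2)"
    using \<open>c < d\<close>
  proof (induction l1)
    case (Cons a l1) then show ?case by (cases l1) auto
  qed auto
  then show "ballot_list l \<Longrightarrow> ballot_list l'" using * by simp
qed

lemma ascent_step_path_of:
  assumes "list_step l l'" "ballot_list l" "hd (l @ [0]) \<le> n"
  shows "ascent_step (path_of n l) (path_of n l')"
proof -
  obtain l1 l2 c d where *: "c < d" "l = l1 @ [d, c] @ l2" "l' = l1 @ [c, c] @ l2"
    using assms(1) unfolding list_step_def by blast
  have "ascent_step (path_of n (l1 @ [d, c] @ l2)) (path_of n (l1 @ [c, c] @ l2))"
    using assms(2,3) unfolding *
  proof (induction l1 arbitrary: n)
    case Nil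
    \<comment> \<open>The difference \<open>d - c\<close> is the length of the ascent between the
      two Down steps, hence the \<open>k\<close> of the cover relation.\<close>
    then have "n - c = (n - d) + (d - c)" using \<open>c < d\<close> by auto
    then have "path_of n ([] @ [c, c] @ l2) =
      replicate (n - d) Up @ replicate (d - c) Up @ [Down, Down] @ path_of c l2"
      by (simp add: replicate_add)
    moreover have "path_of n ([] @ [d, c] @ l2) =
      replicate (n - d) Up @ [Down] @ replicate (d - c) Up @ [Down] @ path_of c l2"
      by simp
    moreover have "d - c \<ge> 1" using \<open>c < d\<close> by simp
    ultimately show ?case unfolding ascent_step_def by metis
  next
    case (Cons a l1)
    have "hd ((l1 @ [d, c] @ l2) @ [0]) \<le> a" using Cons.prems by (cases l1) auto
    then have "ascent_step (path_of a (l1 @ [d, c] @ l2)) (path_of a (l1 @ [c, c] @ l2))"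
      using Cons by simp
    then obtain xs ys k where "k \<ge> 1" "path_of a (l1 @ [d, c] @ l2) = xs @ [Down] @ replicate k Up @ [Down] @ ys"
      "path_of a (l1 @ [c, c] @ l2) = xs @ replicate k Up @ [Down, Down] @ ys"
      unfolding ascent_step_def by blast
    then show ?case unfolding ascent_step_def
      by (intro exI[of _ "replicate (n - a) Up @ Down # xs"] exI[of _ ys] exI[of _ k]) auto
  qed
  then show ?thesis using * by simp
qed

text \<open>The image of the ascent order under \<open>ups_after\<close>, without reference to chains of cover relations.\<close>

fun list_le :: "nat list \<Rightarrow> nat list \<Rightarrow> bool" where
  "list_le [] [] \<longleftrightarrow> True"
| "list_le (a # l) (b # m) \<longleftrightarrow> b \<le> a \<and> b \<in> set (a # l) \<and> list_le l m"
| "list_le _ _ \<longleftrightarrow> False"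

lemma list_le_refl: "list_le l l"
  by (induction l) auto

lemma list_le_length: "list_le l m \<Longrightarrow> length l = length m"
  by (induction l m rule: list_le.induct) auto

text \<open>The new entry \<open>c\<close> is below \<open>d\<close>, and \<open>l\<close> already
  contains it further right because of the old entry \<open>c\<close> next to
  \<open>d\<close>.\<close>

lemma list_le_step:
  assumes "list_le l m" "list_step m m'"
  shows "list_le l m'"
proof -
  obtain m1 m2 c d where *: "c < d" "m = m1 @ [d, c] @ m2" "m' = m1 @ [c, c] @ m2"
    using assms(2) unfolding list_step_def by blast
  have "list_le l (m1 @ [c, c] @ m2)"
    using assms(1) unfolding *
  proof (induction m1 arbitrary: l)
    case Nil
    then have "length l = Suc (Suc (length m2))" using list_le_length[of l] by fastforce
    then obtain x y l' where "l = x # y # l'" by (metis length_Suc_conv)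
    then show ?case using Nil \<open>c < d\<close> by auto
  next
    case (Cons a m1)
    then show ?case by (cases l) auto
  qed
  then show ?thesis using * by simp
qed

lemma list_step_Cons: "list_step l l' \<Longrightarrow> list_step (a # l) (a # l')"
proof -
  assume "list_step l l'"
  then obtain l1 l2 c d where "c < d" "l = l1 @ [d, c] @ l2" "l' = l1 @ [c, c] @ l2"
    unfolding list_step_def by blast
  then show "list_step (a # l) (a # l')"
    unfolding list_step_def by (intro exI[of _ "a # l1"] exI[of _ l2] exI[of _ c] exI[of _ d]) simp
qed

text \<open>The step overwrites the last \<open>a\<close> of the initial run of \<open>a\<close>s.
  When the recursion puts another \<open>a\<close> in front, the set inclusion guarantees that
  \<open>b\<close>, being different from \<open>a\<close>, still occurs in the new tail.\<close>

lemma list_le_descend_hd: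
  assumes "ballot_list (a # l)" "list_le (a # l) (b # m)" "ballot_list (b # m)" "b < a"
  shows "\<exists>l'. list_step (a # l) l' \<and> list_le l' (b # m) \<and> set (a # l) \<subseteq> insert a (set l')"
  using assms
proof (induction l arbitrary: b m)
  case (Cons c l)
  obtain b' m' where m: "m = b' # m'" "list_le (c # l) (b' # m')"
    using Cons.prems(2) by (cases m) auto
  show ?case
  proof (cases "c = a")
    case True
    have "b' \<le> b" using Cons.prems(3) m by simp
    then obtain l' where l': "list_step (a # l) l'" "list_le l' m" "set (a # l) \<subseteq> insert a (set l')"
      using Cons.IH[of b' m'] Cons.prems m True by auto
    have "list_le (a # l') (b # m)" using l' Cons.prems True by auto
    then show ?thesis using l' list_step_Cons[OF l'(1), of a] True
      by (intro exI[of _ "a # l'"] conjI) auto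
  next
    case False
    then have c: "c < a" using Cons.prems by auto
    then have "b \<in> set (c # l)" using Cons.prems by auto
    then have "b \<le> c" using Cons.prems(1) ballot_list_hd_le[of "c # l" b] by auto
    then have "list_le (c # c # l) (b # m)" using Cons.prems(2) \<open>b \<in> set (c # l)\<close> by auto
    moreover have "list_step (a # c # l) (c # c # l)"
      unfolding list_step_def using c by (metis append_Cons append_Nil)
    ultimately show ?thesis by auto
  qed
qed auto

text \<open>The common prefix is kept; at the first disagreement \<open>list_le\<close> forces
  \<open>b < a\<close>, and \<open>list_le_descend_hd\<close> applies.\<close>

lemma list_le_ex_step:
  assumes "ballot_list l" "ballot_list m" "list_le l m" "l \<noteq> m"
  shows "\<exists>l'. list_step l l' \<and> list_le l' m"
  using assms
proof (induction l m rule: list_le.induct)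
  case (2 a l b m)
  show ?case
  proof (cases "b = a")
    case True
    then obtain l' where "list_step l l'" "list_le l' m" using 2 by auto
    then show ?thesis using list_step_Cons[of l l' a] True by (intro exI[of _ "a # l'"]) auto
  next
    case False
    then show ?thesis using list_le_descend_hd[of a l b m] 2 by auto
  qed
qed auto

lemma list_step_sum_list: "list_step l l' \<Longrightarrow> sum_list l' < sum_list l"
  unfolding list_step_def by auto

lemma list_le_iff:
  assumes "ballot_list l" "ballot_list m"
  shows "list_le l m \<longleftrightarrow> list_step\<^sup>*\<^sup>* l m"
proof
  show "list_step\<^sup>*\<^sup>* l m \<Longrightarrow> list_le l m"
    by (induction rule: rtranclp_induct) (auto intro: list_le_refl list_le_step)
  show "list_le l m \<Longrightarrow> list_step\<^sup>*\<^sup>* l m"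
    using assms
  \<comment> \<open>Every step lowers the sum of the list, so repeated steps towards
    \<open>m\<close> terminate.\<close>
  proof (induction "sum_list l" arbitrary: l rule: less_induct)
    case less
    show ?case
    proof (cases "l = m")
      case False
      then obtain l' where l': "list_step l l'" "list_le l' m"
        using list_le_ex_step less.prems by blast
      then have "list_step\<^sup>*\<^sup>* l' m"
        using less.hyps[of l'] list_step_sum_list ballot_list_step less.prems by blast
      then show ?thesis using l' by (meson converse_rtranclp_into_rtranclp)
    qed auto
  qed
qed

lemma ascent_le_iff:
  assumes P: "P \<in> dyck_paths n" and Q: "Q \<in> dyck_paths n"
  shows "ascent_le n P Q \<longleftrightarrow> list_le (ups_after P) (ups_after Q)"
proof -
  let ?r = "\<lambda>P Q. P \<in> dyck_paths n \<and> Q \<in> dyck_paths n \<and> ascent_step P Q"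
  have bal: "ballot_list (ups_after P)" if "P \<in> dyck_paths n" for P
    using that by (simp add: dyck_paths_iff)
  have "list_step\<^sup>*\<^sup>* (ups_after P) (ups_after Q)" if "?r\<^sup>*\<^sup>* P Q" for P Q
    using that by (induction rule: rtranclp_induct)
      (auto dest: list_step_ups_after intro: rtranclp.rtrancl_into_rtrancl)
  \<comment> \<open>Conversely a chain of list steps lifts along \<open>path_of\<close>; all its
    lists are ballot lists, so the intermediate paths are Dyck paths, as the closure in
    \<open>ascent_le\<close> demands.\<close>
  moreover have "?r\<^sup>*\<^sup>* P (path_of n m) \<and> path_of n m \<in> dyck_paths n \<and> m \<in> ballot_lists n"
    if "list_step\<^sup>*\<^sup>* (ups_after P) m" for m
    using that
  proof (induction rule: rtranclp_induct)
    case base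
    then show ?case using P path_of_ups_after[of P]
      by (auto simp: dyck_paths_iff ballot_lists_def length_ups_after)
  next
    case (step m m')
    have "length m' = length m" using step(2) by (auto simp: list_step_def)
    then have m': "m' \<in> ballot_lists n"
      using step ballot_list_step by (auto simp: ballot_lists_def)
    have hd: "hd (l @ [0]) \<le> n" if "l \<in> ballot_lists n" for l
      using that by (cases l) (auto simp: ballot_lists_def)
    have "path_of n m' \<in> dyck_paths n"
      using path_of_props[of m' n] m' hd by (auto simp: dyck_paths_iff ballot_lists_def)
    moreover have "ascent_step (path_of n m) (path_of n m')"
      using step hd by (intro ascent_step_path_of) (auto simp: ballot_lists_def)
    ultimately have "?r (path_of n m) (path_of n m')" using step by blast
    moreover have "?r\<^sup>*\<^sup>* P (path_of n m)" using step by blast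
    ultimately have "?r\<^sup>*\<^sup>* P (path_of n m')" by (metis (no_types, lifting) rtranclp.rtrancl_into_rtrancl)
    then show ?case using m' \<open>path_of n m' \<in> dyck_paths n\<close> by blast
  qed
  ultimately have "?r\<^sup>*\<^sup>* P Q \<longleftrightarrow> list_step\<^sup>*\<^sup>* (ups_after P) (ups_after Q)"
    using path_of_ups_after[of Q] Q by (metis (no_types, lifting) dyck_paths_iff)
  then show ?thesis
    using list_le_iff[OF bal[OF P] bal[OF Q]] P Q unfolding ascent_le_def by blast
qed

definition list_intervals :: "nat \<Rightarrow> (nat list \<times> nat list) set" where
  "list_intervals n = {(l, m). l \<in> ballot_lists n \<and> m \<in> ballot_lists n \<and> list_le l m}"

lemma num_intervals_eq: "num_intervals n = card (list_intervals n)"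
proof -
  have inj: "inj_on ups_after (dyck_paths n)" and im: "ups_after ` dyck_paths n = ballot_lists n"
    using bij_betw_ups_after[of n] by (simp_all add: bij_betw_def)
  have sub: "ascent_intervals n \<subseteq> dyck_paths n \<times> dyck_paths n"
    unfolding ascent_intervals_def by blast
  have "inj_on (map_prod ups_after ups_after) (ascent_intervals n)"
    by (rule inj_on_subset[OF map_prod_inj_on[OF inj inj] sub])
  moreover have "map_prod ups_after ups_after ` ascent_intervals n = list_intervals n"
  proof (intro equalityI subsetI)
    fix z assume "z \<in> map_prod ups_after ups_after ` ascent_intervals n"
    then obtain P Q where PQ: "(P, Q) \<in> ascent_intervals n" and z: "z = (ups_after P, ups_after Q)"
      by (metis imageE map_prod_simp surj_pair)
    then have P: "P \<in> dyck_paths n" "Q \<in> dyck_paths n" "ascent_le n P Q"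
      unfolding ascent_intervals_def by blast+
    then have "ups_after P \<in> ballot_lists n" "ups_after Q \<in> ballot_lists n"
      using im by blast+
    then show "z \<in> list_intervals n"
      using P ascent_le_iff[OF P(1,2)] unfolding z list_intervals_def by simp
  next
    fix z assume "z \<in> list_intervals n"
    then obtain l m where z: "z = (l, m)" "l \<in> ballot_lists n" "m \<in> ballot_lists n" "list_le l m"
      unfolding list_intervals_def by blast
    then obtain P Q where P: "P \<in> dyck_paths n" "Q \<in> dyck_paths n" "l = ups_after P" "m = ups_after Q"
      using im by (metis imageE)
    then have "(P, Q) \<in> ascent_intervals n"
      using z ascent_le_iff[OF P(1,2)] unfolding ascent_intervals_def by simp
    then show "z \<in> map_prod ups_after ups_after ` ascent_intervals n"
      using z P by (intro rev_image_eqI[of "(P, Q)"]) simp_all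
  qed
  ultimately show ?thesis
    unfolding num_intervals_def by (metis card_image)
qed

section \<open>The generating polynomial of intervals\<close>

text \<open>Counted from the top, the elements of \<open>X\<close> down to \<open>b0\<close> have 0,
  1, 2, ... larger elements, so the sum is geometric. A new maximum raises every other rank by
  one.\<close>

lemma sum_powers_rank:
  fixes v :: real and X :: "nat set"
  assumes "finite X" "b0 \<in> X"
  shows "(v - 1) * (\<Sum>b | b \<in> X \<and> b0 \<le> b. v ^ card {c \<in> X. b < c}) = v ^ Suc (card {c \<in> X. b0 < c}) - 1"
  using assms
proof (induction X rule: finite_linorder_max_induct)
  case (insert m X)
  have above: "{c \<in> insert m X. b < c} = insert m {c \<in> X. b < c}" if "b \<in> X" for b
    using insert.hyps that by auto
  have nin: "m \<notin> X" using insert.hyps by auto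
  have card: "card {c \<in> insert m X. b < c} = Suc (card {c \<in> X. b < c})" if "b \<in> X" for b
    unfolding above[OF that] using insert.hyps(1) nin by simp
  have m: "{c \<in> insert m X. m < c} = {}" using insert.hyps by auto
  show ?case
  proof (cases "b0 = m")
    case True
    have "{b. b \<in> insert m X \<and> b0 \<le> b} = {m}" using True insert.hyps by auto
    then show ?thesis unfolding True m by (simp add: m del: insert_iff)
  next
    case False
    then have b0: "b0 \<in> X" using insert.prems by blast
    have "{b. b \<in> insert m X \<and> b0 \<le> b} = insert m {b. b \<in> X \<and> b0 \<le> b}"
      using insert.hyps b0 by fastforce
    moreover have fin: "finite {b. b \<in> X \<and> b0 \<le> b}" and nin': "m \<notin> {b. b \<in> X \<and> b0 \<le> b}"
      using insert.hyps(1) nin by simp_all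
    ultimately have "(\<Sum>b | b \<in> insert m X \<and> b0 \<le> b. v ^ card {c \<in> insert m X. b < c}) =
      v ^ card {c \<in> insert m X. m < c} + (\<Sum>b | b \<in> X \<and> b0 \<le> b. v ^ card {c \<in> insert m X. b < c})"
      by (simp only: sum.insert[OF fin nin'])
    also have "v ^ card {c \<in> insert m X. m < c} = 1" unfolding m by simp
    also have "(\<Sum>b | b \<in> X \<and> b0 \<le> b. v ^ card {c \<in> insert m X. b < c}) =
      v * (\<Sum>b | b \<in> X \<and> b0 \<le> b. v ^ card {c \<in> X. b < c})"
      unfolding sum_distrib_left by (rule sum.cong) (simp_all add: card del: insert_iff)
    finally have "(v - 1) * (\<Sum>b | b \<in> insert m X \<and> b0 \<le> b. v ^ card {c \<in> insert m X. b < c}) =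
      (v - 1) + v * ((v - 1) * (\<Sum>b | b \<in> X \<and> b0 \<le> b. v ^ card {c \<in> X. b < c}))"
      by (simp add: algebra_simps)
    then show ?thesis unfolding insert.IH[OF b0] card[OF b0] by (simp add: algebra_simps)
  qed
qed simp

text \<open>The possible heads when an interval is extended by one \<open>Down\<close> step on the left.\<close>

definition head_extensions :: "nat list \<times> nat list \<Rightarrow> (nat \<times> nat) set" where
  "head_extensions = (\<lambda>(l, m). SIGMA a:{hd l..length l}. {b \<in> set (a # l). hd m \<le> b})"

lemma list_intervals_Suc:
  assumes "n \<ge> 1"
  shows "list_intervals (Suc n) =
    (\<lambda>((l, m), (a, b)). (a # l, b # m)) ` (SIGMA p:list_intervals n. head_extensions p)"
proof (intro equalityI subsetI)
  fix z assume "z \<in> list_intervals (Suc n)"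
  then obtain l' m' where z: "z = (l', m')" "ballot_list l'" "length l' = Suc n" "ballot_list m'"
     "length m' = Suc n" "list_le l' m'"
    unfolding list_intervals_def ballot_lists_def by blast
  obtain a l where l: "l' = a # l" "length l = n" using z(3) by (metis length_Suc_conv)
  obtain b m where m: "m' = b # m" "length m = n" using z(5) by (metis length_Suc_conv)
  have "l \<noteq> []" "m \<noteq> []" using l m assms by auto
  then have "((l, m), (a, b)) \<in> (SIGMA p:list_intervals n. head_extensions p)"
    using z l m by (simp add: list_intervals_def ballot_lists_def head_extensions_def)
  then show "z \<in> (\<lambda>((l, m), (a, b)). (a # l, b # m)) ` (SIGMA p:list_intervals n. head_extensions p)"
    using z l m by (intro rev_image_eqI[of "((l, m), (a, b))"]) simp_all
next
  fix z assume "z \<in> (\<lambda>((l, m), (a, b)). (a # l, b # m)) ` (SIGMA p:list_intervals n. head_extensions p)"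
  then obtain l m a b where z: "z = (a # l, b # m)" "(l, m) \<in> list_intervals n"
    "(a, b) \<in> head_extensions (l, m)" by (elim imageE SigmaE) (force split: prod.splits)
  then have lm: "ballot_list l" "length l = n" "ballot_list m" "length m = n" "list_le l m"
    by (simp_all add: list_intervals_def ballot_lists_def)
  have ab: "hd l \<le> a" "a \<le> length l" "b \<in> set (a # l)" "hd m \<le> b"
    using z(3) by (simp_all add: head_extensions_def)
  have "b \<le> a"
    using ab(1,3) ballot_list_hd_le[OF lm(1), of b] by auto
  then show "z \<in> list_intervals (Suc n)"
    using z(1) lm ab by (simp add: list_intervals_def ballot_lists_def)
qed

text \<open>The exponents are the room left for the next head of the first list and the number of
  distinct values above the current head of the second; they govern \<open>head_extensions\<close>.
  The index is shifted: \<open>n\<close> belongs to size \<open>n + 1\<close>, where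
  \<open>hd l\<close> is at most \<open>n\<close>.\<close>

definition interval_poly :: "nat \<Rightarrow> real \<Rightarrow> real \<Rightarrow> real" where
  "interval_poly n u v =
     (\<Sum>(l, m)\<in>list_intervals (Suc n). u ^ (n - hd l) * v ^ card {c \<in> set l. hd m < c})"

lemma finite_ballot_lists: "finite (ballot_lists n)"
proof (rule finite_subset)
  show "ballot_lists n \<subseteq> {l. set l \<subseteq> {..n} \<and> length l = n}"
  proof
    fix l assume "l \<in> ballot_lists n"
    then have l: "ballot_list l" "length l = n" by (simp_all add: ballot_lists_def)
    have "hd l \<le> n" if "l \<noteq> []" using l that by (cases l) simp_all
    then show "l \<in> {l. set l \<subseteq> {..n} \<and> length l = n}"
      using ballot_list_hd_le[OF l(1)] l(2) by fastforce
  qed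
qed (simp add: finite_lists_length_eq)

lemma finite_list_intervals: "finite (list_intervals n)"
  by (rule finite_subset[of _ "ballot_lists n \<times> ballot_lists n"])
    (auto simp: list_intervals_def finite_ballot_lists)

lemma interval_poly_1_1: "interval_poly n 1 1 = real (num_intervals (Suc n))"
  by (simp add: interval_poly_def num_intervals_eq)

lemma interval_poly_0: "interval_poly 0 u v = 1"
proof -
  have "list_intervals (Suc 0) = {([0], [0])}"
    by (auto simp: list_intervals_def ballot_lists_def length_Suc_conv)
  moreover have "{c \<in> set [0 :: nat]. hd [0] < c} = {}" by auto
  then have "v ^ card {c \<in> set [0 :: nat]. hd [0] < c} = 1" by (simp only: card.empty power_0)
  ultimately show ?thesis unfolding interval_poly_def by (simp del: list.set list.sel)
qed

lemma sum_powers_diff: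
  fixes u :: real
  assumes "k \<le> N"
  shows "(u - 1) * (\<Sum>a\<in>{k..N}. u ^ (N - a)) = u ^ Suc (N - k) - 1"
proof -
  have "(\<Sum>a\<in>{k..N}. u ^ (N - a)) = (\<Sum>i\<in>{..N - k}. u ^ i)"
    by (rule sum.reindex_bij_witness[of _ "\<lambda>i. N - i" "\<lambda>a. N - a"]) (use assms in auto)
  then show ?thesis
    using power_diff_1_eq[of u "Suc (N - k)"] by (simp add: lessThan_Suc_atMost)
qed

text \<open>The sum over \<open>b\<close> is geometric by ranks, then so is the one over
  \<open>a\<close>. The value \<open>a = hd l\<close> stands apart because it adds no new element to
  \<open>set l\<close>: it yields \<open>v * Y\<close> where every other \<open>a\<close> yields
  \<open>v ^ 2 * Y\<close>.\<close>

lemma head_extensions_sum: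
  fixes u v :: real
  assumes "(l, m) \<in> list_intervals (Suc n)"
  defines "X \<equiv> u ^ (n - hd l)" and "Y \<equiv> v ^ card {c \<in> set l. hd m < c}"
  shows "(u - 1) * (v - 1) *
      (\<Sum>(a, b)\<in>head_extensions (l, m). u ^ (Suc n - a) * v ^ card {c \<in> set (a # l). b < c}) =
     u * v * (u + v - 1) * (X * Y) + 1 - u ^ 2 * X - v ^ 2 * Y"
proof -
  have l: "ballot_list l" "length l = Suc n" "ballot_list m" "length m = Suc n" "list_le l m"
    using assms by (simp_all add: list_intervals_def ballot_lists_def)
  have ne: "l \<noteq> []" "m \<noteq> []" using l by auto
  have hdl: "hd l \<le> n" using l(1,2) by (cases l) simp_all
  have hdm: "hd m \<in> set l" using l(5) ne by (cases l; cases m) auto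
  have inner: "(v - 1) * (\<Sum>b | b \<in> set (a # l) \<and> hd m \<le> b. v ^ card {c \<in> set (a # l). b < c}) =
     (if a = hd l then v * Y - 1 else v ^ 2 * Y - 1)" if "a \<ge> hd l" for a
  proof -
    have "card {c \<in> set (a # l). hd m < c} =
      (if a = hd l then 0 else 1) + card {c \<in> set l. hd m < c}"
    proof (cases "a = hd l")
      case True
      then have "set (a # l) = set l" using ne by auto
      then show ?thesis using True by (simp del: list.set)
    next
      case False
      then have "a > x" if "x \<in> set l" for x
        using ballot_list_hd_le[OF l(1) that] \<open>a \<ge> hd l\<close> by simp
      then have "{c \<in> set (a # l). hd m < c} = insert a {c \<in> set l. hd m < c}" "a \<notin> set l"
        using hdm by auto
      then show ?thesis using False by simp
    qed
    then show ?thesis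
      using sum_powers_rank[of "set (a # l)" "hd m" v] hdm by (simp add: Y_def power2_eq_square)
  qed
  have "(\<Sum>(a, b)\<in>head_extensions (l, m). u ^ (Suc n - a) * v ^ card {c \<in> set (a # l). b < c}) =
     (\<Sum>a\<in>{hd l..Suc n}. u ^ (Suc n - a) *
        (\<Sum>b | b \<in> set (a # l) \<and> hd m \<le> b. v ^ card {c \<in> set (a # l). b < c}))"
    unfolding head_extensions_def prod.case l(2)
    by (subst sum.Sigma[symmetric]) (simp_all add: sum_distrib_left del: list.set sum.cl_ivl_Suc)
  then have "(v - 1) * (\<Sum>(a, b)\<in>head_extensions (l, m). u ^ (Suc n - a) * v ^ card {c \<in> set (a # l). b < c}) =
     (\<Sum>a\<in>{hd l..Suc n}. u ^ (Suc n - a) *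
        ((v - 1) * (\<Sum>b | b \<in> set (a # l) \<and> hd m \<le> b. v ^ card {c \<in> set (a # l). b < c})))"
    by (simp only: sum_distrib_left mult.left_commute)
  also have "\<dots> = (\<Sum>a\<in>{hd l..Suc n}. u ^ (Suc n - a) * (if a = hd l then v * Y - 1 else v ^ 2 * Y - 1))"
    by (rule sum.cong) (simp_all add: inner del: list.set)
  also have "{hd l..Suc n} = insert (hd l) {Suc (hd l)..Suc n}" using hdl by auto
  also have "(\<Sum>a\<in>\<dots>. u ^ (Suc n - a) * (if a = hd l then v * Y - 1 else v ^ 2 * Y - 1)) =
     u ^ (Suc n - hd l) * (v * Y - 1) + (\<Sum>a\<in>{Suc (hd l)..Suc n}. u ^ (Suc n - a) * (v ^ 2 * Y - 1))"
    by (subst sum.insert) (auto intro!: sum.cong)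
  also have "\<dots> = u * X * (v * Y - 1) + (\<Sum>a\<in>{Suc (hd l)..Suc n}. u ^ (Suc n - a)) * (v ^ 2 * Y - 1)"
    using hdl by (simp add: X_def Suc_diff_le sum_distrib_right del: sum.cl_ivl_Suc)
  finally have main: "(v - 1) * (\<Sum>(a, b)\<in>head_extensions (l, m). u ^ (Suc n - a) * v ^ card {c \<in> set (a # l). b < c}) =
     u * X * (v * Y - 1) + (\<Sum>a\<in>{Suc (hd l)..Suc n}. u ^ (Suc n - a)) * (v ^ 2 * Y - 1)"
    (is "_ * ?S = _ + ?T * _") .
  have T: "(u - 1) * ?T = u * X - 1"
    using hdl by (subst sum_powers_diff) (simp_all add: X_def)
  have "(u - 1) * (v - 1) * ?S = (u - 1) * ((v - 1) * ?S)" by (simp only: mult.assoc)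
  also have "\<dots> = (u - 1) * (u * X * (v * Y - 1)) + ((u - 1) * ?T) * (v ^ 2 * Y - 1)"
    unfolding main by (simp only: ring_distribs mult.assoc)
  also have "\<dots> = u * v * (u + v - 1) * (X * Y) + 1 - u ^ 2 * X - v ^ 2 * Y"
    unfolding T by (simp add: algebra_simps power2_eq_square)
  finally show ?thesis .
qed

text \<open>The kernel equation coefficient by coefficient: summed over all intervals, the isolated
  powers of \<open>u\<close> and of \<open>v\<close> in \<open>head_extensions_sum\<close> become
  specialisations at 1.\<close>

lemma interval_poly_Suc:
  "(u - 1) * (v - 1) * interval_poly (Suc n) u v =
     u * v * (u + v - 1) * interval_poly n u v + interval_poly n 1 1
     - u ^ 2 * interval_poly n u 1 - v ^ 2 * interval_poly n 1 v"
proof -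
  let ?w = "\<lambda>(l :: nat list, m :: nat list). card {c \<in> set l. hd m < c}"
  let ?E = "\<lambda>((l :: nat list, m :: nat list), (a, b)). (a # l, b # m)"
  have inj: "inj_on ?E S" for S by (auto simp: inj_on_def)
  have fin: "finite (head_extensions p)" for p
    by (auto simp: head_extensions_def split: prod.split)
  have "interval_poly (Suc n) u v =
     (\<Sum>q\<in>(SIGMA p:list_intervals (Suc n). head_extensions p). (case ?E q of (l, m) \<Rightarrow>
        u ^ (Suc n - hd l) * v ^ card {c \<in> set l. hd m < c}))"
    unfolding interval_poly_def list_intervals_Suc[of "Suc n", simplified]
    by (subst sum.reindex[OF inj]) (simp add: o_def)
  also have "\<dots> = (\<Sum>(p, q)\<in>(SIGMA p:list_intervals (Suc n). head_extensions p).
        case p of (l, m) \<Rightarrow> case q of (a, b) \<Rightarrow> u ^ (Suc n - a) * v ^ card {c \<in> set (a # l). b < c})"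
    by (rule sum.cong) auto
  also have "\<dots> = (\<Sum>p\<in>list_intervals (Suc n). \<Sum>q\<in>head_extensions p.
       case p of (l, m) \<Rightarrow> case q of (a, b) \<Rightarrow> u ^ (Suc n - a) * v ^ card {c \<in> set (a # l). b < c})"
    by (rule sum.Sigma[symmetric]) (simp_all add: finite_list_intervals fin)
  finally have "(u - 1) * (v - 1) * interval_poly (Suc n) u v =
    (\<Sum>p\<in>list_intervals (Suc n). (u - 1) * (v - 1) * (\<Sum>q\<in>head_extensions p.
       case p of (l, m) \<Rightarrow> case q of (a, b) \<Rightarrow> u ^ (Suc n - a) * v ^ card {c \<in> set (a # l). b < c}))"
    by (simp only: sum_distrib_left)
  also have "\<dots> = (\<Sum>p\<in>list_intervals (Suc n). case p of (l, m) \<Rightarrow>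
      u * v * (u + v - 1) * (u ^ (n - hd l) * v ^ card {c \<in> set l. hd m < c}) + 1
      - u ^ 2 * u ^ (n - hd l) - v ^ 2 * v ^ card {c \<in> set l. hd m < c})"
  proof (rule sum.cong[OF refl])
    fix p assume p: "p \<in> list_intervals (Suc n)"
    obtain l m where lm: "p = (l, m)" by (cases p)
    show "(u - 1) * (v - 1) * (\<Sum>q\<in>head_extensions p.
       case p of (l, m) \<Rightarrow> case q of (a, b) \<Rightarrow> u ^ (Suc n - a) * v ^ card {c \<in> set (a # l). b < c}) =
      (case p of (l, m) \<Rightarrow>
      u * v * (u + v - 1) * (u ^ (n - hd l) * v ^ card {c \<in> set l. hd m < c}) + 1
      - u ^ 2 * u ^ (n - hd l) - v ^ 2 * v ^ card {c \<in> set l. hd m < c})"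
      using head_extensions_sum[of l m n u v] p unfolding lm prod.case by blast
  qed
  also have "\<dots> = u * v * (u + v - 1) * interval_poly n u v + interval_poly n 1 1
     - u ^ 2 * interval_poly n u 1 - v ^ 2 * interval_poly n 1 v"
    by (simp add: interval_poly_def sum_distrib_left case_prod_unfold sum.distrib sum_subtractf)
  finally show ?thesis .
qed

lemma interval_poly_nonneg: "u \<ge> 0 \<Longrightarrow> v \<ge> 0 \<Longrightarrow> interval_poly n u v \<ge> 0"
  unfolding interval_poly_def by (intro sum_nonneg) auto

text \<open>At \<open>u = v = 2\<close> the factor \<open>(u - 1) * (v - 1)\<close> is 1 and
  \<open>u * v * (u + v - 1)\<close> is 12, while the other terms of the recursion add up to at most
  0.\<close>

lemma interval_poly_bound:
  assumes "\<bar>u\<bar> \<le> 2" "\<bar>v\<bar> \<le> 2"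
  shows "\<bar>interval_poly n u v\<bar> \<le> 12 ^ n"
proof -
  have "\<bar>interval_poly n u v\<bar> \<le> interval_poly n 2 2"
    unfolding interval_poly_def
  proof (rule sum_abs[THEN order_trans], rule sum_mono)
    fix p :: "nat list \<times> nat list"
    show "\<bar>case p of (l, m) \<Rightarrow> u ^ (n - hd l) * v ^ card {c \<in> set l. hd m < c}\<bar> \<le>
      (case p of (l, m) \<Rightarrow> 2 ^ (n - hd l) * 2 ^ card {c \<in> set l. hd m < c})"
      using assms by (auto simp: abs_mult power_abs intro!: mult_mono power_mono split: prod.split)
  qed
  also have "interval_poly n 2 2 \<le> 12 ^ n"
  proof (induction n)
    case (Suc n)
    have "interval_poly n 1 1 \<le> interval_poly n 2 1"
      unfolding interval_poly_def by (intro sum_mono) auto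
    then have "interval_poly (Suc n) 2 2 \<le> 12 * interval_poly n 2 2"
      using interval_poly_Suc[of 2 2 n] interval_poly_nonneg[of 2 1 n] interval_poly_nonneg[of 1 2 n] by simp
    then show ?case using Suc by simp
  qed (simp add: interval_poly_0)
  finally show ?thesis .
qed

lemma continuous_interval_poly:
  assumes "continuous F f" "continuous F g"
  shows "continuous F (\<lambda>x. interval_poly n (f x) (g x))"
  unfolding interval_poly_def case_prod_unfold by (intro continuous_intros assms)

lemma continuous_eq_at_isolated_exception:
  fixes f g :: "real \<Rightarrow> real"
  assumes "isCont f a" "isCont g a" "\<And>x. x \<noteq> a \<Longrightarrow> f x = g x"
  shows "f x = g x"
proof (cases "x = a")
  case True
  have "f \<midarrow>a\<rightarrow> f a" "g \<midarrow>a\<rightarrow> g a" using assms(1,2) by (simp_all add: isCont_def)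
  moreover have "f \<midarrow>a\<rightarrow> g a \<longleftrightarrow> g \<midarrow>a\<rightarrow> g a" by (rule LIM_cong) (simp_all add: assms(3))
  ultimately show ?thesis using True LIM_unique by blast
qed (use assms(3) in blast)

text \<open>The definition does not show this symmetry, but the recursion has it. Division by
  \<open>(u - 1) * (v - 1)\<close> proves the claim away from 1, and continuity fills the gap. Two
  unknown univariate series thereby become one.\<close>

lemma interval_poly_commute: "interval_poly n u v = interval_poly n v u"
proof (induction n arbitrary: u v)
  case (Suc n)
  let ?h = "interval_poly (Suc n)"
  have 1: "?h x y = ?h y x" if "x \<noteq> 1" "y \<noteq> 1" for x y
  proof -
    have "(x - 1) * (y - 1) * ?h x y = (x - 1) * (y - 1) * ?h y x"
      using interval_poly_Suc[of x y n] interval_poly_Suc[of y x n]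
        Suc[of x y] Suc[of x 1] Suc[of y 1] by (simp add: algebra_simps)
    then show ?thesis using that by simp
  qed
  have 2: "?h x y = ?h y x" if "x \<noteq> 1" for x y
    by (rule continuous_eq_at_isolated_exception[where a = 1 and f = "\<lambda>y. ?h x y"])
      (use 1 that in \<open>auto intro!: continuous_interval_poly continuous_intros\<close>)
  show ?case
    by (rule continuous_eq_at_isolated_exception[where a = 1 and f = "\<lambda>x. ?h x v"])
      (use 2 in \<open>auto intro!: continuous_interval_poly continuous_intros\<close>)
qed (simp add: interval_poly_0)

section \<open>Invariant series on the kernel curve\<close>

text \<open>Series in \<open>t\<close> whose coefficients are functions of \<open>a\<close>,
  continuous at 0 and geometrically bounded uniformly in \<open>a\<close>: just enough for the
  invariant argument, and closed under sums and products.\<close>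

definition unif_series :: "(real \<Rightarrow> real \<Rightarrow> real) \<Rightarrow> bool" where
  "unif_series F \<longleftrightarrow> (\<exists>f C M. C \<ge> 0 \<and> M > 0 \<and> (\<forall>n. isCont (f n) 0) \<and>
     (\<forall>n a. \<bar>a\<bar> \<le> 1/2 \<longrightarrow> \<bar>f n a\<bar> \<le> C * M ^ n) \<and>
     (\<forall>a t. \<bar>a\<bar> \<le> 1/2 \<longrightarrow> M * \<bar>t\<bar> < 1 \<longrightarrow> F a t = (\<Sum>n. f n a * t ^ n)))"

lemma summable_geometric_bound:
  fixes f :: "nat \<Rightarrow> real"
  assumes "\<And>n. \<bar>f n\<bar> \<le> C * M ^ n" "M > 0" "M * \<bar>t\<bar> < 1"
  shows "summable (\<lambda>n. \<bar>f n * t ^ n\<bar>)" "summable (\<lambda>n. f n * t ^ n)"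
proof -
  have g: "summable (\<lambda>n. C * (M * \<bar>t\<bar>) ^ n)"
    using assms by (intro summable_mult summable_geometric) (simp add: abs_mult)
  have b: "\<bar>f n * t ^ n\<bar> \<le> C * (M * \<bar>t\<bar>) ^ n" for n
    using mult_right_mono[OF assms(1)[of n], of "\<bar>t\<bar> ^ n"]
    by (simp add: abs_mult power_abs power_mult_distrib mult.assoc)
  show "summable (\<lambda>n. \<bar>f n * t ^ n\<bar>)"
    by (rule summable_comparison_test'[OF g, where N = 0]) (simp only: real_norm_def abs_idempotent b)
  then show "summable (\<lambda>n. f n * t ^ n)" by (rule summable_rabs_cancel)
qed

lemma unif_series_const:
  assumes "isCont c 0" "\<And>a. \<bar>a\<bar> \<le> 1/2 \<Longrightarrow> \<bar>c a\<bar> \<le> B"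
  shows "unif_series (\<lambda>a t. c a)"
  unfolding unif_series_def
proof (intro exI conjI allI impI)
  let ?f = "\<lambda>n a. if n = 0 then c a else 0"
  show "\<bar>B\<bar> \<ge> 0" "(1::real) > 0" by simp_all
  show "isCont (?f n) 0" for n using assms(1) by (cases "n = 0") simp_all
  show "\<bar>?f n a\<bar> \<le> \<bar>B\<bar> * 1 ^ n" if "\<bar>a\<bar> \<le> 1/2" for n a
    using assms(2)[OF that] abs_ge_zero[of "c a"] by (cases "n = 0") simp_all
  show "c a = (\<Sum>n. ?f n a * t ^ n)" for a t
    using suminf_finite[of "{0}" "\<lambda>n. ?f n a * t ^ n"] by simp
qed

lemma unif_series_t: "unif_series (\<lambda>a t. t)"
  unfolding unif_series_def
proof (intro exI conjI allI impI)
  let ?f = "\<lambda>n (a :: real). if n = 1 then 1 else 0 :: real"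
  show "(1::real) \<ge> 0" "(1::real) > 0" by simp_all
  show "isCont (?f n) 0" for n by simp
  show "\<bar>?f n a\<bar> \<le> 1 * 1 ^ n" for n :: nat and a :: real by simp
  show "t = (\<Sum>n. ?f n a * t ^ n)" for a t :: real
    using suminf_finite[of "{1}" "\<lambda>n. ?f n a * t ^ n"] by simp
qed

lemma unif_seriesE2:
  assumes "unif_series F" "unif_series G"
  obtains f g C M where "C \<ge> 0" "M > 0" "\<And>n. isCont (f n) 0" "\<And>n. isCont (g n) 0"
    "\<And>n a. \<bar>a\<bar> \<le> 1/2 \<Longrightarrow> \<bar>f n a\<bar> \<le> C * M ^ n" "\<And>n a. \<bar>a\<bar> \<le> 1/2 \<Longrightarrow> \<bar>g n a\<bar> \<le> C * M ^ n"
    "\<And>a t. \<bar>a\<bar> \<le> 1/2 \<Longrightarrow> M * \<bar>t\<bar> < 1 \<Longrightarrow> F a t = (\<Sum>n. f n a * t ^ n)"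
    "\<And>a t. \<bar>a\<bar> \<le> 1/2 \<Longrightarrow> M * \<bar>t\<bar> < 1 \<Longrightarrow> G a t = (\<Sum>n. g n a * t ^ n)"
proof -
  obtain f C M where f: "C \<ge> 0" "M > 0" "\<And>n. isCont (f n) 0"
    "\<And>n a. \<bar>a\<bar> \<le> 1/2 \<Longrightarrow> \<bar>f n a\<bar> \<le> C * M ^ n"
    "\<And>a t. \<bar>a\<bar> \<le> 1/2 \<Longrightarrow> M * \<bar>t\<bar> < 1 \<Longrightarrow> F a t = (\<Sum>n. f n a * t ^ n)"
    using assms(1) unfolding unif_series_def by blast
  obtain g D N where g: "D \<ge> 0" "N > 0" "\<And>n. isCont (g n) 0"
    "\<And>n a. \<bar>a\<bar> \<le> 1/2 \<Longrightarrow> \<bar>g n a\<bar> \<le> D * N ^ n"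
    "\<And>a t. \<bar>a\<bar> \<le> 1/2 \<Longrightarrow> N * \<bar>t\<bar> < 1 \<Longrightarrow> G a t = (\<Sum>n. g n a * t ^ n)"
    using assms(2) unfolding unif_series_def by blast
  have *: "C * M ^ n \<le> max C D * max M N ^ n" "D * N ^ n \<le> max C D * max M N ^ n" for n
    using f(1,2) g(1,2) by (auto intro!: mult_mono power_mono)
  have **: "M * \<bar>t\<bar> < 1 \<and> N * \<bar>t\<bar> < 1" if "max M N * \<bar>t\<bar> < 1" for t
    using that mult_right_mono[of M "max M N" "\<bar>t\<bar>"] mult_right_mono[of N "max M N" "\<bar>t\<bar>"] by auto
  show thesis
  proof (rule that[of "max C D" "max M N" f g])
    show "max C D \<ge> 0" "max M N > 0" using f(1,2) g(1,2) by auto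
    show "isCont (f n) 0" "isCont (g n) 0" for n by (rule f(3) g(3))+
    show "\<bar>f n a\<bar> \<le> max C D * max M N ^ n" if "\<bar>a\<bar> \<le> 1/2" for n a
      using f(4)[OF that, of n] *(1)[of n] by linarith
    show "\<bar>g n a\<bar> \<le> max C D * max M N ^ n" if "\<bar>a\<bar> \<le> 1/2" for n a
      using g(4)[OF that, of n] *(2)[of n] by linarith
    show "F a t = (\<Sum>n. f n a * t ^ n)" if "\<bar>a\<bar> \<le> 1/2" "max M N * \<bar>t\<bar> < 1" for a t
      using f(5) ** that by blast
    show "G a t = (\<Sum>n. g n a * t ^ n)" if "\<bar>a\<bar> \<le> 1/2" "max M N * \<bar>t\<bar> < 1" for a t
      using g(5) ** that by blast
  qed
qed

lemma unif_series_add: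
  assumes "unif_series F" "unif_series G"
  shows "unif_series (\<lambda>a t. F a t + G a t)"
proof -
  obtain f g C M where *: "C \<ge> 0" "M > 0" "\<And>n. isCont (f n) 0" "\<And>n. isCont (g n) 0"
    "\<And>n a. \<bar>a\<bar> \<le> 1/2 \<Longrightarrow> \<bar>f n a\<bar> \<le> C * M ^ n" "\<And>n a. \<bar>a\<bar> \<le> 1/2 \<Longrightarrow> \<bar>g n a\<bar> \<le> C * M ^ n"
    "\<And>a t. \<bar>a\<bar> \<le> 1/2 \<Longrightarrow> M * \<bar>t\<bar> < 1 \<Longrightarrow> F a t = (\<Sum>n. f n a * t ^ n)"
    "\<And>a t. \<bar>a\<bar> \<le> 1/2 \<Longrightarrow> M * \<bar>t\<bar> < 1 \<Longrightarrow> G a t = (\<Sum>n. g n a * t ^ n)"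
    by (rule unif_seriesE2[OF assms]) blast
  show ?thesis
    unfolding unif_series_def
  proof (intro exI conjI allI impI)
    show "2 * C \<ge> 0" "M > 0" using *(1,2) by simp_all
    show "isCont (\<lambda>a. f n a + g n a) 0" for n using *(3,4) by (intro continuous_intros)
    show "\<bar>f n a + g n a\<bar> \<le> 2 * C * M ^ n" if "\<bar>a\<bar> \<le> 1/2" for n a
      using *(5,6)[OF that, of n] by linarith
    show "F a t + G a t = (\<Sum>n. (f n a + g n a) * t ^ n)" if "\<bar>a\<bar> \<le> 1/2" "M * \<bar>t\<bar> < 1" for a t
      unfolding *(7,8)[OF that] ring_distribs
      by (rule suminf_add) (rule summable_geometric_bound(2)[OF *(5)[OF that(1)] *(2) that(2)],
        rule summable_geometric_bound(2)[OF *(6)[OF that(1)] *(2) that(2)])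
  qed
qed

lemma unif_series_mult:
  assumes "unif_series F" "unif_series G"
  shows "unif_series (\<lambda>a t. F a t * G a t)"
proof -
  obtain f g C M where *: "C \<ge> 0" "M > 0" "\<And>n. isCont (f n) 0" "\<And>n. isCont (g n) 0"
    "\<And>n a. \<bar>a\<bar> \<le> 1/2 \<Longrightarrow> \<bar>f n a\<bar> \<le> C * M ^ n" "\<And>n a. \<bar>a\<bar> \<le> 1/2 \<Longrightarrow> \<bar>g n a\<bar> \<le> C * M ^ n"
    "\<And>a t. \<bar>a\<bar> \<le> 1/2 \<Longrightarrow> M * \<bar>t\<bar> < 1 \<Longrightarrow> F a t = (\<Sum>n. f n a * t ^ n)"
    "\<And>a t. \<bar>a\<bar> \<le> 1/2 \<Longrightarrow> M * \<bar>t\<bar> < 1 \<Longrightarrow> G a t = (\<Sum>n. g n a * t ^ n)"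
    by (rule unif_seriesE2[OF assms]) blast
  let ?h = "\<lambda>n a. \<Sum>i\<le>n. f i a * g (n - i) a"
  show ?thesis
    unfolding unif_series_def
  proof (intro exI conjI allI impI)
    \<comment> \<open>The \<open>n + 1\<close> terms of a Cauchy coefficient are absorbed by
      \<open>Suc n \<le> 2 ^ n\<close>, which doubles \<open>M\<close>.\<close>
    show "C * C \<ge> 0" "2 * M > 0" using *(1,2) by simp_all
    show "isCont (?h n) 0" for n using *(3,4) by (intro continuous_intros)
    show "\<bar>?h n a\<bar> \<le> C * C * (2 * M) ^ n" if "\<bar>a\<bar> \<le> 1/2" for n a
    proof -
      have "\<bar>?h n a\<bar> \<le> (\<Sum>i\<le>n. C * C * M ^ n)"
      proof (rule sum_abs[THEN order_trans], rule sum_mono)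
        fix i assume "i \<in> {..n}"
        then have "M ^ i * M ^ (n - i) = M ^ n" by (simp flip: power_add)
        moreover have "\<bar>f i a * g (n - i) a\<bar> \<le> (C * M ^ i) * (C * M ^ (n - i))"
          unfolding abs_mult using *(1,2)
          by (intro mult_mono *(5)[OF that] *(6)[OF that]) simp_all
        ultimately show "\<bar>f i a * g (n - i) a\<bar> \<le> C * C * M ^ n" by (simp add: ac_simps)
      qed
      also have "\<dots> = (real (Suc n)) * (C * C * M ^ n)" by simp
      also have "\<dots> \<le> 2 ^ n * (C * C * M ^ n)"
      proof (rule mult_right_mono)
        have "Suc n \<le> 2 ^ n" by (induction n) auto
        then show "real (Suc n) \<le> 2 ^ n" by (metis of_nat_le_iff of_nat_numeral of_nat_power)
      qed (use *(1,2) in simp)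
      finally show ?thesis by (simp add: power_mult_distrib ac_simps)
    qed
    show "F a t * G a t = (\<Sum>n. ?h n a * t ^ n)" if "\<bar>a\<bar> \<le> 1/2" "2 * M * \<bar>t\<bar> < 1" for a t
    proof -
      have t: "M * \<bar>t\<bar> < 1" using that(2) *(2) mult_nonneg_nonneg[of M "\<bar>t\<bar>"] by linarith
      have "(\<Sum>n. f n a * t ^ n) * (\<Sum>n. g n a * t ^ n) = (\<Sum>n. \<Sum>i\<le>n. f i a * t ^ i * (g (n - i) a * t ^ (n - i)))"
        using summable_geometric_bound(1)[OF *(5)[OF that(1)] *(2) t]
          summable_geometric_bound(1)[OF *(6)[OF that(1)] *(2) t]
        by (intro Cauchy_product) simp_all
      also have "(\<lambda>n. \<Sum>i\<le>n. f i a * t ^ i * (g (n - i) a * t ^ (n - i))) = (\<lambda>n. ?h n a * t ^ n)"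
      proof (rule ext)
        fix n
        have "f i a * t ^ i * (g (n - i) a * t ^ (n - i)) = f i a * g (n - i) a * t ^ n" if "i \<le> n" for i
        proof -
          have "t ^ n = t ^ i * t ^ (n - i)" using that by (simp flip: power_add)
          then show ?thesis by simp
        qed
        then show "(\<Sum>i\<le>n. f i a * t ^ i * (g (n - i) a * t ^ (n - i))) = ?h n a * t ^ n"
          unfolding sum_distrib_right by (intro sum.cong) simp_all
      qed
      finally show ?thesis using *(7,8)[OF that(1) t] by simp
    qed
  qed
qed

lemma unif_series_diff:
  assumes "unif_series F" "unif_series G"
  shows "unif_series (\<lambda>a t. F a t - G a t)"
proof -
  have "unif_series (\<lambda>a t. (-1) * G a t)"
    by (intro unif_series_mult assms unif_series_const[where B = 1]) simp_all
  from unif_series_add[OF assms(1) this] show ?thesis by simp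
qed

text \<open>The curve \<open>t = curve a b\<close> is the zero set of the kernel of the functional equation.\<close>

definition curve :: "real \<Rightarrow> real \<Rightarrow> real" where
  "curve a b = a * b / ((1 + a) * (1 + b) * (1 + a + b))"

lemma curve_tendsto_0:
  assumes "\<bar>a\<bar> < 1/2"
  shows "((\<lambda>b. curve a b) \<longlongrightarrow> 0) (at 0)"
proof -
  have "isCont (curve a) 0"
    unfolding curve_def using assms by (intro continuous_intros) auto
  moreover have "curve a 0 = 0" by (simp add: curve_def)
  ultimately show ?thesis unfolding isCont_def by metis
qed

text \<open>On the curve \<open>t\<close> vanishes as \<open>b\<close> tends to \<open>0\<close>, so an invariant series is constant in \<open>a\<close> to
  leading order in \<open>t\<close>; iterate.\<close>

lemma invariant_unif_series:
  assumes "unif_series F" "0 < \<epsilon>" "\<epsilon> \<le> 1/2"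
    and inv: "\<And>a b. a \<noteq> 0 \<Longrightarrow> b \<noteq> 0 \<Longrightarrow> \<bar>a\<bar> < \<epsilon> \<Longrightarrow> \<bar>b\<bar> < \<epsilon> \<Longrightarrow>
       F a (curve a b) = F b (curve a b)"
  shows "\<exists>\<rho>>0. \<forall>a t. \<bar>a\<bar> < \<epsilon> \<longrightarrow> \<bar>t\<bar> < \<rho> \<longrightarrow> F a t = F 0 t"
proof -
  obtain f C M where f: "C \<ge> 0" "M > 0" "\<And>n. isCont (f n) 0"
    "\<And>n a. \<bar>a\<bar> \<le> 1/2 \<Longrightarrow> \<bar>f n a\<bar> \<le> C * M ^ n"
    "\<And>a t. \<bar>a\<bar> \<le> 1/2 \<Longrightarrow> M * \<bar>t\<bar> < 1 \<Longrightarrow> F a t = (\<Sum>n. f n a * t ^ n)"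
    using assms(1) unfolding unif_series_def by blast
  have tail: "\<exists>r. F a t = (\<Sum>j<n. f j a * t ^ j) + t ^ n * (f n a + r) \<and> \<bar>r\<bar> \<le> 2 * C * M ^ Suc n * \<bar>t\<bar>"
    if a: "\<bar>a\<bar> \<le> 1/2" and t: "M * \<bar>t\<bar> \<le> 1/2" for a t n
  proof -
    have t1: "M * \<bar>t\<bar> < 1" using t by simp
    have bnd: "\<bar>f (k + Suc n) a\<bar> \<le> (C * M ^ Suc n) * M ^ k" for k
      using f(4)[OF a, of "k + Suc n"] by (simp add: power_add ac_simps)
    have sm: "summable (\<lambda>k. \<bar>f (k + Suc n) a * t ^ k\<bar>)" "summable (\<lambda>k. f (k + Suc n) a * t ^ k)"
      using summable_geometric_bound[OF bnd f(2) t1] by simp_all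
    let ?s = "\<Sum>k. f (k + Suc n) a * t ^ k"
    have "F a t = (\<Sum>k. f (k + Suc n) a * t ^ (k + Suc n)) + (\<Sum>j<Suc n. f j a * t ^ j)"
      unfolding f(5)[OF a t1]
      by (rule suminf_split_initial_segment[OF summable_geometric_bound(2)[OF f(4)[OF a] f(2) t1]])
    also have "(\<Sum>k. f (k + Suc n) a * t ^ (k + Suc n)) = t ^ Suc n * ?s"
      unfolding suminf_mult[OF sm(2), symmetric] by (simp add: power_add ac_simps)
    finally have "F a t = (\<Sum>j<n. f j a * t ^ j) + t ^ n * (f n a + t * ?s)"
      by (simp add: algebra_simps)
    moreover have "\<bar>?s\<bar> \<le> 2 * C * M ^ Suc n"
    proof -
      have "\<bar>?s\<bar> \<le> (\<Sum>k. \<bar>f (k + Suc n) a * t ^ k\<bar>)" by (rule summable_rabs[OF sm(1)])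
      also have "\<dots> \<le> (\<Sum>k. (C * M ^ Suc n) * (1/2) ^ k)"
      proof (rule suminf_le[OF _ sm(1)])
        fix k
        have "\<bar>f (k + Suc n) a * t ^ k\<bar> \<le> (C * M ^ Suc n) * M ^ k * \<bar>t\<bar> ^ k"
          using mult_right_mono[OF bnd[of k], of "\<bar>t\<bar> ^ k"] by (simp add: abs_mult power_abs)
        also have "\<dots> = (C * M ^ Suc n) * (M * \<bar>t\<bar>) ^ k" by (simp add: power_mult_distrib)
        also have "\<dots> \<le> (C * M ^ Suc n) * (1/2) ^ k"
          using f(1,2) t by (intro mult_left_mono power_mono) simp_all
        finally show "\<bar>f (k + Suc n) a * t ^ k\<bar> \<le> (C * M ^ Suc n) * (1/2) ^ k" .
      qed (intro summable_mult summable_geometric, simp)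
      also have "\<dots> = (C * M ^ Suc n) * 2"
        by (subst suminf_mult) (simp_all add: suminf_geometric summable_geometric)
      finally show ?thesis by simp
    qed
    then have "\<bar>t * ?s\<bar> \<le> 2 * C * M ^ Suc n * \<bar>t\<bar>"
      unfolding abs_mult using mult_left_mono[of "\<bar>?s\<bar>" "2 * C * M ^ Suc n" "\<bar>t\<bar>"] by (simp add: ac_simps)
    ultimately show ?thesis by blast
  qed
  have const: "f n a = f n 0" if "\<bar>a\<bar> < \<epsilon>" for n a
    using that
  proof (induction n arbitrary: a rule: less_induct)
    case (less n)
    show ?case
    proof (cases "a = 0")
      case False
      have a: "\<bar>a\<bar> < 1/2" "\<bar>a\<bar> \<le> 1/2" using less.prems assms(3) by simp_all
      have ev_t: "eventually (\<lambda>b. \<bar>curve a b\<bar> < 1 / (2 * M)) (at 0)"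
        using order_tendstoD(2)[OF tendsto_rabs[OF curve_tendsto_0[OF a(1)]], of "1 / (2 * M)"] f(2) by simp
      have ev_b: "eventually (\<lambda>b::real. \<bar>b\<bar> < \<epsilon>) (at 0)"
        using assms(2) by (auto simp: eventually_at dist_real_def)
      have ev_0: "eventually (\<lambda>b::real. b \<noteq> 0) (at 0)"
        by (simp add: eventually_at_filter)
      \<comment> \<open>The lower coefficients agree at \<open>a\<close> and \<open>b\<close> by
        induction. After cancelling the \<open>n\<close>-th power of \<open>t = curve a b\<close>,
        the difference of the \<open>n\<close>-th coefficients is of order \<open>t\<close>.\<close>
      have bound: "eventually (\<lambda>b. norm (f n a - f n b) \<le> 4 * C * M ^ Suc n * \<bar>curve a b\<bar>) (at 0)"
        using ev_t ev_b ev_0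
      proof eventually_elim
        case (elim b)
        let ?t = "curve a b"
        have t: "M * \<bar>?t\<bar> \<le> 1/2" using elim(1) f(2) by (simp add: field_simps)
        have t0: "?t \<noteq> 0"
          using False elim a assms(3) by (simp add: curve_def) linarith
        have b: "\<bar>b\<bar> \<le> 1/2" using elim assms(3) by simp
        obtain r where r: "F a ?t = (\<Sum>j<n. f j a * ?t ^ j) + ?t ^ n * (f n a + r)" "\<bar>r\<bar> \<le> 2 * C * M ^ Suc n * \<bar>?t\<bar>"
          using tail[OF a(2) t] by blast
        obtain s where s: "F b ?t = (\<Sum>j<n. f j b * ?t ^ j) + ?t ^ n * (f n b + s)" "\<bar>s\<bar> \<le> 2 * C * M ^ Suc n * \<bar>?t\<bar>"
          using tail[OF b t] by blast
        have "f j a = f j b" if "j < n" for j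
          using less.IH[OF that less.prems] less.IH[OF that elim(2)] by simp
        then have "(\<Sum>j<n. f j a * ?t ^ j) = (\<Sum>j<n. f j b * ?t ^ j)"
          by (intro sum.cong) simp_all
        moreover have "F a ?t = F b ?t" by (rule inv[OF False elim(3) less.prems elim(2)])
        ultimately have "f n a + r = f n b + s" using r(1) s(1) t0 by simp
        then show ?case unfolding real_norm_def using r(2) s(2) by linarith
      qed
      have "((\<lambda>b. 4 * C * M ^ Suc n * \<bar>curve a b\<bar>) \<longlongrightarrow> 4 * C * M ^ Suc n * \<bar>0\<bar>) (at 0)"
        by (intro tendsto_intros curve_tendsto_0 a)
      then have "((\<lambda>b. 4 * C * M ^ Suc n * \<bar>curve a b\<bar>) \<longlongrightarrow> 0) (at 0)" by simp
      from Lim_null_comparison[OF bound this] have "((\<lambda>b. f n a - f n b) \<longlongrightarrow> 0) (at 0)" .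
      moreover have "((\<lambda>b. f n a - f n b) \<longlongrightarrow> f n a - f n 0) (at 0)"
        by (intro tendsto_diff tendsto_const) (rule f(3)[of n, unfolded isCont_def])
      ultimately have "0 = f n a - f n 0" by (rule LIM_unique)
      then show ?thesis by simp
    qed simp
  qed
  have "F a t = F 0 t" if "\<bar>a\<bar> < \<epsilon>" "\<bar>t\<bar> < 1 / M" for a t
  proof -
    have "M * \<bar>t\<bar> < 1" using that(2) f(2) by (simp add: field_simps)
    moreover have "\<bar>a\<bar> \<le> 1/2" using that assms by simp
    ultimately have "F a t = (\<Sum>n. f n a * t ^ n)" "F 0 t = (\<Sum>n. f n 0 * t ^ n)"
      using f(5)[of a t] f(5)[of 0 t] by simp_all
    then show ?thesis using const[OF that(1)] by presburger
  qed
  then show ?thesis using f(2) by (intro exI[of _ "1 / M"] conjI) (simp, blast)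
qed

section \<open>The functional equation\<close>

text \<open>The coefficient of \<open>t ^ Suc n\<close> in the series R(a) of the overview.\<close>

definition catalytic_coeff :: "nat \<Rightarrow> real \<Rightarrow> real" where
  "catalytic_coeff n a = (1 + a)\<^sup>2 * interval_poly n (1 + a) 1"

text \<open>The divided difference of \<open>catalytic_coeff n\<close> at 0, written with geometric
  sums so that it makes sense at \<open>a = 0\<close>; the 2 in the range accounts for the factor
  \<open>(1 + a)\<^sup>2\<close>.\<close>

definition catalytic_quot :: "nat \<Rightarrow> real \<Rightarrow> real" where
  "catalytic_quot n a = (\<Sum>(l, m)\<in>list_intervals (Suc n). \<Sum>i<n - hd l + 2. (1 + a) ^ i)"

lemma catalytic_quot: "catalytic_coeff n a = interval_poly n 1 1 + a * catalytic_quot n a"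
proof -
  have "a * (\<Sum>i<k + 2. (1 + a) ^ i) = (1 + a) ^ (k + 2) - 1" for k
    using power_diff_1_eq[of "1 + a" "k + 2"] by simp
  then have "a * catalytic_quot n a = (\<Sum>(l, m)\<in>list_intervals (Suc n). (1 + a) ^ (n - hd l + 2) - 1)"
    unfolding catalytic_quot_def sum_distrib_left case_prod_unfold by simp
  also have "\<dots> = catalytic_coeff n a - interval_poly n 1 1"
    by (simp add: catalytic_coeff_def interval_poly_def sum_distrib_left case_prod_unfold
        sum_subtractf power_add power2_eq_square ac_simps)
  finally show ?thesis by simp
qed

lemma catalytic_quot_bound:
  assumes "\<bar>a\<bar> \<le> 1"
  shows "\<bar>catalytic_quot n a\<bar> \<le> 4 * 12 ^ n"
proof -
  have a: "\<bar>1 + a\<bar> \<le> 2" using assms by linarith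
  have "\<bar>catalytic_quot n a\<bar> \<le> (\<Sum>(l, m)\<in>list_intervals (Suc n). 4 * 2 ^ (n - hd l))"
    unfolding catalytic_quot_def
  proof (rule sum_abs[THEN order_trans], rule sum_mono)
    fix p :: "nat list \<times> nat list"
    have "\<bar>\<Sum>i<k + 2. (1 + a) ^ i\<bar> \<le> 4 * 2 ^ k" for k
    proof -
      have "\<bar>\<Sum>i<k + 2. (1 + a) ^ i\<bar> \<le> (\<Sum>i<k + 2. 2 ^ i)"
        by (rule sum_abs[THEN order_trans], rule sum_mono) (simp only: power_abs power_mono[OF a abs_ge_zero])
      also have "(\<Sum>i<k + 2. 2 ^ i :: real) = 2 ^ (k + 2) - 1"
        using power_diff_1_eq[of "2 :: real" "k + 2"] by simp
      finally show ?thesis by simp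
    qed
    then show "\<bar>case p of (l, m) \<Rightarrow> \<Sum>i<n - hd l + 2. (1 + a) ^ i\<bar> \<le> (case p of (l, m) \<Rightarrow> 4 * 2 ^ (n - hd l))"
      by (cases p) (simp only: prod.case)
  qed
  also have "\<dots> = 4 * interval_poly n 2 1"
    by (simp add: interval_poly_def sum_distrib_left case_prod_unfold)
  also have "\<dots> \<le> 4 * 12 ^ n"
    using interval_poly_bound[of 2 1 n] by simp
  finally show ?thesis .
qed

text \<open>The factor \<open>t\<close> undoes the index shift: this is G as a real
  function.\<close>

definition interval_series :: "real \<Rightarrow> real" where
  "interval_series t = (\<Sum>n. interval_poly n 1 1 * t ^ n) * t"

definition quot_series :: "real \<Rightarrow> real \<Rightarrow> real" where
  "quot_series a t = (\<Sum>n. catalytic_quot n a * t ^ n) * t"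

lemma unif_series_interval_series: "unif_series (\<lambda>a. interval_series)"
proof -
  have "unif_series (\<lambda>a t. (\<Sum>n. interval_poly n 1 1 * t ^ n))"
    unfolding unif_series_def
  proof (intro exI conjI allI impI)
    show "(1::real) \<ge> 0" "(12::real) > 0" by simp_all
    show "isCont (\<lambda>a. interval_poly n 1 1) 0" for n by simp
    show "\<bar>interval_poly n 1 1\<bar> \<le> 1 * 12 ^ n" for n
      using interval_poly_bound[of 1 1 n] by simp
  qed simp
  then show ?thesis
    unfolding interval_series_def by (intro unif_series_mult unif_series_t)
qed

lemma unif_series_quot_series: "unif_series quot_series"
proof -
  have "unif_series (\<lambda>a t. (\<Sum>n. catalytic_quot n a * t ^ n))"
    unfolding unif_series_def
  proof (intro exI conjI allI impI)
    show "(4::real) \<ge> 0" "(12::real) > 0" by simp_all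
    show "isCont (catalytic_quot n) 0" for n
      unfolding catalytic_quot_def case_prod_unfold by (intro continuous_intros)
    show "\<bar>catalytic_quot n a\<bar> \<le> 4 * 12 ^ n" if "\<bar>a\<bar> \<le> 1 / 2" for n a
      using catalytic_quot_bound[of a n] that by simp
  qed simp
  then show ?thesis
    unfolding quot_series_def[abs_def] by (intro unif_series_mult unif_series_t)
qed

definition catalytic_series :: "real \<Rightarrow> real \<Rightarrow> real" where
  "catalytic_series a t = interval_series t + a * quot_series a t"

lemma summable_interval_series: "12 * \<bar>t\<bar> < 1 \<Longrightarrow> summable (\<lambda>n. interval_poly n 1 1 * t ^ n)"
  by (rule summable_geometric_bound(2)[where C = 1 and M = 12]) (use interval_poly_bound[of 1 1] in simp_all)

lemma catalytic_series_sums: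
  assumes "\<bar>a\<bar> \<le> 1" "12 * \<bar>t\<bar> < 1"
  shows "(\<lambda>n. catalytic_coeff n a * t ^ n * t) sums catalytic_series a t"
proof -
  have "summable (\<lambda>n. catalytic_quot n a * t ^ n)"
    by (rule summable_geometric_bound(2)[where C = 4 and M = 12]) (use assms catalytic_quot_bound in simp_all)
  from sums_add[OF sums_mult2[OF summable_sums[OF summable_interval_series[OF assms(2)]], of t]
    sums_mult[OF sums_mult2[OF summable_sums[OF this], of t], of a]]
  show ?thesis
    unfolding catalytic_series_def interval_series_def quot_series_def catalytic_quot
    by (simp add: algebra_simps)
qed

text \<open>The kernel vanishes on the curve, so that the bivariate series drops out of the equation.\<close>

lemma catalytic_series_on_curve:
  assumes ab: "\<bar>a\<bar> \<le> 1" "\<bar>b\<bar> \<le> 1" and t: "12 * \<bar>t\<bar> < 1"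
    and curve: "t * ((1 + a) * (1 + b) * (1 + a + b)) = a * b"
  shows "catalytic_series a t + catalytic_series b t = a * b + interval_series t"
proof -
  let ?h = "\<lambda>n. interval_poly n (1 + a) (1 + b) * t ^ n"
  have "summable ?h"
  proof (rule summable_geometric_bound(2)[where C = 1 and M = 12])
    show "\<bar>interval_poly n (1 + a) (1 + b)\<bar> \<le> 1 * 12 ^ n" for n
      using interval_poly_bound[of "1 + a" "1 + b" n] ab by simp
  qed (use t in simp_all)
  then obtain H where H: "?h sums H" by (meson summable_def)
  have "a * b * interval_poly (Suc n) (1 + a) (1 + b) =
      (1 + a) * (1 + b) * (1 + a + b) * interval_poly n (1 + a) (1 + b) + interval_poly n 1 1
      - catalytic_coeff n a - catalytic_coeff n b" for n
    using interval_poly_Suc[of "1 + a" "1 + b" n] interval_poly_commute[of n 1 "1 + b"]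
    by (simp add: catalytic_coeff_def algebra_simps)
  then have eq: "a * b * ?h (Suc n) = a * b * ?h n + interval_poly n 1 1 * t ^ n * t
       - catalytic_coeff n a * t ^ n * t - catalytic_coeff n b * t ^ n * t" for n
  proof -
    have "a * b * ?h (Suc n) = (a * b * interval_poly (Suc n) (1 + a) (1 + b)) * t ^ n * t" by simp
    also have "\<dots> = (t * ((1 + a) * (1 + b) * (1 + a + b))) * ?h n + interval_poly n 1 1 * t ^ n * t
       - catalytic_coeff n a * t ^ n * t - catalytic_coeff n b * t ^ n * t"
      unfolding \<open>a * b * interval_poly (Suc n) (1 + a) (1 + b) = _\<close> by (simp add: algebra_simps)
    finally show ?thesis unfolding curve .
  qed
  \<comment> \<open>One series is summed in two ways. The shift drops the initial term 1 of
    \<open>?h\<close>, so \<open>H\<close> cancels and \<open>a * b\<close> remains.\<close>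
  have "(\<lambda>n. a * b * ?h (Suc n)) sums (a * b * (H - 1))"
    using H sums_Suc_iff[of ?h "H - 1"] by (intro sums_mult) (simp add: interval_poly_0)
  moreover have "(\<lambda>n. a * b * ?h (Suc n)) sums
     (a * b * H + interval_series t - catalytic_series a t - catalytic_series b t)"
    unfolding eq interval_series_def
    by (intro sums_diff sums_add sums_mult[OF H] sums_mult2 catalytic_series_sums
        summable_sums summable_interval_series ab t)
  ultimately have "a * b * (H - 1) = a * b * H + interval_series t - catalytic_series a t - catalytic_series b t"
    by (rule sums_unique2)
  then show ?thesis by (simp add: algebra_simps)
qed

text \<open>Write \<open>a\<^sub>1 = a\<close>, \<open>a\<^sub>2 = b\<close> and \<open>a\<^sub>i\<^sub>-\<^sub>1 a\<^sub>i\<^sub>+\<^sub>1 = 1 + a\<^sub>i\<close>; this sequence has period 5, and on the curve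
  \<open>L = 1 / t\<close> is an invariant of it. Then \<open>even_part a L = a\<^sub>2 a\<^sub>3 + a\<^sub>4 a\<^sub>5\<close> and
  \<open>odd_part a L = a\<^sub>1 a\<^sub>2 + a\<^sub>3 a\<^sub>4 + a\<^sub>5 a\<^sub>1\<close>.\<close>

definition even_part :: "real \<Rightarrow> real \<Rightarrow> real" where
  "even_part a L = (L - 1 - a) * (a * (L - 4) - a\<^sup>2 - 3) / (1 + a)\<^sup>2 - 2"

definition odd_part :: "real \<Rightarrow> real \<Rightarrow> real" where
  "odd_part a L = a * (a * (L - 3) - a\<^sup>2 - 2) / (1 + a) + L / (a * (1 + a))"

text \<open>In the five-cycle, \<open>odd_part a\<close> is \<open>a_1 a_2 = a b\<close> plus
  \<open>a_3 a_4 + a_5 a_1\<close>, and the latter is the even part of the same cycle read from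
  \<open>a_2 = b\<close>.\<close>

lemma odd_part_eq:
  assumes "a \<noteq> 0" "b \<noteq> 0" "1 + a \<noteq> 0" "1 + b \<noteq> 0" and L: "L * (a * b) = (1 + a) * (1 + b) * (1 + a + b)"
  shows "odd_part a L = a * b + even_part b L"
proof -
  have L': "L = (1 + a) * (1 + b) * (1 + a + b) / (a * b)"
    using assms by (simp add: field_simps)
  have *: "L / (1 + a) = (1 + b) * (1 + a + b) / (a * b)"
    unfolding L' using assms(1-4) by simp
  have "odd_part a L = ((a ^ 3 + 1) * (L / (1 + a)) - a\<^sup>2 * (a + 2)) / a"
    unfolding odd_part_def using assms(1,3)
    by (simp add: divide_simps) (simp add: algebra_simps power2_eq_square power3_eq_cube)
  then have o: "odd_part a L = ((a ^ 3 + 1) * ((1 + b) * (1 + a + b) / (a * b)) - a\<^sup>2 * (a + 2)) / a"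
    unfolding * .
  have e1: "L - 1 - b = (1 + b) * ((1 + a) * (1 + a + b) - a * b) / (a * b)"
    unfolding L' using assms by (simp add: divide_simps) (simp add: algebra_simps power2_eq_square)
  have e2: "b * (L - 4) - b\<^sup>2 - 3 = (1 + b) * ((1 + a) * (1 + a + b) - a * (b + 3)) / a"
    unfolding L' using assms by (simp add: divide_simps) (simp add: algebra_simps power2_eq_square)
  have e: "even_part b L = ((1 + a) * (1 + a + b) - a * b) * ((1 + a) * (1 + a + b) - a * (b + 3)) / (a\<^sup>2 * b) - 2"
    unfolding even_part_def e1 e2 using assms by (simp add: divide_simps power2_eq_square)
  show ?thesis
    unfolding o e using assms(1-4)
    by (simp add: divide_simps) (simp add: algebra_simps power2_eq_square power3_eq_cube)
qed

text \<open>\<open>t\<^sup>2\<close> and \<open>t\<close> times the parts of \<open>even_part\<close> and \<open>odd_part\<close> that have no pole at \<open>a = 0\<close>.\<close>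

definition even_reg :: "real \<Rightarrow> real \<Rightarrow> real" where
  "even_reg a t = (1 - t - a * t) * (a * (1 - 4 * t) - t * (a * a + 3)) * (1 / (1 + a)) * (1 / (1 + a)) - 2 * t * t"

text \<open>The divided difference of \<open>even_reg\<close> at \<open>a = 0\<close>, where
  \<open>even_reg\<close> is \<open>t * t - 3 * t\<close>.\<close>

definition even_quot :: "real \<Rightarrow> real \<Rightarrow> real" where
  "even_quot a t = (1 + t + t * t + a * t + (2 * a + a * a) * (t * t)) * (1 / (1 + a)) * (1 / (1 + a))"

definition odd_reg :: "real \<Rightarrow> real \<Rightarrow> real" where
  "odd_reg a t = a * (a * (1 - 3 * t) - t * (a * a + 2)) * (1 / (1 + a))"

text \<open>This is \<open>t ^ 3\<close> times \<open>(y - odd_part) * (y + even_part) + c *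
  (odd_part + even_part)\<close>, with the pole at \<open>a = 0\<close> cancelled by hand. At 0,
  \<open>y\<close> is \<open>interval_series t / 2\<close>, \<open>even_part\<close> is
  \<open>1 - 3 / t\<close>, and only \<open>odd_part\<close> has a pole, so
  \<open>c = interval_series t / 2 + 1 - 3 / t\<close> is forced.\<close>

definition invariant_series :: "real \<Rightarrow> real \<Rightarrow> real" where
  "invariant_series a t =
     (t * t * (1/2 * interval_series t + a * quot_series a t) + even_reg a t) *
     (t * (1/2 * interval_series t + a * quot_series a t) - odd_reg a t)
     - (1 / (1 + a)) * (t * t * quot_series a t + even_quot a t)
     + (1/2 * t * interval_series t + t - 3) * (t * odd_reg a t + even_reg a t)"

lemma unif_series_real: "unif_series (\<lambda>a t. c)"
  by (rule unif_series_const[where B = "\<bar>c\<bar>"]) simp_all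

lemma unif_series_a: "unif_series (\<lambda>a t. a)"
  by (rule unif_series_const[where B = "1/2"]) simp_all

lemma unif_series_inverse: "unif_series (\<lambda>a t. 1 / (1 + a))"
proof (rule unif_series_const[where B = 2])
  fix a :: real assume "\<bar>a\<bar> \<le> 1/2"
  then have "1 + a \<ge> 1/2" by linarith
  then show "\<bar>1 / (1 + a)\<bar> \<le> 2" by (simp add: field_simps)
qed (auto intro!: continuous_intros)

lemma unif_series_invariant_series: "unif_series invariant_series"
  unfolding invariant_series_def[abs_def] even_reg_def even_quot_def odd_reg_def
  by (intro unif_series_t unif_series_a unif_series_real unif_series_inverse
      unif_series_quot_series unif_series_interval_series
      unif_series_add unif_series_diff unif_series_mult)

lemma even_reg_eq: "t \<noteq> 0 \<Longrightarrow> 1 + a \<noteq> 0 \<Longrightarrow> even_reg a t = t * t * even_part a (1 / t)"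
  unfolding even_reg_def even_part_def
  by (simp add: divide_simps) (simp add: algebra_simps power2_eq_square)

lemma even_quot_eq:
  assumes "1 + a \<noteq> 0"
  shows "even_reg a t = t * t - 3 * t + a * even_quot a t"
proof -
  define i where "i = 1 / (1 + a)"
  have i: "i * (1 + a) = 1" using assms by (simp add: i_def)
  have "t * t - 3 * t = (t * t - 3 * t) * (i * (1 + a)) * (i * (1 + a))"
    "2 * t * t = 2 * t * t * (i * (1 + a)) * (i * (1 + a))" unfolding i by simp_all
  then have "t * t - 3 * t + a * even_quot a t - even_reg a t =
     (t * t - 3 * t) * (i * (1 + a)) * (i * (1 + a)) + a * even_quot a t - (even_reg a t + 2 * t * t - 2 * t * t * (i * (1 + a)) * (i * (1 + a)))"
    by linarith
  also have "\<dots> = 0" unfolding even_quot_def even_reg_def i_def[symmetric]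
    by (simp add: algebra_simps)
  finally show ?thesis by simp
qed

lemma odd_reg_eq:
  assumes "t \<noteq> 0" "1 + a \<noteq> 0" "a \<noteq> 0"
  shows "t * odd_part a (1 / t) = odd_reg a t + 1 / (a * (1 + a))"
  unfolding odd_reg_def odd_part_def using assms
  by (simp add: divide_simps) (simp add: algebra_simps power2_eq_square)

lemma invariant_series_eq:
  assumes "t \<noteq> 0" "1 + a \<noteq> 0" "a \<noteq> 0"
  defines "y \<equiv> catalytic_series a t - interval_series t / 2"
  shows "invariant_series a t = t ^ 3 *
    ((y - odd_part a (1 / t)) * (y + even_part a (1 / t)) +
     (interval_series t / 2 + 1 - 3 / t) * (odd_part a (1 / t) + even_part a (1 / t)))"
proof -
  define p where "p = 1 / (a * (1 + a))"
  have p: "1 / (1 + a) = a * p" using assms(2,3) by (simp add: p_def)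
  define G where "G = interval_series t"
  define R where "R = quot_series a t"
  define o' where "o' = odd_part a (1 / t)"
  define e where "e = even_part a (1 / t)"
  have y: "y = 1/2 * G + a * R"
    by (simp add: y_def catalytic_series_def G_def R_def)
  have o': "odd_reg a t = t * o' - p"
    using odd_reg_eq[OF assms(1-3)] by (simp add: p_def o'_def)
  have e: "even_reg a t = t * t * e"
    using even_reg_eq[OF assms(1,2)] by (simp add: e_def)
  have q: "a * even_quot a t = t * t * e - t * t + 3 * t"
    using even_quot_eq[OF assms(2), of t] e by simp
  have t: "t ^ 3 * (interval_series t / 2 + 1 - 3 / t) = t * t * (1/2 * t * G + t - 3)"
    using assms(1) by (simp add: field_simps power3_eq_cube G_def)
  have "invariant_series a t = (t * t * y + t * t * e) * (t * y - (t * o' - p)) - p * (t * t * (a * R) + a * even_quot a t)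
     + (1/2 * t * G + t - 3) * (t * (t * o' - p) + t * t * e)"
    unfolding invariant_series_def p o' e G_def[symmetric] R_def[symmetric] y by (simp add: algebra_simps)
  \<comment> \<open>All terms with \<open>p\<close>, which carries the pole of
    \<open>t * odd_part\<close>, cancel here.\<close>
  also have "\<dots> = t ^ 3 * ((y - o') * (y + e)) + (t * t * (1/2 * t * G + t - 3)) * (o' + e)"
    unfolding q y by (simp add: field_simps power3_eq_cube)
  also have "\<dots> = t ^ 3 * ((y - o') * (y + e) + (interval_series t / 2 + 1 - 3 / t) * (o' + e))"
    unfolding t[symmetric] by (simp only: distrib_left mult.assoc)
  finally show ?thesis unfolding o'_def e_def .
qed

text \<open>The bound 1/10 keeps \<open>t\<close> inside the radius 1/12 on which the series are
  known to converge.\<close>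

lemma curve_bounds:
  assumes "\<bar>a\<bar> < 1/10" "\<bar>b\<bar> < 1/10"
  shows "12 * \<bar>curve a b\<bar> < 1" "curve a b * ((1 + a) * (1 + b) * (1 + a + b)) = a * b"
    "a \<noteq> 0 \<Longrightarrow> b \<noteq> 0 \<Longrightarrow> curve a b \<noteq> 0"
    "a \<noteq> 0 \<Longrightarrow> b \<noteq> 0 \<Longrightarrow> 1 / curve a b * (a * b) = (1 + a) * (1 + b) * (1 + a + b)"
proof -
  have pos: "1 + a > 9/10" "1 + b > 9/10" "1 + a + b > 8/10" using assms by linarith+
  have "9/10 * (9/10) \<le> (1 + a) * (1 + b)" using pos by (intro mult_mono) simp_all
  then have den: "9/10 * (9/10) * (8/10) \<le> (1 + a) * (1 + b) * (1 + a + b)"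
    using pos by (intro mult_mono) simp_all
  have "\<bar>a * b\<bar> \<le> 1/10 * (1/10)" unfolding abs_mult using assms by (intro mult_mono) simp_all
  then have "12 * \<bar>a * b\<bar> < (1 + a) * (1 + b) * (1 + a + b)" using den by linarith
  moreover have "\<bar>curve a b\<bar> = \<bar>a * b\<bar> / ((1 + a) * (1 + b) * (1 + a + b))"
    using den by (simp only: curve_def abs_divide)
  moreover have "(1 + a) * (1 + b) * (1 + a + b) > 0" using den by linarith
  ultimately show "12 * \<bar>curve a b\<bar> < 1" by (simp only: times_divide_eq_right divide_less_eq_1_pos)
  show *: "curve a b * ((1 + a) * (1 + b) * (1 + a + b)) = a * b"
    using pos by (simp add: curve_def)
  show "curve a b \<noteq> 0" if "a \<noteq> 0" "b \<noteq> 0" using * that by auto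
  then show "1 / curve a b * (a * b) = (1 + a) * (1 + b) * (1 + a + b)" if "a \<noteq> 0" "b \<noteq> 0"
    unfolding *[symmetric] using that by simp
qed

text \<open>Passing from \<open>a\<close> to \<open>b\<close> turns \<open>y\<close> into
  \<open>a * b - y\<close>, and by \<open>odd_part_eq\<close> it exchanges the factors
  \<open>y - odd_part\<close> and \<open>y + even_part\<close> up to sign. The sum
  \<open>odd_part + even_part\<close> equals \<open>a * b\<close> plus the even parts at
  \<open>a\<close> and \<open>b\<close>, which is symmetric.\<close>

lemma invariant_series_on_curve:
  assumes "a \<noteq> 0" "b \<noteq> 0" "\<bar>a\<bar> < 1/10" "\<bar>b\<bar> < 1/10"
  shows "invariant_series a (curve a b) = invariant_series b (curve a b)"
proof -
  define t where "t = curve a b"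
  have t: "12 * \<bar>t\<bar> < 1" "t \<noteq> 0" "t * ((1 + a) * (1 + b) * (1 + a + b)) = a * b"
     "1 / t * (a * b) = (1 + a) * (1 + b) * (1 + a + b)"
    unfolding t_def using curve_bounds[OF assms(3,4)] assms(1,2) by blast+
  have ab: "1 + a \<noteq> 0" "1 + b \<noteq> 0" "\<bar>a\<bar> \<le> 1" "\<bar>b\<bar> \<le> 1" using assms(3,4) by linarith+
  define y where "y = catalytic_series a t - interval_series t / 2"
  have y: "catalytic_series b t - interval_series t / 2 = a * b - y"
    using catalytic_series_on_curve[OF ab(3,4) t(1,3)] by (simp add: y_def)
  have oa: "odd_part a (1 / t) = a * b + even_part b (1 / t)"
    by (rule odd_part_eq[OF assms(1,2) ab(1,2) t(4)])
  have ob: "odd_part b (1 / t) = a * b + even_part a (1 / t)"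
    using odd_part_eq[OF assms(2,1) ab(2,1), of "1 / t"] t(4) by (simp add: ac_simps)
  show ?thesis
    unfolding t_def[symmetric] invariant_series_eq[OF t(2) ab(1) assms(1)] invariant_series_eq[OF t(2) ab(2) assms(2)]
      y y_def[symmetric] oa ob by (simp add: algebra_simps)
qed

text \<open>At a point \<open>(a, a)\<close> of the curve the functional equation determines \<open>catalytic_series a t\<close>, so there the
  invariant is known up to \<open>interval_series t\<close>. Two such points over the same \<open>t\<close> determine the latter.\<close>

lemma invariant_series_diagonal:
  assumes "a \<noteq> 0" "\<bar>a\<bar> < 1/10" "t = curve a a"
  defines "J \<equiv> a\<^sup>2 + 2 * even_part a (1 / t)"
  shows "invariant_series a t = t ^ 3 * (- (J\<^sup>2 / 4) + (interval_series t / 2 + 1 - 3 / t) * J)"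
proof -
  have t: "12 * \<bar>t\<bar> < 1" "t \<noteq> 0" "t * ((1 + a) * (1 + a) * (1 + a + a)) = a * a"
     "1 / t * (a * a) = (1 + a) * (1 + a) * (1 + a + a)"
    unfolding assms(3) using curve_bounds[OF assms(2,2)] assms(1) by blast+
  have a: "1 + a \<noteq> 0" "\<bar>a\<bar> \<le> 1" using assms(2) by linarith+
  \<comment> \<open>For \<open>a = b\<close> the functional equation determines
    \<open>y = a * a / 2\<close>. Hence \<open>y - odd_part\<close> is \<open>- J / 2\<close>,
    \<open>y + even_part\<close> is \<open>J / 2\<close>, and \<open>odd_part + even_part\<close> is
    \<open>J\<close>.\<close>
  have y: "catalytic_series a t - interval_series t / 2 = a * a / 2"
    using catalytic_series_on_curve[OF a(2,2) t(1,3)] by simp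
  have o: "odd_part a (1 / t) = a * a + even_part a (1 / t)"
    by (rule odd_part_eq[OF assms(1,1) a(1,1) t(4)])
  have e: "even_part a (1 / t) = (J - a * a) / 2" by (simp add: J_def power2_eq_square)
  show ?thesis
    unfolding invariant_series_eq[OF t(2) a(1) assms(1)] y o e
    by (simp add: field_simps power2_eq_square)
qed

text \<open>As the invariant does not depend on \<open>a\<close>,
  \<open>- (J\<^sup>2 / 4) + c * J\<close> has the same value at both points. A quadratic of this
  form with equal values at distinct \<open>J\<close> and \<open>K\<close> has
  \<open>c = (J + K) / 4\<close>, and \<open>c\<close> contains the wanted series.\<close>

lemma interval_series_from_diagonal:
  "\<exists>\<rho>>0. \<forall>a b t. a \<noteq> 0 \<longrightarrow> b \<noteq> 0 \<longrightarrow> \<bar>a\<bar> < 1/10 \<longrightarrow> \<bar>b\<bar> < 1/10 \<longrightarrow> \<bar>t\<bar> < \<rho> \<longrightarrow>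
     t = curve a a \<longrightarrow> t = curve b b \<longrightarrow> a\<^sup>2 + 2 * even_part a (1 / t) \<noteq> b\<^sup>2 + 2 * even_part b (1 / t) \<longrightarrow>
     interval_series t = (a\<^sup>2 + b\<^sup>2) / 2 + even_part a (1 / t) + even_part b (1 / t) - 2 + 6 / t"
proof -
  obtain \<rho> where \<rho>: "\<rho> > 0" "\<And>a t. \<bar>a\<bar> < 1/10 \<Longrightarrow> \<bar>t\<bar> < \<rho> \<Longrightarrow> invariant_series a t = invariant_series 0 t"
  proof -
    have "\<exists>\<rho>>0. \<forall>a t. \<bar>a\<bar> < 1/10 \<longrightarrow> \<bar>t\<bar> < \<rho> \<longrightarrow> invariant_series a t = invariant_series 0 t"
      by (rule invariant_unif_series[OF unif_series_invariant_series])
        (simp, simp, rule invariant_series_on_curve)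
    then show ?thesis using that by blast
  qed
  show ?thesis
  proof (intro exI[of _ \<rho>] conjI allI impI \<rho>(1))
    fix a b t :: real
    assume ab: "a \<noteq> 0" "b \<noteq> 0" "\<bar>a\<bar> < 1/10" "\<bar>b\<bar> < 1/10" "\<bar>t\<bar> < \<rho>" "t = curve a a" "t = curve b b"
    define J where "J = a\<^sup>2 + 2 * even_part a (1 / t)"
    define K where "K = b\<^sup>2 + 2 * even_part b (1 / t)"
    define c where "c = interval_series t / 2 + 1 - 3 / t"
    assume "a\<^sup>2 + 2 * even_part a (1 / t) \<noteq> b\<^sup>2 + 2 * even_part b (1 / t)"
    then have "J \<noteq> K" by (simp add: J_def K_def)
    have "t \<noteq> 0" unfolding ab(6) by (rule curve_bounds(3)[OF ab(3,3,1,1)])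
    have "invariant_series a t = invariant_series b t"
      using \<rho>(2)[OF ab(3,5)] \<rho>(2)[OF ab(4,5)] by simp
    then have "- (J\<^sup>2 / 4) + c * J = - (K\<^sup>2 / 4) + c * K"
      unfolding invariant_series_diagonal[OF ab(1,3,6)] invariant_series_diagonal[OF ab(2,4,7)]
        J_def[symmetric] K_def[symmetric] c_def[symmetric] using \<open>t \<noteq> 0\<close> by simp
    then have "(J - K) * (c - (J + K) / 4) = 0" by (simp add: field_simps power2_eq_square)
    then have "c = (J + K) / 4" using \<open>J \<noteq> K\<close> by simp
    then show "interval_series t = (a\<^sup>2 + b\<^sup>2) / 2 + even_part a (1 / t) + even_part b (1 / t) - 2 + 6 / t"
      by (simp add: c_def J_def K_def field_simps)
  qed
qed

section \<open>Rational parametrisation of the diagonal points of the curve\<close>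

lemma even_part_diagonal:
  assumes "a \<noteq> 0" "1 + a \<noteq> 0" "L = (1 + a)\<^sup>2 * (1 + 2 * a) / a\<^sup>2"
  shows "even_part a L = 1 + a + (1 + a) * (1 + 2 * a) / a ^ 3"
proof -
  have 1: "L - 1 - a = (1 + a) * ((1 + a) * (1 + 2 * a) - a\<^sup>2) / a\<^sup>2"
    unfolding assms(3) using assms(1) by (simp add: divide_simps) (simp add: algebra_simps power2_eq_square power4_eq_xxxx)
  have 2: "a * (L - 4) - a\<^sup>2 - 3 = (1 + a) * ((1 + a) * (1 + 2 * a) - a * (a + 3)) / a"
    unfolding assms(3) using assms(1) by (simp add: divide_simps) (simp add: algebra_simps power2_eq_square power4_eq_xxxx)
  have "even_part a L = ((1 + a) * (1 + 2 * a) - a\<^sup>2) * ((1 + a) * (1 + 2 * a) - a * (a + 3)) / a ^ 3 - 2"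
    unfolding even_part_def 1 2 using assms(1,2) by (simp add: power2_eq_square power3_eq_cube)
  also have "\<dots> = 1 + a + (1 + a) * (1 + 2 * a) / a ^ 3"
    using assms(1) by (simp add: divide_simps) (simp add: algebra_simps power2_eq_square power3_eq_cube power4_eq_xxxx)
  finally show ?thesis .
qed

text \<open>For this \<open>t\<close>, the condition
  \<open>t * (1 + a)\<^sup>2 * (1 + 2 * a) = a\<^sup>2\<close> factors into the quadratic with root
  sum \<open>2 * z * (2 + z)\<close> and root product \<open>- z\<close>, and the factor
  \<open>2 * z * a - 1\<close>. Since \<open>b / z = - 1 / a\<close>, negative powers of
  \<open>a\<close> become powers of \<open>b / z\<close>.\<close>

lemma diagonal_param:
  assumes z: "z > 0" and a: "\<bar>a\<bar> < 1/10" and ab: "a + b = 2 * z * (2 + z)" "a * b = - z"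
  defines "t \<equiv> z / ((1 + z) * (1 + 2 * z)\<^sup>2)"
  shows "a \<noteq> 0" "t = curve a a" "even_part a (1 / t) = 1 + a - (2 * (b / z) - 3 * (b / z)\<^sup>2 + (b / z) ^ 3)"
proof -
  show a0: "a \<noteq> 0" using ab(2) z by auto
  have pos: "1 + a > 0" "1 + 2 * a > 0" using a by linarith+
  have pos': "1 + z > 0" "1 + 2 * z > 0" using z by simp_all
  have "a * (a + b) = 2 * z * (2 + z) * a" unfolding ab(1) by simp
  then have quad: "a * a = 2 * z * (2 + z) * a + z" using ab(2) by (simp add: algebra_simps)
  have "z * ((1 + a)\<^sup>2 * (1 + 2 * a)) - a\<^sup>2 * ((1 + z) * (1 + 2 * z)\<^sup>2) =
     (a * a - 2 * z * (2 + z) * a - z) * (2 * z * a - 1)"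
    by (simp add: algebra_simps power2_eq_square)
  then have key: "z * ((1 + a)\<^sup>2 * (1 + 2 * a)) = a\<^sup>2 * ((1 + z) * (1 + 2 * z)\<^sup>2)"
    unfolding quad by simp
  have "1 + a + a = 1 + 2 * a" by simp
  then have "curve a a = a\<^sup>2 / ((1 + a)\<^sup>2 * (1 + 2 * a))"
    by (simp add: curve_def power2_eq_square)
  also have "\<dots> = t"
    unfolding t_def using pos pos' key by (simp add: frac_eq_eq)
  finally show t: "t = curve a a" by simp
  have "1 / t = (1 + a)\<^sup>2 * (1 + 2 * a) / a\<^sup>2"
    unfolding t_def using z a0 key by (simp add: frac_eq_eq) (simp add: ac_simps)
  then have "even_part a (1 / t) = 1 + a + (1 + a) * (1 + 2 * a) / a ^ 3"
    using even_part_diagonal[OF a0, of "1 / t"] pos by simp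
  moreover have inv: "b / z = - 1 / a" using ab(2) a0 z by (simp add: field_simps)
  have "2 * (b / z) - 3 * (b / z)\<^sup>2 + (b / z) ^ 3 = - ((1 + a) * (1 + 2 * a) / a ^ 3)"
    unfolding inv using a0 by (simp add: divide_simps) (simp add: algebra_simps power2_eq_square power3_eq_cube)
  ultimately show "even_part a (1 / t) = 1 + a - (2 * (b / z) - 3 * (b / z)\<^sup>2 + (b / z) ^ 3)" by simp
qed

text \<open>For small \<open>z > 0\<close> the quadratic of \<open>diagonal_param\<close> has two
  real roots that tend to 0 with \<open>z\<close>. The formula for \<open>interval_series\<close> is
  symmetric in them, hence rational in \<open>z\<close>, and all negative powers of \<open>z\<close>
  cancel.\<close>

lemma interval_series_param:
  "eventually (\<lambda>z. interval_series (z / ((1 + z) * (1 + 2 * z)\<^sup>2)) = z - 2 * z\<^sup>2 + 2 * z ^ 4) (at_right 0)"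
proof -
  let ?t = "\<lambda>z :: real. z / ((1 + z) * (1 + 2 * z)\<^sup>2)"
  let ?s = "\<lambda>z :: real. sqrt ((z * (2 + z))\<^sup>2 + z)"
  obtain \<rho> where \<rho>: "\<rho> > 0" "\<And>a b t. a \<noteq> 0 \<Longrightarrow> b \<noteq> 0 \<Longrightarrow> \<bar>a\<bar> < 1/10 \<Longrightarrow> \<bar>b\<bar> < 1/10 \<Longrightarrow> \<bar>t\<bar> < \<rho> \<Longrightarrow>
     t = curve a a \<Longrightarrow> t = curve b b \<Longrightarrow> a\<^sup>2 + 2 * even_part a (1 / t) \<noteq> b\<^sup>2 + 2 * even_part b (1 / t) \<Longrightarrow>
     interval_series t = (a\<^sup>2 + b\<^sup>2) / 2 + even_part a (1 / t) + even_part b (1 / t) - 2 + 6 / t"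
    using interval_series_from_diagonal by blast
  have lim: "((\<lambda>z. \<bar>?t z\<bar>) \<longlongrightarrow> \<bar>?t 0\<bar>) (at_right 0)"
    "((\<lambda>z. \<bar>z * (2 + z) + ?s z\<bar>) \<longlongrightarrow> \<bar>0 * (2 + 0) + ?s 0\<bar>) (at_right 0)"
    "((\<lambda>z. \<bar>z * (2 + z) - ?s z\<bar>) \<longlongrightarrow> \<bar>0 * (2 + 0) - ?s 0\<bar>) (at_right 0)"
    by (intro tendsto_intros; simp)+
  have "eventually (\<lambda>z. \<bar>?t z\<bar> < \<rho>) (at_right 0)"
    "eventually (\<lambda>z. \<bar>z * (2 + z) + ?s z\<bar> < 1/10) (at_right 0)"
    "eventually (\<lambda>z. \<bar>z * (2 + z) - ?s z\<bar> < 1/10) (at_right 0)"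
    using order_tendstoD(2)[OF lim(1), of \<rho>] order_tendstoD(2)[OF lim(2), of "1/10"]
      order_tendstoD(2)[OF lim(3), of "1/10"] \<rho>(1) by simp_all
  moreover have "eventually (\<lambda>z::real. z > 0) (at_right 0)" by (rule eventually_at_right_less)
  ultimately show ?thesis
  proof eventually_elim
    case (elim z)
    note z = elim(4)
    define s where "s = ?s z"
    define a where "a = z * (2 + z) + s"
    define b where "b = z * (2 + z) - s"
    define x where "x = a / z"
    define y where "y = b / z"
    have s0: "s > 0" unfolding s_def using z by (simp add: add_nonneg_pos)
    have "s\<^sup>2 = (z * (2 + z))\<^sup>2 + z" unfolding s_def using z by simp
    then have prod: "a * b = - z" by (simp add: a_def b_def algebra_simps power2_eq_square)
    have sum: "a + b = 2 * z * (2 + z)" by (simp add: a_def b_def)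
    have ab: "\<bar>a\<bar> < 1/10" "\<bar>b\<bar> < 1/10" using elim(2,3) by (simp_all add: a_def b_def s_def)
    note A = diagonal_param[OF z ab(1) sum prod, folded y_def]
    have sum': "b + a = 2 * z * (2 + z)" "b * a = - z" using sum prod by (simp_all add: ac_simps)
    note B = diagonal_param[OF z ab(2) sum', folded x_def]
    have xy: "x + y = 4 + 2 * z" "z * (x * y) = - 1" "a = z * x" "b = z * y"
      using sum prod z by (simp_all add: x_def y_def field_simps)
    have "x > y" using s0 z by (simp add: x_def y_def a_def b_def divide_strict_right_mono)
    \<comment> \<open>The two values of \<open>J\<close> must differ; written with
      \<open>x = a / z\<close> and \<open>y = b / z\<close>, their difference is a sum of two
      positive products.\<close>
    have less: "b\<^sup>2 + 2 * even_part b (1 / ?t z) < a\<^sup>2 + 2 * even_part a (1 / ?t z)"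
    proof -
      have xyneg: "x * y < 0"
        using xy(2) z by (metis less_minus_one_simps(1) mult_less_0_iff not_less_iff_gr_or_eq)
      have "a\<^sup>2 + 2 * even_part a (1 / ?t z) - (b\<^sup>2 + 2 * even_part b (1 / ?t z)) =
        (a - b) * (a + b + 2) + 2 * ((x - y) * (2 + (x + y) * (x + y - 3) - x * y))"
        unfolding A(3) B(3) by (simp add: algebra_simps power2_eq_square power3_eq_cube)
      also have "\<dots> > 0"
      proof (rule add_pos_pos)
        show "(a - b) * (a + b + 2) > 0" unfolding sum using z s0
          by (intro mult_pos_pos) (simp_all add: a_def b_def add_pos_pos)
        have "(x + y) * (x + y - 3) \<ge> 0" unfolding xy(1) using z by (intro mult_nonneg_nonneg) simp_all
        then show "2 * ((x - y) * (2 + (x + y) * (x + y - 3) - x * y)) > 0"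
          using xyneg \<open>x > y\<close> by (intro mult_pos_pos) linarith+
      qed
      finally show ?thesis by simp
    qed
    have "interval_series (?t z) = (a\<^sup>2 + b\<^sup>2) / 2 + even_part a (1 / ?t z) + even_part b (1 / ?t z) - 2 + 6 / ?t z"
      by (rule \<rho>(2)[OF A(1) B(1) ab elim(1) A(2) B(2)]) (use less in simp)
    also have "\<dots> = ((a + b)\<^sup>2 - 2 * (a * b)) / 2 + (a + b) - (2 * (x + y) - 3 * ((x + y)\<^sup>2 - 2 * (x * y)) +
       ((x + y) ^ 3 - 3 * (x * y) * (x + y))) + 6 / ?t z"
      unfolding A(3) B(3) by (simp add: algebra_simps power2_eq_square power3_eq_cube)
    also have "x * y = - 1 / z" using xy(2) z by (simp add: field_simps)
    also have "((a + b)\<^sup>2 - 2 * (a * b)) / 2 + (a + b) - (2 * (x + y) - 3 * ((x + y)\<^sup>2 - 2 * (- 1 / z)) +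
       ((x + y) ^ 3 - 3 * (- 1 / z) * (x + y))) + 6 / ?t z = z - 2 * z\<^sup>2 + 2 * z ^ 4"
      unfolding sum prod xy(1) using z
      by (simp add: divide_simps) (simp add: algebra_simps power2_eq_square power3_eq_cube power4_eq_xxxx)
    finally show ?case .
  qed
qed

section \<open>The rational parametrization\<close>

text \<open>The series of \<open>t\<close> in the parameter \<open>z\<close>, that is, the
  compositional inverse of Z; \<open>value_fps\<close> is G in the same parameter.\<close>

definition param_fps :: "'a :: field fps" where
  "param_fps = fps_X * inverse ((1 + fps_X) * (1 + 2 * fps_X) ^ 2)"

definition value_fps :: "'a :: field fps" where
  "value_fps = fps_X - 2 * fps_X ^ 2 + 2 * fps_X ^ 4"

text \<open>Zeros on the small positive reals accumulate at 0, which a nonzero expansion excludes.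
  This carries the identity for real \<open>z\<close> over to formal series.\<close>

lemma has_fps_expansion_zero_on_reals:
  fixes f :: "complex \<Rightarrow> complex"
  assumes F: "f has_fps_expansion F" and zero: "eventually (\<lambda>x. f (of_real x) = 0) (at_right 0)"
  shows "F = 0"
proof -
  have lim: "filterlim (of_real :: real \<Rightarrow> complex) (at 0) (at_right 0)"
    unfolding filterlim_at by (auto intro!: tendsto_eq_intros simp: eventually_at_filter)
  have "frequently (\<lambda>z. f z = 0) (at 0)"
  proof (rule ccontr)
    assume "\<not> frequently (\<lambda>z. f z = 0) (at 0)"
    then have "eventually (\<lambda>z. f z \<noteq> 0) (at 0)" by (simp add: not_frequently)
    then have "eventually (\<lambda>x. f (of_real x) \<noteq> 0) (at_right (0::real))"
      using lim by (rule eventually_compose_filterlim)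
    then have "eventually (\<lambda>x::real. False) (at_right 0)" using zero by eventually_elim simp
    then show False by simp
  qed
  then have "fps_to_fls F = 0"
    using has_laurent_expansion_frequently_zero_iff[of f 0 "fps_to_fls F"] has_laurent_expansion_fps[OF F] by simp
  then show ?thesis by simp
qed

definition complex_interval_gf :: "complex fps" where
  "complex_interval_gf = Abs_fps (\<lambda>n. if n \<ge> 1 then of_nat (num_intervals n) else 0)"

lemma interval_series_sums:
  assumes "12 * \<bar>t\<bar> < 1"
  shows "(\<lambda>n. fps_nth complex_interval_gf n * of_real t ^ n) sums of_real (interval_series t)"
proof -
  have "(\<lambda>n. interval_poly n 1 1 * t ^ n * t) sums interval_series t"
    unfolding interval_series_def by (intro sums_mult2 summable_sums summable_interval_series assms)
  then have "(\<lambda>n. of_real (interval_poly n 1 1 * t ^ n * t)) sums (of_real (interval_series t) :: complex)"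
    by (rule sums_of_real)
  then have "(\<lambda>n. fps_nth complex_interval_gf (Suc n) * of_real t ^ Suc n) sums of_real (interval_series t)"
    by (simp add: complex_interval_gf_def interval_poly_1_1 mult_ac)
  then show ?thesis
    by (subst (asm) sums_Suc_iff) (simp add: complex_interval_gf_def)
qed

lemma fps_conv_radius_complex_interval_gf: "fps_conv_radius complex_interval_gf > 0"
proof -
  have "summable (\<lambda>n. fps_nth complex_interval_gf n * of_real (1/24) ^ n)"
    using interval_series_sums[of "1/24"] by (auto simp: sums_iff)
  then have "conv_radius (fps_nth complex_interval_gf) \<ge> norm (of_real (1/24) :: complex)"
    by (rule conv_radius_geI)
  then show ?thesis
    unfolding fps_conv_radius_def by (rule less_le_trans[rotated]) simp
qed

lemma complex_interval_gf_compose: "complex_interval_gf oo param_fps = value_fps"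
proof -
  let ?\<tau> = "\<lambda>z :: complex. z * inverse ((1 + z) * (1 + 2 * z) ^ 2)"
  have \<tau>: "?\<tau> has_fps_expansion param_fps"
    unfolding param_fps_def by (intro fps_expansion_intros) simp
  have "(eval_fps complex_interval_gf \<circ> ?\<tau>) has_fps_expansion (complex_interval_gf oo param_fps)"
    by (intro has_fps_expansion_compose eval_fps_has_fps_expansion fps_conv_radius_complex_interval_gf \<tau>)
      (simp add: param_fps_def)
  moreover have "(\<lambda>z. z - 2 * z ^ 2 + 2 * z ^ 4) has_fps_expansion (value_fps :: complex fps)"
    unfolding value_fps_def by (intro fps_expansion_intros)
  ultimately have "(\<lambda>z. (eval_fps complex_interval_gf \<circ> ?\<tau>) z - (z - 2 * z ^ 2 + 2 * z ^ 4)) has_fps_expansion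
      ((complex_interval_gf oo param_fps) - value_fps)"
    by (rule has_fps_expansion_diff)
  moreover have "eventually (\<lambda>x. (eval_fps complex_interval_gf \<circ> ?\<tau>) (of_real x)
      - (of_real x - 2 * of_real x ^ 2 + 2 * of_real x ^ 4) = 0) (at_right 0)"
  proof -
    have "((\<lambda>x::real. 12 * \<bar>x / ((1 + x) * (1 + 2 * x)\<^sup>2)\<bar>) \<longlongrightarrow> 12 * \<bar>0 / ((1 + 0) * (1 + 2 * 0)\<^sup>2)\<bar>) (at_right 0)"
      by (intro tendsto_intros; simp)
    then have "eventually (\<lambda>x::real. 12 * \<bar>x / ((1 + x) * (1 + 2 * x)\<^sup>2)\<bar> < 1) (at_right 0)"
      by (rule order_tendstoD) simp
    then show ?thesis
      using interval_series_param
    proof eventually_elim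
      case (elim x)
      have "?\<tau> (of_real x) = of_real (x / ((1 + x) * (1 + 2 * x)\<^sup>2))"
        by (simp add: divide_inverse)
      then have "eval_fps complex_interval_gf (?\<tau> (of_real x)) = of_real (x - 2 * x\<^sup>2 + 2 * x ^ 4)"
        using interval_series_sums[OF elim(1)] elim(2) by (simp add: eval_fps_def sums_iff)
      then show ?case by simp
    qed
  qed
  ultimately have "(complex_interval_gf oo param_fps) - value_fps = 0"
    by (rule has_fps_expansion_zero_on_reals)
  then show ?thesis by simp
qed

section \<open>Descent of the identity from complex to rational coefficients\<close>

definition fps_map_rat :: "rat fps \<Rightarrow> 'a :: field_char_0 fps" where
  "fps_map_rat F = Abs_fps (\<lambda>n. of_rat (fps_nth F n))"

lemma fps_map_rat_nth [simp]: "fps_nth (fps_map_rat F) n = of_rat (fps_nth F n)"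
  by (simp add: fps_map_rat_def)

lemma fps_map_rat_mult: "fps_map_rat (F * G) = fps_map_rat F * fps_map_rat G"
  by (rule fps_ext) (simp add: fps_mult_nth of_rat_sum of_rat_mult)

lemma fps_map_rat_add: "fps_map_rat (F + G) = fps_map_rat F + fps_map_rat G"
  by (rule fps_ext) (simp add: of_rat_add)

lemma fps_map_rat_diff: "fps_map_rat (F - G) = fps_map_rat F - fps_map_rat G"
  by (rule fps_ext) (simp add: of_rat_diff)

lemma fps_map_rat_1: "fps_map_rat 1 = 1"
  by (rule fps_ext) simp

lemma fps_map_rat_X: "fps_map_rat fps_X = fps_X"
  by (rule fps_ext) simp

lemma fps_map_rat_numeral: "fps_map_rat (numeral n) = numeral n"
  by (rule fps_ext) (simp add: fps_numeral_nth)

lemma fps_map_rat_power: "fps_map_rat (F ^ n) = fps_map_rat F ^ n"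
  by (induction n) (simp_all add: fps_map_rat_1 fps_map_rat_mult)

lemmas fps_map_rat_simps = fps_map_rat_mult fps_map_rat_add fps_map_rat_diff fps_map_rat_1
  fps_map_rat_X fps_map_rat_numeral fps_map_rat_power

lemma fps_map_rat_compose: "fps_map_rat (F oo G) = fps_map_rat F oo fps_map_rat G"
  by (rule fps_ext) (simp add: fps_compose_nth of_rat_sum of_rat_mult flip: fps_map_rat_power)

lemma fps_map_rat_eq_iff: "fps_map_rat F = (fps_map_rat G :: 'a :: field_char_0 fps) \<longleftrightarrow> F = G"
  by (simp add: fps_eq_iff)

lemma param_fps_eq: "(param_fps :: 'a :: field fps) * ((1 + fps_X) * (1 + 2 * fps_X) ^ 2) = fps_X"
proof -
  have "inverse ((1 + fps_X) * (1 + 2 * fps_X) ^ 2) * ((1 + fps_X) * (1 + 2 * fps_X) ^ 2) = (1 :: 'a fps)"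
    by (rule inverse_mult_eq_1) (simp add: power2_eq_square)
  then show ?thesis by (simp only: param_fps_def mult.assoc mult_1_right)
qed

lemma fps_map_rat_param_fps: "fps_map_rat param_fps = (param_fps :: 'a :: field_char_0 fps)"
proof -
  let ?B = "(1 + fps_X) * (1 + 2 * fps_X) ^ 2 :: 'a fps"
  have "fps_map_rat param_fps * ?B =
     (fps_map_rat (param_fps * ((1 + fps_X) * (1 + 2 * fps_X) ^ 2)) :: 'a fps)"
    by (simp only: fps_map_rat_simps)
  also have "\<dots> = param_fps * ?B"
    by (simp only: param_fps_eq fps_map_rat_X)
  finally show ?thesis
    by (metis fps_X_neq_zero mult_cancel_right mult_zero_right param_fps_eq)
qed

lemma interval_gf_compose: "interval_gf oo param_fps = value_fps"
proof -
  have gf: "fps_map_rat interval_gf = complex_interval_gf"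
    by (rule fps_ext) (simp add: interval_gf_def complex_interval_gf_def)
  have val: "fps_map_rat value_fps = (value_fps :: complex fps)"
    by (simp only: value_fps_def fps_map_rat_simps)
  have "fps_map_rat (interval_gf oo param_fps) = (fps_map_rat value_fps :: complex fps)"
    unfolding fps_map_rat_compose gf fps_map_rat_param_fps val by (rule complex_interval_gf_compose)
  then show ?thesis by (simp only: fps_map_rat_eq_iff)
qed

lemma param_fps_nth:
  "fps_nth (param_fps :: 'a :: field fps) 0 = 0" "fps_nth (param_fps :: 'a :: field fps) (Suc 0) = 1"
  using arg_cong[OF param_fps_eq[where 'a = 'a], of "\<lambda>F. fps_nth F 1"]
  by (simp_all add: param_fps_def fps_mult_nth_1 power2_eq_square)

text \<open>The series \<open>(1 + Z) * (1 + 2 * Z) ^ 2\<close> has constant term 1 and can be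
  cancelled, so the equation says \<open>param_fps oo Z = fps_X\<close>.\<close>

lemma fps_eq_iff_param_inverse:
  fixes Z :: "rat fps"
  shows "fps_nth Z 0 = 0 \<and> Z = fps_X * (1 + Z) * (1 + 2 * Z) ^ 2 \<longleftrightarrow> Z = fps_inv param_fps"
proof
  assume Z: "fps_nth Z 0 = 0 \<and> Z = fps_X * (1 + Z) * (1 + 2 * Z) ^ 2"
  let ?B = "(1 + Z) * (1 + 2 * Z) ^ 2"
  have "?B $ 0 = 1" using Z by (simp add: power2_eq_square)
  then have B: "?B \<noteq> 0" by (metis fps_zero_nth zero_neq_one)
  have "(param_fps * ((1 + fps_X) * (1 + 2 * fps_X) ^ 2)) oo Z = fps_X oo Z"
    by (simp only: param_fps_eq)
  then have "(param_fps oo Z) * ?B = Z"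
    using Z by (simp add: fps_compose_mult_distrib fps_compose_add_distrib flip: fps_compose_power)
  then have "(param_fps oo Z) * ?B = fps_X * ?B" using Z by (simp only: mult.assoc)
  then have c: "param_fps oo Z = fps_X" using B by simp
  have "fps_inv param_fps oo (param_fps oo Z) = (fps_inv param_fps oo param_fps) oo Z"
    using Z by (intro fps_compose_assoc) (simp_all add: param_fps_nth)
  then show "Z = fps_inv param_fps"
    using Z fps_inv[of "param_fps :: rat fps"] unfolding c by (simp add: param_fps_nth)
next
  assume "Z = fps_inv param_fps"
  then have c: "param_fps oo Z = fps_X" and Z: "fps_nth Z 0 = 0"
    using fps_inv_right[of "param_fps :: rat fps"] by (simp_all add: param_fps_nth fps_inv_def)
  have "(param_fps * ((1 + fps_X) * (1 + 2 * fps_X) ^ 2)) oo Z = fps_X oo Z"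
    by (simp only: param_fps_eq)
  then have "(param_fps oo Z) * ((1 + Z) * (1 + 2 * Z) ^ 2) = Z"
    using Z by (simp add: fps_compose_mult_distrib fps_compose_add_distrib flip: fps_compose_power)
  then show "fps_nth Z 0 = 0 \<and> Z = fps_X * (1 + Z) * (1 + 2 * Z) ^ 2"
    using Z unfolding c by (simp only: mult.assoc simp_thms)
qed

lemma interval_gf_eq:
  assumes "fps_nth Z 0 = 0" "Z = fps_X * (1 + Z) * (1 + 2 * Z) ^ 2"
  shows "interval_gf = Z * (1 - 2 * Z + 2 * Z ^ 3)"
proof -
  have Z: "Z = fps_inv param_fps" using assms fps_eq_iff_param_inverse by blast
  have "interval_gf = interval_gf oo (param_fps oo Z)"
    unfolding Z using fps_inv_right[of "param_fps :: rat fps"] by (simp add: param_fps_nth)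
  also have "\<dots> = (interval_gf oo param_fps) oo Z"
    using assms(1) by (intro fps_compose_assoc) (simp_all add: param_fps_nth)
  also have "\<dots> = Z - 2 * Z ^ 2 + 2 * Z ^ 4"
    unfolding interval_gf_compose value_fps_def using assms(1)
    by (simp add: fps_compose_mult_distrib fps_compose_add_distrib fps_compose_sub_distrib flip: fps_compose_power)
  also have "\<dots> = Z * (1 - 2 * Z + 2 * Z ^ 3)"
    by (simp add: algebra_simps power2_eq_square power3_eq_cube power4_eq_xxxx)
  finally show ?thesis .
qed

section \<open>Algebraicity\<close>

abbreviation "den_poly \<equiv> ([:1, 5, 8, 4:] :: real poly)"
abbreviation "value_poly \<equiv> ([:0, 1, - 2, 0, 2:] :: real poly)"

lemma den_poly_fps: "fps_of_poly den_poly = (1 + fps_X) * (1 + 2 * fps_X) ^ 2"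
  by (simp add: fps_of_poly_pCons algebra_simps power2_eq_square flip: numeral_fps_const)

lemma value_poly_fps: "fps_of_poly value_poly = value_fps"
  by (simp add: value_fps_def fps_of_poly_pCons algebra_simps power2_eq_square power4_eq_xxxx
      flip: numeral_fps_const fps_const_neg)

text \<open>Clearing denominators turns the substitution into a polynomial, so an identity of series
  at 0 can be evaluated at points \<open>w\<close> far from 0. Allowing all large \<open>N\<close>
  lets several \<open>C\<close> share one exponent.\<close>

lemma homogenize:
  fixes C :: "real poly"
  shows "\<exists>N0. \<forall>N\<ge>N0. \<exists>H. fps_of_poly H = (fps_of_poly C oo param_fps) * fps_of_poly den_poly ^ N \<and>
     (\<forall>w. poly den_poly w \<noteq> 0 \<longrightarrow> poly H w = poly den_poly w ^ N * poly C (w / poly den_poly w))"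
proof (induction C)
  case 0
  show ?case by (intro exI[of _ 0] allI impI exI[of _ "0 :: real poly"]) simp
next
  case (pCons a C)
  then obtain N0 where N0: "\<And>N. N \<ge> N0 \<Longrightarrow> \<exists>H. fps_of_poly H = (fps_of_poly C oo param_fps) * fps_of_poly den_poly ^ N \<and>
     (\<forall>w. poly den_poly w \<noteq> 0 \<longrightarrow> poly H w = poly den_poly w ^ N * poly C (w / poly den_poly w))"
    by blast
  show ?case
  proof (intro exI[of _ "Suc N0"] allI impI)
    fix N assume "Suc N0 \<le> N"
    then obtain M where M: "N = Suc M" "M \<ge> N0" by (cases N) simp_all
    obtain H where H: "fps_of_poly H = (fps_of_poly C oo param_fps) * fps_of_poly den_poly ^ M"
     "\<And>w. poly den_poly w \<noteq> 0 \<Longrightarrow> poly H w = poly den_poly w ^ M * poly C (w / poly den_poly w)"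
      using N0[OF M(2)] by blast
    let ?K = "smult a (den_poly ^ N) + [:0, 1:] * H"
    have "fps_of_poly ?K = fps_const a * fps_of_poly den_poly ^ N + fps_X * fps_of_poly H"
      by (simp only: fps_of_poly_add fps_of_poly_smult fps_of_poly_power fps_of_poly_mult fps_of_poly_fps_X)
    also have "fps_X * fps_of_poly H = (param_fps * fps_of_poly den_poly) * fps_of_poly H"
      by (simp only: den_poly_fps param_fps_eq)
    also have "\<dots> = (fps_of_poly C oo param_fps) * param_fps * fps_of_poly den_poly ^ N"
      unfolding H(1) M(1) by (simp only: power_Suc mult_ac)
    also have "fps_const a * fps_of_poly den_poly ^ N + \<dots> =
       (fps_of_poly (pCons a C) oo param_fps) * fps_of_poly den_poly ^ N"
      unfolding fps_of_poly_pCons fps_compose_add_distrib fps_compose_mult_distrib[OF param_fps_nth(1)]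
      by (simp only: fps_const_compose fps_X_fps_compose_startby0[OF param_fps_nth(1)] ring_distribs)
    finally have "fps_of_poly ?K = (fps_of_poly (pCons a C) oo param_fps) * fps_of_poly den_poly ^ N" .
    moreover have "poly ?K w = poly den_poly w ^ N * poly (pCons a C) (w / poly den_poly w)"
      if "poly den_poly w \<noteq> 0" for w
    proof -
      have "poly ?K w = a * poly den_poly w ^ N + w * (poly den_poly w ^ M * poly C (w / poly den_poly w))"
        using H(2)[OF that] by (simp only: poly_add poly_smult poly_power poly_mult) simp
      also have "w * (poly den_poly w ^ M * poly C (w / poly den_poly w)) =
         poly den_poly w ^ N * (w / poly den_poly w * poly C (w / poly den_poly w))"
        unfolding M(1) using that by (simp del: poly_pCons)
      finally show ?thesis by (simp only: poly_pCons ring_distribs mult.commute)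
    qed
    ultimately show "\<exists>H. fps_of_poly H = (fps_of_poly (pCons a C) oo param_fps) * fps_of_poly den_poly ^ N \<and>
     (\<forall>w. poly den_poly w \<noteq> 0 \<longrightarrow> poly H w = poly den_poly w ^ N * poly (pCons a C) (w / poly den_poly w))"
      by blast
  qed
qed

text \<open>The divided difference of \<open>value_poly\<close> is
  \<open>1 + 2 * (x + y) * (x\<^sup>2 + y\<^sup>2 - 1)\<close>, which exceeds 1 in the first case
  and is below \<open>- 1\<close> in the second.\<close>

lemma value_poly_neq:
  assumes "x \<noteq> y" "x + y > 0 \<and> x\<^sup>2 + y\<^sup>2 > 1 \<or> x + y < -1 \<and> x\<^sup>2 + y\<^sup>2 > 2"
  shows "poly value_poly x \<noteq> poly value_poly y"
proof -
  have eq: "poly value_poly x - poly value_poly y = (x - y) * (1 + 2 * ((x + y) * (x\<^sup>2 + y\<^sup>2 - 1)))"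
    by (simp add: algebra_simps power2_eq_square)
  have "1 + 2 * ((x + y) * (x\<^sup>2 + y\<^sup>2 - 1)) \<noteq> 0"
    using assms(2)
  proof
    assume "x + y > 0 \<and> x\<^sup>2 + y\<^sup>2 > 1"
    then have "(x + y) * (x\<^sup>2 + y\<^sup>2 - 1) > 0" by (intro mult_pos_pos) simp_all
    then show ?thesis by simp
  next
    assume "x + y < -1 \<and> x\<^sup>2 + y\<^sup>2 > 2"
    then have "- (x + y) * (x\<^sup>2 + y\<^sup>2 - 1) > 1 * 1" by (intro mult_strict_mono) simp_all
    then show ?thesis unfolding mult_minus_left by linarith
  qed
  then show ?thesis using eq assms(1) by (metis eq_iff_diff_eq_0 mult_eq_0_iff)
qed

lemma quadratic_three_zeros:
  fixes a b c :: real
  assumes "a + b * x + c * x\<^sup>2 = 0" "a + b * y + c * y\<^sup>2 = 0" "a + b * w + c * w\<^sup>2 = 0"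
    and "x \<noteq> y" "x \<noteq> w" "y \<noteq> w"
  shows "a = 0 \<and> b = 0 \<and> c = 0"
proof -
  have "(x - y) * (b + c * (x + y)) = 0" "(x - w) * (b + c * (x + w)) = 0"
    using assms(1-3) by (simp_all add: algebra_simps power2_eq_square)
  then have *: "b + c * (x + y) = 0" "b + c * (x + w) = 0" using assms(4,5) by simp_all
  have "c * (y - w) = (b + c * (x + y)) - (b + c * (x + w))" by (simp add: algebra_simps)
  then have "c * (y - w) = 0" unfolding * by simp
  then have "c = 0" using assms(6) by simp
  then show ?thesis using * assms(1) by simp
qed

text \<open>The points \<open>w\<^sub>1\<close> and \<open>w\<^sub>2\<close> are the other two preimages of the value of the parametrization at \<open>z\<close>.\<close>

lemma conjugate_values:
  fixes z :: real
  assumes "0 < z" "z < 1/100"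
  obtains w1 w2 where "poly den_poly w1 \<noteq> 0" "poly den_poly w2 \<noteq> 0" "poly den_poly z \<noteq> 0"
    "w1 / poly den_poly w1 = z / poly den_poly z" "w2 / poly den_poly w2 = z / poly den_poly z"
    "poly value_poly z \<noteq> poly value_poly w1" "poly value_poly z \<noteq> poly value_poly w2"
    "poly value_poly w1 \<noteq> poly value_poly w2"
proof -
  \<comment> \<open>Divided by \<open>w - z\<close>, the equation
    \<open>w * den_poly z = z * den_poly w\<close> becomes
    \<open>4 * z * w * (2 + z + w) = 1\<close>. Its roots are \<open>w1\<close> and
    \<open>w2\<close>; for small \<open>z\<close> they are far apart, on both sides of 0.\<close>
  define d where "d = sqrt ((2 + z)\<^sup>2 + 1 / z)"
  define w1 where "w1 = (- (2 + z) + d) / 2"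
  define w2 where "w2 = (- (2 + z) - d) / 2"
  have d2: "d\<^sup>2 = (2 + z)\<^sup>2 + 1 / z" unfolding d_def using assms by simp
  have "1 / z > 100" using assms by (simp add: field_simps)
  then have "100 < d\<^sup>2" unfolding d2 using zero_le_power2[of "2 + z"] by linarith
  then have "10\<^sup>2 < d\<^sup>2" by simp
  then have "d > 10" by (rule power2_less_imp_less) (use assms in \<open>simp add: d_def add_nonneg_nonneg\<close>)
  then have w: "w1 > 3" "w2 < -6" using assms by (simp_all add: w1_def w2_def)
  have sum: "w1 + w2 = - (2 + z)" by (simp add: w1_def w2_def field_simps)
  have denz: "poly den_poly z > 0" using assms by (simp add: add_pos_pos)
  have root: "w * poly den_poly z = z * poly den_poly w" if "w = w1 \<or> w = w2" for w
  proof -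
    have "w1 * (2 + z + w1) = (d\<^sup>2 - (2 + z)\<^sup>2) / 4" "w2 * (2 + z + w2) = (d\<^sup>2 - (2 + z)\<^sup>2) / 4"
      by (simp_all add: w1_def w2_def field_simps power2_eq_square)
    then have "w * (2 + z + w) = (d\<^sup>2 - (2 + z)\<^sup>2) / 4" using that by blast
    then have "4 * z * w * (2 + z + w) = 4 * z * ((d\<^sup>2 - (2 + z)\<^sup>2) / 4)"
      by (simp only: mult.assoc)
    also have "\<dots> = 1" unfolding d2 using assms by simp
    finally have "4 * z * w * (2 + z + w) = 1" .
    moreover have "w * poly den_poly z - z * poly den_poly w = (w - z) * (1 - 4 * z * w * (2 + z + w))"
      by (simp add: algebra_simps)
    ultimately show ?thesis by simp
  qed
  have nz: "poly den_poly w \<noteq> 0" if "w = w1 \<or> w = w2" for w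
    using root[OF that] denz w that by auto
  have quot: "w / poly den_poly w = z / poly den_poly z" if "w = w1 \<or> w = w2" for w
    using root[OF that] nz[OF that] denz by (simp add: frac_eq_eq del: poly_pCons)
  have sq: "w1\<^sup>2 > 9" "w2\<^sup>2 > 36" "z\<^sup>2 \<ge> 0"
    using w power_strict_mono[of 3 w1 2] power_strict_mono[of 6 "- w2" 2] by simp_all
  show thesis
  proof (rule that[of w1 w2])
    show "poly den_poly w1 \<noteq> 0" "poly den_poly w2 \<noteq> 0" "poly den_poly z \<noteq> 0"
      using nz denz by (blast, blast, linarith)
    show "w1 / poly den_poly w1 = z / poly den_poly z" "w2 / poly den_poly w2 = z / poly den_poly z"
      using quot by blast+
    have "z + w1 > 0 \<and> z\<^sup>2 + w1\<^sup>2 > 1" "z + w2 < -1 \<and> z\<^sup>2 + w2\<^sup>2 > 2"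
      "w1 + w2 < -1 \<and> w1\<^sup>2 + w2\<^sup>2 > 2"
      using w assms sq unfolding sum by linarith+
    then show "poly value_poly z \<noteq> poly value_poly w1" "poly value_poly z \<noteq> poly value_poly w2"
      "poly value_poly w1 \<noteq> poly value_poly w2"
      using value_poly_neq[of z w1] value_poly_neq[of z w2] value_poly_neq[of w1 w2] w assms
      by (blast | linarith)+
  qed
qed

text \<open>Over one \<open>t\<close> lie three parameters with three different values of
  \<open>value_poly\<close>. A quadratic relation vanishes at all three, so its coefficients vanish
  at this \<open>t\<close>, and there are infinitely many such \<open>t\<close>.\<close>

lemma real_independent:
  fixes C0 C1 C2 :: "real poly"
  assumes "(fps_of_poly C0 oo param_fps) + (fps_of_poly C1 oo param_fps) * value_fps
     + (fps_of_poly C2 oo param_fps) * value_fps ^ 2 = 0"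
  shows "C0 = 0 \<and> C1 = 0 \<and> C2 = 0"
proof -
  let ?P = "\<lambda>C N H. fps_of_poly H = (fps_of_poly C oo param_fps) * fps_of_poly den_poly ^ N \<and>
     (\<forall>w. poly den_poly w \<noteq> 0 \<longrightarrow> poly H w = poly den_poly w ^ N * poly C (w / poly den_poly w))"
  obtain N0 N1 N2 where N: "\<And>N. N \<ge> N0 \<Longrightarrow> \<exists>H. ?P C0 N H" "\<And>N. N \<ge> N1 \<Longrightarrow> \<exists>H. ?P C1 N H"
    "\<And>N. N \<ge> N2 \<Longrightarrow> \<exists>H. ?P C2 N H"
    using homogenize[of C0] homogenize[of C1] homogenize[of C2] by blast
  define n where "n = max N0 (max N1 N2)"
  have n: "n \<ge> N0" "n \<ge> N1" "n \<ge> N2" by (simp_all add: n_def)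
  obtain H0 where H0: "?P C0 n H0" using N(1)[OF n(1)] by (rule exE)
  obtain H1 where H1: "?P C1 n H1" using N(2)[OF n(2)] by (rule exE)
  obtain H2 where H2: "?P C2 n H2" using N(3)[OF n(3)] by (rule exE)
  note H = H0 H1 H2
  have "fps_of_poly (H0 + H1 * value_poly + H2 * value_poly ^ 2) =
    ((fps_of_poly C0 oo param_fps) + (fps_of_poly C1 oo param_fps) * value_fps
     + (fps_of_poly C2 oo param_fps) * value_fps ^ 2) * fps_of_poly den_poly ^ n"
    unfolding fps_of_poly_add fps_of_poly_mult fps_of_poly_power value_poly_fps
      H0[THEN conjunct1] H1[THEN conjunct1] H2[THEN conjunct1]
    by (simp only: algebra_simps)
  also have "\<dots> = fps_of_poly 0" unfolding assms by simp
  finally have zero: "H0 + H1 * value_poly + H2 * value_poly ^ 2 = 0"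
    by (simp only: fps_of_poly_eq_iff)
  have rel: "poly C0 (w / poly den_poly w) + poly C1 (w / poly den_poly w) * poly value_poly w +
     poly C2 (w / poly den_poly w) * (poly value_poly w)\<^sup>2 = 0" if "poly den_poly w \<noteq> 0" for w
  proof -
    have "poly (H0 + H1 * value_poly + H2 * value_poly ^ 2) w = 0" unfolding zero by simp
    then have "poly H0 w + poly H1 w * poly value_poly w + poly H2 w * (poly value_poly w)\<^sup>2 = 0"
      by (simp only: poly_add poly_mult poly_power)
    moreover have "poly H0 w = poly den_poly w ^ n * poly C0 (w / poly den_poly w)"
      "poly H1 w = poly den_poly w ^ n * poly C1 (w / poly den_poly w)"
      "poly H2 w = poly den_poly w ^ n * poly C2 (w / poly den_poly w)"
      using H that by blast+
    ultimately have "poly den_poly w ^ n * (poly C0 (w / poly den_poly w) + poly C1 (w / poly den_poly w) * poly value_poly w +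
     poly C2 (w / poly den_poly w) * (poly value_poly w)\<^sup>2) = 0"
      by (simp only: ring_distribs mult.assoc)
    then show ?thesis using that by (metis mult_eq_0_iff power_not_zero)
  qed
  have vanish: "poly C0 (z / poly den_poly z) = 0 \<and> poly C1 (z / poly den_poly z) = 0 \<and> poly C2 (z / poly den_poly z) = 0"
    if z: "0 < z" "z < 1/100" for z
  proof -
    obtain w1 w2 where w: "poly den_poly w1 \<noteq> 0" "poly den_poly w2 \<noteq> 0" "poly den_poly z \<noteq> 0"
      "w1 / poly den_poly w1 = z / poly den_poly z" "w2 / poly den_poly w2 = z / poly den_poly z"
      "poly value_poly z \<noteq> poly value_poly w1" "poly value_poly z \<noteq> poly value_poly w2"
      "poly value_poly w1 \<noteq> poly value_poly w2"
      by (rule conjugate_values[OF z])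
    show ?thesis
      by (rule quadratic_three_zeros[OF rel[OF w(3)] rel[OF w(1), unfolded w(4)] rel[OF w(2), unfolded w(5)] w(6-8)])
  qed
  have "C = 0" if P: "?P C n H" and v: "\<And>z. 0 < z \<Longrightarrow> z < 1/100 \<Longrightarrow> poly C (z / poly den_poly z) = 0" for C H
  proof -
    have "poly H z = 0" if "z \<in> {0<..<1/100}" for z
    proof -
      have "poly den_poly z > 0" using that by (simp add: add_pos_pos)
      then have "poly den_poly z \<noteq> 0" by linarith
      then have "poly H z = poly den_poly z ^ n * poly C (z / poly den_poly z)" using P by blast
      then show ?thesis using v that by simp
    qed
    then have "{0<..<1/100} \<subseteq> {z. poly H z = 0}" by blast
    moreover have "infinite {0<..<1/100 :: real}" by simp
    ultimately have "H = 0" using poly_roots_finite[of H] finite_subset by blast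
    then have "(fps_of_poly C oo param_fps) * fps_of_poly den_poly ^ n = 0" using P by (metis fps_of_poly_0)
    moreover have "fps_of_poly den_poly \<noteq> 0"
      by (simp only: fps_of_poly_eq_iff flip: fps_of_poly_0) simp
    ultimately have "fps_of_poly C oo param_fps = 0" by simp
    then have "fps_of_poly C = 0"
      using fps_compose_eq_0_iff[of param_fps "fps_of_poly C"] param_fps_nth[where 'a = real] by force
    then show "C = 0" by (metis fps_of_poly_0 fps_of_poly_eq_iff)
  qed
  then show ?thesis using H vanish by blast
qed

lemma interval_gf_independent:
  assumes "fps_of_poly C0 + fps_of_poly C1 * interval_gf + fps_of_poly C2 * interval_gf ^ 2 = 0"
  shows "C0 = 0 \<and> C1 = 0 \<and> C2 = 0"
proof -
  let ?r = "map_poly of_rat :: rat poly \<Rightarrow> real poly"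
  have r: "fps_map_rat (fps_of_poly C) = fps_of_poly (?r C)" for C
    by (rule fps_ext) (simp add: coeff_map_poly)
  have v: "fps_map_rat value_fps = (value_fps :: real fps)"
    by (simp only: value_fps_def fps_map_rat_simps)
  have "(fps_of_poly C0 + fps_of_poly C1 * interval_gf + fps_of_poly C2 * interval_gf ^ 2) oo param_fps = 0"
    unfolding assms by simp
  then have "(fps_of_poly C0 oo param_fps) + (fps_of_poly C1 oo param_fps) * value_fps
     + (fps_of_poly C2 oo param_fps) * value_fps ^ 2 = 0"
    by (simp only: fps_compose_add_distrib fps_compose_mult_distrib[OF param_fps_nth(1)]
      fps_compose_power[OF param_fps_nth(1), symmetric] interval_gf_compose)
  from arg_cong[OF this, of "fps_map_rat :: rat fps \<Rightarrow> real fps"]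
  have "(fps_of_poly (?r C0) oo param_fps) + (fps_of_poly (?r C1) oo param_fps) * value_fps
     + (fps_of_poly (?r C2) oo param_fps) * value_fps ^ 2 = fps_map_rat 0"
    by (simp only: fps_map_rat_simps fps_map_rat_compose r fps_map_rat_param_fps v)
  moreover have "fps_map_rat 0 = (0 :: real fps)" by (rule fps_ext) simp
  ultimately have "?r C0 = 0 \<and> ?r C1 = 0 \<and> ?r C2 = 0" by (intro real_independent) simp
  moreover have "C = 0" if "?r C = 0" for C
  proof (rule poly_eqI)
    fix i
    have "coeff (?r C) i = 0" using that by simp
    then show "coeff C i = coeff 0 i" by (simp add: coeff_map_poly)
  qed
  ultimately show ?thesis by blast
qed

text \<open>The result of eliminating Z between its equation and the formula for G. Multiplication
  by \<open>B ^ 4\<close> makes the check a polynomial identity in Z, because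
  \<open>fps_X * B = Z\<close>.\<close>

lemma interval_gf_cubic:
  "64 * fps_X ^ 4 * interval_gf ^ 3 + (176 * fps_X ^ 4 - 288 * fps_X ^ 3 - 16 * fps_X ^ 2) * interval_gf ^ 2
   + (161 * fps_X ^ 4 - 452 * fps_X ^ 3 + 238 * fps_X ^ 2 - 28 * fps_X + 1) * interval_gf
   + (49 * fps_X ^ 4 - 167 * fps_X ^ 3 + 25 * fps_X ^ 2 - fps_X) = 0"
  (is "?P = 0")
proof -
  define Z :: "rat fps" where "Z = fps_inv param_fps"
  then have Z: "fps_nth Z 0 = 0" "Z = fps_X * (1 + Z) * (1 + 2 * Z) ^ 2"
    using fps_eq_iff_param_inverse by blast+
  define B where "B = (1 + Z) * (1 + 2 * Z) ^ 2"
  have XB: "fps_X * B = Z" using Z(2) by (simp add: B_def mult.assoc)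
  define G where "G = Z * (1 - 2 * Z + 2 * Z ^ 3)"
  have G: "interval_gf = G" unfolding G_def by (rule interval_gf_eq[OF Z])
  have X: "fps_X * B ^ 4 = Z * B ^ 3" "fps_X ^ 2 * B ^ 4 = Z ^ 2 * B ^ 2" "fps_X ^ 3 * B ^ 4 = Z ^ 3 * B"
    "fps_X ^ 4 * B ^ 4 = Z ^ 4"
    unfolding XB[symmetric] by (simp_all add: power_mult_distrib power2_eq_square power3_eq_cube power4_eq_xxxx mult_ac)
  have "?P * B ^ 4 = 64 * (fps_X ^ 4 * B ^ 4) * G ^ 3
     + (176 * (fps_X ^ 4 * B ^ 4) - 288 * (fps_X ^ 3 * B ^ 4) - 16 * (fps_X ^ 2 * B ^ 4)) * G ^ 2
     + (161 * (fps_X ^ 4 * B ^ 4) - 452 * (fps_X ^ 3 * B ^ 4) + 238 * (fps_X ^ 2 * B ^ 4) - 28 * (fps_X * B ^ 4) + B ^ 4) * G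
     + (49 * (fps_X ^ 4 * B ^ 4) - 167 * (fps_X ^ 3 * B ^ 4) + 25 * (fps_X ^ 2 * B ^ 4) - fps_X * B ^ 4)"
    unfolding G by (simp add: algebra_simps)
  also have "\<dots> = 0"
    unfolding X unfolding G_def B_def by algebra
  finally have "?P * B ^ 4 = 0" .
  moreover have "fps_nth B 0 = 1" using Z(1) by (simp add: B_def power2_eq_square)
  then have "B \<noteq> 0" by auto
  ultimately show ?thesis by simp
qed

definition cubic_coeff :: "nat \<Rightarrow> rat poly" where
  "cubic_coeff i = (if i = 0 then [:0, - 1, 25, - 167, 49:]
     else if i = 1 then [:1, - 28, 238, - 452, 161:]
     else if i = 2 then [:0, 0, - 16, - 288, 176:]
     else [:0, 0, 0, 0, 64:])"

lemma cubic_coeff_fps: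
  "fps_of_poly (cubic_coeff 0) = 49 * fps_X ^ 4 - 167 * fps_X ^ 3 + 25 * fps_X ^ 2 - fps_X"
  "fps_of_poly (cubic_coeff (Suc 0)) = 161 * fps_X ^ 4 - 452 * fps_X ^ 3 + 238 * fps_X ^ 2 - 28 * fps_X + 1"
  "fps_of_poly (cubic_coeff 2) = 176 * fps_X ^ 4 - 288 * fps_X ^ 3 - 16 * fps_X ^ 2"
  "fps_of_poly (cubic_coeff 3) = 64 * fps_X ^ 4"
  by (simp_all add: cubic_coeff_def fps_of_poly_pCons algebra_simps power2_eq_square power3_eq_cube power4_eq_xxxx
      flip: numeral_fps_const fps_const_neg)

lemma rational_flsI: "q \<noteq> 0 \<Longrightarrow> fps_to_fls (fps_of_poly p) / fps_to_fls (fps_of_poly q) \<in> rational_fls"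
  unfolding rational_fls_def by blast

lemma interval_gf_degree: "algebraic_of_degree rational_fls (fps_to_fls interval_gf) 3"
proof -
  let ?G = "fps_to_fls interval_gf"
  let ?c = "\<lambda>i. fps_to_fls (fps_of_poly (cubic_coeff i))"
  let ?p = "[:?c 0 / ?c 3, ?c (Suc 0) / ?c 3, ?c 2 / ?c 3, 1:]"
  have c3: "cubic_coeff 3 \<noteq> 0" by (simp add: cubic_coeff_def)
  then have fc3: "?c 3 \<noteq> 0" by (metis fps_of_poly_0 fps_of_poly_eq_iff fps_to_fls_eq_0_iff)
  have "is_minimal_poly rational_fls ?G ?p"
    unfolding is_minimal_poly_def
  proof (intro conjI allI impI)
    fix i
    have "1 \<in> (rational_fls :: rat fls set)" "0 \<in> (rational_fls :: rat fls set)"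
      using rational_flsI[of 1 "1 :: rat poly"] rational_flsI[of 1 "0 :: rat poly"] by simp_all
    then show "coeff ?p i \<in> rational_fls"
      using rational_flsI[OF c3] by (auto simp: coeff_pCons split: nat.split)
  next
    show "lead_coeff ?p = 1" by simp
  next
    have "?c 3 * ?G ^ 3 + ?c 2 * ?G ^ 2 + ?c (Suc 0) * ?G + ?c 0 = 0"
    proof -
      have "fps_of_poly (cubic_coeff 3) * interval_gf ^ 3 + fps_of_poly (cubic_coeff 2) * interval_gf ^ 2
         + fps_of_poly (cubic_coeff (Suc 0)) * interval_gf + fps_of_poly (cubic_coeff 0) = 0"
        unfolding cubic_coeff_fps by (rule interval_gf_cubic)
      from arg_cong[OF this, of fps_to_fls] show ?thesis
        by (simp only: fps_to_fls_plus fls_times_fps_to_fls fps_to_fls_power fps_zero_to_fls)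
    qed
    then have "?c 3 * poly ?p ?G = 0"
      using fc3 by (simp add: algebra_simps power2_eq_square power3_eq_cube)
    then show "poly ?p ?G = 0" using fc3 by simp
  next
    fix q assume q: "(\<forall>i. coeff q i \<in> rational_fls) \<and> q \<noteq> 0 \<and> poly q ?G = 0"
    have "\<not> degree q < 3"
    proof
      assume deg: "degree q < 3"
      have "\<exists>a b. b \<noteq> 0 \<and> coeff q i = fps_to_fls (fps_of_poly a) / fps_to_fls (fps_of_poly b)" for i
        using q unfolding rational_fls_def by blast
      then obtain a b where ab: "\<And>i. b i \<noteq> 0"
        "\<And>i. coeff q i = fps_to_fls (fps_of_poly (a i)) / fps_to_fls (fps_of_poly (b i))"
        by metis
      let ?F = "\<lambda>p. fps_to_fls (fps_of_poly p) :: rat fls"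
      have F0: "?F p = 0 \<longleftrightarrow> p = 0" for p
        by (metis fps_of_poly_0 fps_of_poly_eq_iff fps_to_fls_eq_0_iff)
      have mult: "?F (x * y) = ?F x * ?F y" for x y
        by (simp add: fps_of_poly_mult fls_times_fps_to_fls)
      have "poly q ?G = (\<Sum>i\<le>degree q. coeff q i * ?G ^ i)" by (rule poly_altdef)
      also have "\<dots> = (\<Sum>i\<le>2. coeff q i * ?G ^ i)"
        using deg by (intro sum.mono_neutral_left) (auto simp: coeff_eq_0)
      also have "\<dots> = coeff q 0 + coeff q 1 * ?G + coeff q 2 * ?G ^ 2"
        by (simp add: numeral_2_eq_2)
      finally have "coeff q 0 + coeff q 1 * ?G + coeff q 2 * ?G ^ 2 = 0" using q by simp
      \<comment> \<open>The product of the three denominators makes the coefficients polynomial, as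
        \<open>interval_gf_independent\<close> requires.\<close>
      then have "(?F (b 0) * ?F (b 1) * ?F (b 2)) * (coeff q 0 + coeff q 1 * ?G + coeff q 2 * ?G ^ 2) = 0"
        by simp
      moreover have "?F (b 0) * ?F (b 1) * ?F (b 2) * coeff q 0 = ?F (a 0 * b 1 * b 2)"
        "?F (b 0) * ?F (b 1) * ?F (b 2) * coeff q 1 = ?F (a 1 * b 0 * b 2)"
        "?F (b 0) * ?F (b 1) * ?F (b 2) * coeff q 2 = ?F (a 2 * b 0 * b 1)"
        unfolding ab(2) mult using ab(1) by (simp_all add: F0 field_simps)
      ultimately have "?F (a 0 * b 1 * b 2) + ?F (a 1 * b 0 * b 2) * ?G + ?F (a 2 * b 0 * b 1) * ?G ^ 2 = 0"
        by (simp only: ring_distribs mult.assoc[symmetric])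
      then have "fps_to_fls (fps_of_poly (a 0 * b 1 * b 2) + fps_of_poly (a 1 * b 0 * b 2) * interval_gf
         + fps_of_poly (a 2 * b 0 * b 1) * interval_gf ^ 2) = 0"
        by (simp only: fps_to_fls_plus fls_times_fps_to_fls fps_to_fls_power)
      then have "a 0 * b 1 * b 2 = 0 \<and> a 1 * b 0 * b 2 = 0 \<and> a 2 * b 0 * b 1 = 0"
        by (intro interval_gf_independent) (simp only: fps_to_fls_eq_0_iff)
      then have "a 0 = 0" "a 1 = 0" "a 2 = 0" using ab(1) by simp_all
      then have z: "coeff q 0 = 0" "coeff q 1 = 0" "coeff q 2 = 0" unfolding ab(2) by simp_all
      have "coeff q i = 0" for i
      proof (cases "i < 3")
        case True
        then have "i = 0 \<or> i = 1 \<or> i = 2" by linarith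
        then show ?thesis using z by blast
      next
        case False
        then show ?thesis using deg by (intro coeff_eq_0) simp
      qed
      then have "q = 0" by (intro poly_eqI) simp
      then show False using q by simp
    qed
    then show "degree ?p \<le> degree q" by simp
  qed
  then show ?thesis
    unfolding algebraic_of_degree_def by (intro exI[of _ ?p] conjI) simp_all
qed

section \<open>Lagrange inversion\<close>

lemma fps_deriv_power_Suc:
  "fps_deriv (a ^ Suc k) = of_nat (Suc k) * (fps_deriv a * a ^ k)" for a :: "'a :: comm_ring_1 fps"
  using fps_deriv_power[of a "Suc k"] by (simp add: fps_of_nat mult_ac del: power_Suc of_nat_Suc)

context
  fixes \<tau> \<phi> :: "'a :: field_char_0 fps"
  assumes inverse: "\<tau> * \<phi> = fps_X" and \<phi>0: "fps_nth \<phi> 0 = 1"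
begin

text \<open>The product is \<open>\<phi> ^ m\<close> minus \<open>fps_X\<close> times the derivative
  of \<open>\<phi> ^ m\<close> divided by \<open>m\<close>, and the operator X d/dX multiplies the
  coefficient of index \<open>m\<close> by \<open>m\<close>.\<close>

lemma fps_nth_power_diff_zero:
  assumes "m \<ge> 1"
  shows "fps_nth ((\<phi> - fps_X * fps_deriv \<phi>) * \<phi> ^ (m - 1)) m = 0"
proof -
  obtain k where m: "m = Suc k" using assms by (cases m) auto
  have "(\<phi> - fps_X * fps_deriv \<phi>) * \<phi> ^ k = \<phi> ^ Suc k - fps_X * (fps_deriv \<phi> * \<phi> ^ k)"
    by (simp add: algebra_simps)
  moreover have "fps_deriv (\<phi> ^ Suc k) = of_nat (Suc k) * (fps_deriv \<phi> * \<phi> ^ k)"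
    by (rule fps_deriv_power_Suc)
  then have "fps_nth (fps_deriv (\<phi> ^ Suc k)) k = of_nat (Suc k) * fps_nth (fps_deriv \<phi> * \<phi> ^ k) k"
    by (simp only: fps_mult_of_nat_nth)
  then have "of_nat (Suc k) * fps_nth (\<phi> ^ Suc k) (Suc k) = of_nat (Suc k) * fps_nth (fps_deriv \<phi> * \<phi> ^ k) k"
    by (simp only: fps_deriv_nth Suc_eq_plus1)
  then have "fps_nth (\<phi> ^ Suc k) (Suc k) = fps_nth (fps_deriv \<phi> * \<phi> ^ k) k"
    by (simp only: mult_cancel_left of_nat_neq_0 simp_thms)
  ultimately show ?thesis unfolding m by simp
qed

text \<open>By \<open>\<tau> * \<phi> = fps_X\<close> this is \<open>j\<close> times the coefficient
  of index \<open>n - j\<close> in \<open>(fps_deriv \<tau> * \<phi>) * \<phi> ^ (n - j)\<close>.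
  For \<open>j < n\<close> one more \<open>\<phi>\<close> turns the bracket into
  \<open>\<phi> - fps_X * fps_deriv \<phi>\<close>, and the coefficient is 0.\<close>

lemma lagrange_monom:
  assumes "1 \<le> j" "j \<le> n"
  shows "fps_nth (fps_deriv (\<tau> ^ j) * \<phi> ^ n) (n - 1) = (if j = n then of_nat n else 0)"
proof -
  have "fps_deriv (\<tau> * \<phi>) = 1" unfolding inverse by simp
  then have d: "fps_deriv \<tau> * \<phi> + \<tau> * fps_deriv \<phi> = 1" by (simp add: algebra_simps)
  obtain i where j: "j = Suc i" using assms(1) by (cases j) auto
  have "fps_deriv (\<tau> ^ j) * \<phi> ^ n = of_nat j * ((\<tau> * \<phi>) ^ i * (fps_deriv \<tau> * \<phi>) * \<phi> ^ (n - j))"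
  proof -
    have "n = i + 1 + (n - j)" using assms(2) j by simp
    then have "\<phi> ^ n = \<phi> ^ i * \<phi> * \<phi> ^ (n - j)" by (metis power_add power_one_right)
    then show ?thesis
      unfolding j fps_deriv_power_Suc by (simp add: power_mult_distrib ac_simps del: of_nat_Suc power_Suc)
  qed
  then have "fps_nth (fps_deriv (\<tau> ^ j) * \<phi> ^ n) (n - 1) =
     of_nat j * fps_nth (fps_X ^ i * ((fps_deriv \<tau> * \<phi>) * \<phi> ^ (n - j))) (n - 1)"
    unfolding inverse by (simp only: fps_mult_of_nat_nth mult.assoc)
  also have "\<dots> = of_nat j * fps_nth ((fps_deriv \<tau> * \<phi>) * \<phi> ^ (n - j)) (n - j)"
    using assms j by (simp add: fps_X_power_mult_nth)
  also have "fps_nth ((fps_deriv \<tau> * \<phi>) * \<phi> ^ (n - j)) (n - j) = (if j = n then 1 else 0)"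
  proof (cases "j = n")
    case True
    have "fps_nth (\<tau> * \<phi>) 0 = 0" unfolding inverse by simp
    then have "fps_nth \<tau> 0 = 0" using \<phi>0 by simp
    then have "fps_nth (fps_deriv \<tau> * \<phi>) 0 = 1" using arg_cong[OF d, of "\<lambda>F. fps_nth F 0"] by simp
    then show ?thesis using True by simp
  next
    case False
    then obtain k where k: "n - j = Suc k" using assms(2) by (metis Suc_diff_Suc le_neq_implies_less)
    have "(fps_deriv \<tau> * \<phi>) * \<phi> = (fps_deriv \<tau> * \<phi> + \<tau> * fps_deriv \<phi>) * \<phi> - (\<tau> * \<phi>) * fps_deriv \<phi>"
      by (simp add: algebra_simps)
    then have "(fps_deriv \<tau> * \<phi>) * \<phi> = \<phi> - fps_X * fps_deriv \<phi>" unfolding d inverse by simp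
    then have "(fps_deriv \<tau> * \<phi>) * \<phi> ^ Suc k = (\<phi> - fps_X * fps_deriv \<phi>) * \<phi> ^ k"
      by (simp only: power_Suc mult.assoc[symmetric])
    then show ?thesis
      using fps_nth_power_diff_zero[of "Suc k"] False unfolding k by (simp del: power_Suc)
  qed
  finally show ?thesis by simp
qed

theorem lagrange_inversion:
  assumes "F oo \<tau> = G" "n \<ge> 1"
  shows "of_nat n * fps_nth F n = fps_nth (fps_deriv G * \<phi> ^ n) (n - 1)"
proof -
  have "fps_nth (\<tau> * \<phi>) 0 = 0" unfolding inverse by simp
  then have \<tau>0: "fps_nth \<tau> 0 = 0" using \<phi>0 by simp
  let ?L = "\<lambda>F. fps_nth (fps_deriv (F oo \<tau>) * \<phi> ^ n) (n - 1)"
  have add: "?L (F + H) = ?L F + ?L H" for F H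
    by (simp add: fps_compose_add_distrib ring_distribs)
  \<comment> \<open>Downward induction from \<open>k = n + 1\<close>, where both sides are 0. Each
    step splits off the constant term of \<open>F\<close> and treats it by
    \<open>lagrange_monom\<close>.\<close>
  have "?L (fps_X ^ k * F) = of_nat n * fps_nth (fps_X ^ k * F) n" if "k \<le> Suc n" for k F
    using that
  proof (induction k arbitrary: F rule: inc_induct)
    case base
    have "(fps_X ^ Suc n * F) oo \<tau> = \<tau> ^ Suc n * (F oo \<tau>)"
      by (simp add: fps_compose_mult_distrib \<tau>0 del: power_Suc flip: fps_compose_power)
    then have "fps_deriv ((fps_X ^ Suc n * F) oo \<tau>) =
       \<tau> ^ Suc n * fps_deriv (F oo \<tau>) + of_nat (Suc n) * (fps_deriv \<tau> * \<tau> ^ n) * (F oo \<tau>)"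
      by (simp only: fps_deriv_mult fps_deriv_power_Suc)
    then have "fps_deriv ((fps_X ^ Suc n * F) oo \<tau>) * \<phi> ^ n =
       (\<tau> * \<phi>) ^ n * (of_nat (Suc n) * fps_deriv \<tau> * (F oo \<tau>) + \<tau> * fps_deriv (F oo \<tau>))"
      by (simp only: power_mult_distrib power_Suc algebra_simps)
    then have "?L (fps_X ^ Suc n * F) = 0"
      using assms(2) unfolding inverse by (simp add: fps_X_power_mult_nth del: of_nat_Suc power_Suc)
    then show ?case by (simp add: fps_X_power_mult_nth del: power_Suc)
  next
    case (step k)
    define c where "c = fps_nth F 0"
    have F: "F = fps_const c + fps_X * fps_shift 1 F"
      by (rule fps_ext) (simp add: c_def fps_X_mult_nth)
    have split: "fps_X ^ k * F = fps_const c * fps_X ^ k + fps_X ^ Suc k * fps_shift 1 F"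
      by (subst F) (simp add: algebra_simps)
    have "?L (fps_const c * fps_X ^ k) = c * fps_nth (fps_deriv (\<tau> ^ k) * \<phi> ^ n) (n - 1)"
      by (simp add: fps_compose_mult_distrib \<tau>0 mult.assoc flip: fps_compose_power)
    also have "\<dots> = of_nat n * fps_nth (fps_const c * fps_X ^ k) n"
    proof (cases "k = 0")
      case True
      then show ?thesis using assms(2) by simp
    next
      case False
      then show ?thesis using lagrange_monom[of k n] step.hyps by auto
    qed
    finally show ?case
      unfolding split add step.IH by (simp add: ring_distribs del: power_Suc)
  qed
  from this[of 0 F] show ?thesis using assms(1) by simp
qed

text \<open>Integration by parts for coefficients. The factor
  \<open>\<phi> - fps_X * fps_deriv \<phi>\<close> vanishes at the saddle point, so each use removes
  one cancellation from the asymptotics.\<close>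

lemma power_by_parts:
  assumes "n \<ge> 1"
  shows "of_nat n * fps_nth (h * (\<phi> - fps_X * fps_deriv \<phi>) * \<phi> ^ (n - 1)) n = fps_nth (fps_deriv h * \<phi> ^ n) (n - 1)"
proof (cases n)
  case (Suc k)
  have "fps_deriv (h * \<phi> ^ Suc k) = fps_deriv h * \<phi> ^ Suc k + of_nat (Suc k) * (h * (fps_deriv \<phi> * \<phi> ^ k))"
    by (simp only: fps_deriv_mult fps_deriv_power_Suc algebra_simps)
  then have "fps_nth (fps_deriv (h * \<phi> ^ Suc k)) k = fps_nth (fps_deriv h * \<phi> ^ Suc k) k +
     of_nat (Suc k) * fps_nth (h * (fps_deriv \<phi> * \<phi> ^ k)) k"
    by (simp only: fps_add_nth fps_mult_of_nat_nth)
  then have *: "of_nat (Suc k) * fps_nth (h * \<phi> ^ Suc k) (Suc k) = fps_nth (fps_deriv h * \<phi> ^ Suc k) k +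
     of_nat (Suc k) * fps_nth (h * (fps_deriv \<phi> * \<phi> ^ k)) k"
    by (simp only: fps_deriv_nth Suc_eq_plus1)
  have "h * (\<phi> - fps_X * fps_deriv \<phi>) * \<phi> ^ k = h * \<phi> ^ Suc k - fps_X * (h * (fps_deriv \<phi> * \<phi> ^ k))"
    by (simp add: algebra_simps)
  then have "fps_nth (h * (\<phi> - fps_X * fps_deriv \<phi>) * \<phi> ^ k) (Suc k) =
     fps_nth (h * \<phi> ^ Suc k) (Suc k) - fps_nth (h * (fps_deriv \<phi> * \<phi> ^ k)) k"
    by (simp only: fps_sub_nth fps_X_mult_nth) simp
  then show ?thesis using * Suc by (simp add: algebra_simps del: of_nat_Suc power_Suc)
qed (use assms in simp)

end

text \<open>The factor \<open>n\<close> comes from Lagrange inversion, \<open>n - 1\<close> and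
  \<open>n - 2\<close> from two integrations by parts.\<close>

lemma num_intervals_coeff:
  assumes "n \<ge> 3"
  defines "\<phi> \<equiv> (1 + fps_X) * (1 + 2 * fps_X) ^ 2 :: complex fps"
  shows "of_nat (n * (n - 1) * (n - 2) * num_intervals n) = 6 * fps_nth ((13 + 16 * fps_X) * \<phi> ^ n) (n - 3)"
proof -
  have inv: "param_fps * \<phi> = fps_X" unfolding \<phi>_def by (rule param_fps_eq)
  have \<phi>0: "fps_nth \<phi> 0 = 1" by (simp add: \<phi>_def power2_eq_square)
  obtain k where n: "n = k + 3" using assms(1) by (metis add.commute le_Suc_ex)
  let ?X = "fps_X :: complex fps"
  have d: "fps_deriv ?X = 1" by simp
  have D: "\<phi> - ?X * fps_deriv \<phi> = (1 + 2 * ?X) * (1 - 2 * ?X - 4 * ?X ^ 2)"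
    unfolding \<phi>_def by (simp add: fps_deriv_power algebra_simps power2_eq_square)
  \<comment> \<open>\<open>?h1\<close> and \<open>?h2\<close> are the first two derivatives of G in
    terms of the parameter: each is the derivative of the preceding function, divided by the
    derivative of \<open>fps_X / \<phi>\<close>.\<close>
  let ?h1 = "(1 - 2 * ?X) * (1 + ?X) ^ 2 * (1 + 2 * ?X) ^ 3"
  let ?h2 = "6 * (1 + ?X) ^ 3 * (1 + 2 * ?X) ^ 5"
  have "fps_deriv value_fps = (1 - 2 * ?X) * (1 - 2 * ?X - 4 * ?X ^ 2)"
    unfolding value_fps_def by (simp add: fps_deriv_power algebra_simps power2_eq_square power3_eq_cube power4_eq_xxxx)
  then have e1: "fps_deriv value_fps * \<phi> ^ n = ?h1 * (\<phi> - ?X * fps_deriv \<phi>) * \<phi> ^ (k + 1)"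
  proof -
    have "(1 - 2 * ?X) * (1 - 2 * ?X - 4 * ?X ^ 2) * \<phi> ^ 2 = ?h1 * (\<phi> - ?X * fps_deriv \<phi>)"
      unfolding D unfolding \<phi>_def by algebra
    moreover have "n = 2 + (k + 1)" by (simp add: n)
    then have "\<phi> ^ n = \<phi> ^ 2 * \<phi> ^ (k + 1)" by (simp only: power_add)
    ultimately show ?thesis unfolding \<open>fps_deriv value_fps = _\<close> by (simp only: mult.assoc[symmetric])
  qed
  have e2: "fps_deriv ?h1 * \<phi> ^ (k + 2) = ?h2 * (\<phi> - ?X * fps_deriv \<phi>) * \<phi> ^ k"
  proof -
    have "fps_deriv ?h1 = 6 * (1 - 2 * ?X - 4 * ?X ^ 2) * (1 + ?X) * (1 + 2 * ?X) ^ 2"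
      by (simp add: fps_deriv_power algebra_simps power2_eq_square power3_eq_cube power4_eq_xxxx)
    then have "fps_deriv ?h1 * \<phi> ^ 2 = ?h2 * (\<phi> - ?X * fps_deriv \<phi>)"
      unfolding D \<open>fps_deriv ?h1 = _\<close> unfolding \<phi>_def by algebra
    moreover have "\<phi> ^ (k + 2) = \<phi> ^ 2 * \<phi> ^ k" by (simp only: power_add mult.commute)
    ultimately show ?thesis by (simp only: mult.assoc[symmetric])
  qed
  have e3: "fps_deriv ?h2 * \<phi> ^ (k + 1) = 6 * ((13 + 16 * ?X) * \<phi> ^ n)"
  proof -
    have "Suc 2 = 3" "Suc 4 = 5" by simp_all
    then have dA: "fps_deriv ((1 + ?X) ^ 3) = 3 * (1 + ?X) ^ 2"
      and dB: "fps_deriv ((1 + 2 * ?X) ^ 5) = 5 * (2 * (1 + 2 * ?X) ^ 4)"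
      using fps_deriv_power_Suc[of "1 + ?X" 2] fps_deriv_power_Suc[of "1 + 2 * ?X" 4] by simp_all
    have "fps_deriv ?h2 = 6 * (fps_deriv ((1 + ?X) ^ 3) * (1 + 2 * ?X) ^ 5 + (1 + ?X) ^ 3 * fps_deriv ((1 + 2 * ?X) ^ 5))"
      unfolding fps_deriv_mult[of "6 * (1 + ?X) ^ 3"] fps_deriv_mult[of "6 :: complex fps"]
      by (simp only: fps_deriv_numeral algebra_simps) simp
    also have "\<dots> = 6 * (13 + 16 * ?X) * (1 + ?X) ^ 2 * (1 + 2 * ?X) ^ 4"
      unfolding dA dB by algebra
    finally have "fps_deriv ?h2 = 6 * (13 + 16 * ?X) * (1 + ?X) ^ 2 * (1 + 2 * ?X) ^ 4" .
    then have "fps_deriv ?h2 = 6 * (13 + 16 * ?X) * \<phi> ^ 2"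
      unfolding \<phi>_def by (simp add: power_mult_distrib flip: power_mult)
    moreover have "n = 2 + (k + 1)" by (simp add: n)
    then have "\<phi> ^ n = \<phi> ^ 2 * \<phi> ^ (k + 1)" by (simp only: power_add)
    ultimately show ?thesis by (simp only: mult.assoc)
  qed
  have 1: "of_nat n * of_nat (num_intervals n) = fps_nth (?h1 * (\<phi> - ?X * fps_deriv \<phi>) * \<phi> ^ (k + 1)) (k + 2)"
    using lagrange_inversion[OF inv \<phi>0 complex_interval_gf_compose, of n] unfolding e1
    by (simp add: n complex_interval_gf_def)
  have 2: "of_nat (k + 2) * fps_nth (?h1 * (\<phi> - ?X * fps_deriv \<phi>) * \<phi> ^ (k + 1)) (k + 2) =
      fps_nth (?h2 * (\<phi> - ?X * fps_deriv \<phi>) * \<phi> ^ k) (k + 1)"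
    using power_by_parts[OF inv \<phi>0, of "k + 2" ?h1] unfolding e2 by simp
  have 3: "of_nat (k + 1) * fps_nth (?h2 * (\<phi> - ?X * fps_deriv \<phi>) * \<phi> ^ k) (k + 1) =
      fps_nth (6 * ((13 + 16 * ?X) * \<phi> ^ n)) k"
    using power_by_parts[OF inv \<phi>0, of "k + 1" ?h2] unfolding e3 by simp
  have "of_nat (n * (n - 1) * (n - 2) * num_intervals n) =
     of_nat (k + 1) * (of_nat (k + 2) * (of_nat n * of_nat (num_intervals n) :: complex))"
  proof -
    have "n - 1 = k + 2" "n - 2 = k + 1" by (simp_all add: n)
    then show ?thesis by (simp only: of_nat_mult mult_ac)
  qed
  also have "\<dots> = fps_nth (6 * ((13 + 16 * ?X) * \<phi> ^ n)) k" unfolding 1 2 3 ..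
  also have "\<dots> = 6 * fps_nth ((13 + 16 * ?X) * \<phi> ^ n) (n - 3)"
    by (simp add: n fps_mult_numeral_left)
  finally show ?thesis .
qed

section \<open>The saddle point integral\<close>

lemma has_bochner_integral_iexp:
  fixes m :: int
  shows "has_bochner_integral lborel (\<lambda>x. indicator {- pi..pi} x *\<^sub>R iexp (m * x)) (if m = 0 then 2 * pi else 0)"
proof (cases "m = 0")
  case True
  have "has_bochner_integral lborel (\<lambda>x. indicator {- pi..pi} x *\<^sub>R (1::complex)) (of_real pi - of_real (- pi))"
    by (rule has_bochner_integral_FTC_Icc)
      (auto intro!: derivative_eq_intros has_vector_derivative_of_real)
  then show ?thesis using True by simp
next
  case False
  define F where "F = (\<lambda>x::real. iexp (m * x) / (\<i> * m))"
  have "has_bochner_integral lborel (\<lambda>x. indicator {- pi..pi} x *\<^sub>R iexp (m * x)) (F pi - F (- pi))"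
  proof (rule has_bochner_integral_FTC_Icc)
    show "(F has_vector_derivative iexp (m * x)) (at x within {- pi..pi})" for x :: real
    proof -
      have neg: "- (\<i> * (c * \<i>)) = c" for c by (simp add: complex_eq_iff)
      have "((\<lambda>z. exp (\<i> * (of_int m * z)) / (\<i> * of_int m)) has_field_derivative iexp (m * x)) (at (of_real x))"
        using False neg by (auto intro!: derivative_eq_intros)
      then have "((\<lambda>x. exp (\<i> * (of_int m * of_real x)) / (\<i> * of_int m)) has_vector_derivative iexp (m * x)) (at x within {- pi..pi})"
        by (rule has_vector_derivative_real_field)
      then show ?thesis by (simp add: F_def)
    qed
    show "continuous_on {- pi..pi} (\<lambda>x. iexp (m * x))" by (intro continuous_intros)
  qed simp
  moreover have "F pi = F (- pi)"
  proof -
    have "exp ((2 * of_int m * of_real pi) * \<i>) = (1 :: complex)"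
      using exp_integer_2pi[of "of_int m"] by simp
    moreover have "\<i> * (of_int m * of_real pi) = - (\<i> * (of_int m * of_real pi)) + (2 * of_int m * of_real pi) * \<i>"
      by (simp add: algebra_simps)
    ultimately have "exp (\<i> * (of_int m * of_real pi)) = exp (- (\<i> * (of_int m * of_real pi)))"
      by (metis exp_add mult_1_right)
    then show ?thesis unfolding F_def by simp
  qed
  ultimately show ?thesis using False by simp
qed

text \<open>Cauchy's formula on the circle of radius \<open>r\<close>; for a polynomial it is the
  orthogonality of exponentials. Summation up to \<open>max k (degree p)\<close> covers a
  \<open>k\<close> beyond the degree.\<close>

lemma poly_coeff_integral:
  fixes p :: "complex poly" and r :: real
  shows "(\<integral>x. indicator {- pi..pi} x *\<^sub>R (poly p (r * iexp x) * iexp (- (real k * x))) \<partial>lborel) = 2 * pi * r ^ k * coeff p k"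
proof -
  have eq: "indicator {- pi..pi} x *\<^sub>R (poly p (r * iexp x) * iexp (- (real k * x))) =
     (\<Sum>j\<le>max k (degree p). (coeff p j * r ^ j) * (indicator {- pi..pi} x *\<^sub>R iexp ((int j - int k) * x)))" for x :: real
  proof -
    have "poly p z = (\<Sum>j\<le>max k (degree p). coeff p j * z ^ j)" for z
      unfolding poly_altdef by (rule sum.mono_neutral_left) (auto simp: coeff_eq_0)
    moreover have "(r * iexp x) ^ j * iexp (- (real k * x)) = r ^ j * iexp ((int j - int k) * x)" for j
      by (simp add: power_mult_distrib algebra_simps flip: exp_of_nat_mult exp_add)
    ultimately show ?thesis
      by (simp add: sum_distrib_right scaleR_conv_of_real sum_distrib_left mult_ac)
  qed
  have "has_bochner_integral lborel (\<lambda>x. indicator {- pi..pi} x *\<^sub>R (poly p (r * iexp x) * iexp (- (real k * x))))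
     (\<Sum>j\<le>max k (degree p). (coeff p j * r ^ j) * (if int j - int k = 0 then 2 * pi else 0))"
    unfolding eq
    by (intro has_bochner_integral_sum has_bochner_integral_mult_right has_bochner_integral_iexp)
  also have "(\<Sum>j\<le>max k (degree p). (coeff p j * r ^ j) * (if int j - int k = 0 then 2 * pi else 0)) =
     (\<Sum>j\<le>max k (degree p). if j = k then coeff p j * r ^ j * (2 * pi) else 0)"
    by (intro sum.cong) auto
  also have "\<dots> = 2 * pi * r ^ k * coeff p k" by simp
  finally show ?thesis by (rule has_bochner_integral_integral_eq)
qed

text \<open>On this range \<open>x\<^sup>2 \<le> 10\<close>, so the Taylor bound
  \<open>x\<^sup>2 / 2 - x ^ 4 / 24\<close> is at least
  \<open>(1/2 - 10/24) * x\<^sup>2\<close>.\<close>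

lemma one_minus_cos_ge:
  assumes "\<bar>x\<bar> \<le> pi"
  shows "1 - cos x \<ge> x\<^sup>2 / 12"
proof -
  have "\<bar>Re (iexp x - (\<Sum>k\<le>3. (\<i> * x)^k / fact k))\<bar> \<le> \<bar>x\<bar> ^ 4 / 24"
    using iexp_approx1[of x 3] abs_Re_le_cmod[of "iexp x - (\<Sum>k\<le>3. (\<i> * x)^k / fact k)"]
    by (simp add: fact_numeral)
  moreover have "Re (iexp x - (\<Sum>k\<le>3. (\<i> * x)^k / fact k)) = cos x - (1 - x\<^sup>2 / 2)"
    by (simp add: eval_nat_numeral Re_exp fact_numeral power2_eq_square)
  ultimately have "\<bar>cos x - (1 - x\<^sup>2 / 2)\<bar> \<le> \<bar>x\<bar> ^ 4 / 24" by (simp only:)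
  moreover have "\<bar>x\<bar> ^ 4 = x ^ 4" by simp
  ultimately have "cos x \<le> 1 - x\<^sup>2 / 2 + x ^ 4 / 24"
    using abs_ge_self[of "cos x - (1 - x\<^sup>2 / 2)"] by linarith
  moreover have "x\<^sup>2 \<le> 10"
  proof -
    have "\<bar>x\<bar> \<le> 3.15" using assms pi_approx(2) by simp
    then have "\<bar>x\<bar>\<^sup>2 \<le> 3.15\<^sup>2" by (intro power_mono) simp_all
    then show ?thesis by (simp add: power2_eq_square)
  qed
  then have "x\<^sup>2 * x\<^sup>2 \<le> 10 * x\<^sup>2" by (intro mult_right_mono) simp_all
  then have "x ^ 4 \<le> 10 * x\<^sup>2" by (simp add: power4_eq_xxxx power2_eq_square)
  ultimately show ?thesis by simp
qed

lemma iexp_second_order: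
  "cmod (iexp x - (1 + \<i> * x - x\<^sup>2 / 2)) \<le> \<bar>x\<bar> ^ 3 / 6"
proof -
  have "(\<Sum>k\<le>2. (\<i> * complex_of_real x)^k / fact k) = 1 + \<i> * x - x\<^sup>2 / 2"
  proof -
    have "(\<Sum>k\<le>2. f k) = f 0 + f 1 + f 2" for f :: "nat \<Rightarrow> complex"
      by (simp add: numeral_2_eq_2)
    moreover have "(\<i> * complex_of_real x)\<^sup>2 = - (x\<^sup>2)"
      by (simp add: power_mult_distrib)
    ultimately show ?thesis by simp
  qed
  then show ?thesis using iexp_approx1[of x 2] by (simp add: fact_numeral numeral_3_eq_3)
qed

text \<open>The positive point where \<open>(1 + z) * (1 + 2 * z)\<^sup>2 / z\<close> is stationary;
  \<open>saddle_value / saddle\<close> is the growth rate.\<close>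

definition saddle :: real where "saddle = (sqrt 5 - 1) / 4"

lemma saddle: "4 * saddle\<^sup>2 + 2 * saddle = 1" "saddle > 0"
  by (simp_all add: saddle_def power2_eq_square field_simps)

definition saddle_value :: real where "saddle_value = (1 + saddle) * (1 + 2 * saddle)\<^sup>2"

lemma saddle_value_pos: "saddle_value > 0"
  unfolding saddle_value_def using saddle(2) by (simp add: add_pos_pos)

text \<open>The second moment of the distribution behind \<open>saddle_char\<close>, in closed
  form.\<close>

definition saddle_variance :: real where "saddle_variance = 7 * sqrt 5 - 15"

lemma saddle_variance_pos: "saddle_variance > 0"
proof -
  have "15\<^sup>2 < (7 * sqrt 5)\<^sup>2" by (simp add: power2_eq_square)
  then have "15 < 7 * sqrt 5" by (rule power2_less_imp_less) simp
  then show ?thesis by (simp add: saddle_variance_def)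
qed

text \<open>The factor \<open>(1 + z) * (1 + 2 * z)\<^sup>2 / z\<close> of Cauchy's integrand on the
  circle of radius \<open>saddle\<close>, scaled to 1 at \<open>x = 0\<close>.\<close>

definition saddle_char :: "real \<Rightarrow> complex" where
  "saddle_char x = (1 + saddle * iexp x) * (1 + 2 * saddle * iexp x)\<^sup>2 / (saddle_value * iexp x)"

text \<open>The decay is taken from \<open>1 + saddle * iexp x\<close> alone; the squared factor is
  bounded by its value at 0.\<close>

lemma cmod_saddle_char:
  "cmod (saddle_char x) \<le> sqrt (1 - 2 * saddle / (1 + saddle)\<^sup>2 * (1 - cos x))"
proof -
  have s: "saddle > 0" by (rule saddle)
  have "(cmod (1 + saddle * iexp x))\<^sup>2 = (1 + saddle)\<^sup>2 - 2 * saddle * (1 - cos x)"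
  proof -
    have "(cmod (1 + saddle * iexp x))\<^sup>2 = (1 + saddle * cos x)\<^sup>2 + (saddle * sin x)\<^sup>2"
      by (simp add: cmod_power2 Re_exp Im_exp)
    also have "\<dots> = 1 + 2 * saddle * cos x + saddle\<^sup>2 * ((cos x)\<^sup>2 + (sin x)\<^sup>2)"
      by algebra
    finally show ?thesis by (simp add: power2_eq_square algebra_simps)
  qed
  also have "\<dots> = (1 + saddle)\<^sup>2 * (1 - 2 * saddle / (1 + saddle)\<^sup>2 * (1 - cos x))"
    using s by (simp add: field_simps)
  finally have A: "cmod (1 + saddle * iexp x) = (1 + saddle) * sqrt (1 - 2 * saddle / (1 + saddle)\<^sup>2 * (1 - cos x))"
    using s by (metis abs_of_pos add_pos_pos norm_ge_zero real_sqrt_abs real_sqrt_mult real_sqrt_unique zero_less_one)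
  have "cmod (1 + 2 * saddle * iexp x) \<le> 1 + 2 * saddle"
    using norm_triangle_ineq[of 1 "2 * saddle * iexp x"] s by (simp add: norm_mult)
  then have "(cmod (1 + 2 * saddle * iexp x))\<^sup>2 \<le> (1 + 2 * saddle)\<^sup>2"
    by (intro power_mono) simp_all
  then have "cmod (1 + saddle * iexp x) * (cmod (1 + 2 * saddle * iexp x))\<^sup>2 \<le>
     (1 + saddle) * sqrt (1 - 2 * saddle / (1 + saddle)\<^sup>2 * (1 - cos x)) * (1 + 2 * saddle)\<^sup>2"
    unfolding A[symmetric] by (intro mult_left_mono) simp_all
  also have "\<dots> = saddle_value * sqrt (1 - 2 * saddle / (1 + saddle)\<^sup>2 * (1 - cos x))"
    by (simp add: saddle_value_def)
  finally have "cmod (1 + saddle * iexp x) * (cmod (1 + 2 * saddle * iexp x))\<^sup>2 / saddle_value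
      \<le> sqrt (1 - 2 * saddle / (1 + saddle)\<^sup>2 * (1 - cos x))"
    using saddle_value_pos by (simp add: field_simps)
  moreover have "cmod (saddle_char x) = cmod (1 + saddle * iexp x) * (cmod (1 + 2 * saddle * iexp x))\<^sup>2 / saddle_value"
    using saddle_value_pos by (simp add: saddle_char_def norm_divide norm_mult norm_power)
  ultimately show ?thesis by simp
qed

definition saddle_decay :: real where "saddle_decay = saddle / (1 + saddle)\<^sup>2 / 12"

lemma saddle_decay_pos: "saddle_decay > 0"
  using saddle(2) by (simp add: saddle_decay_def)

text \<open>The bound holds on the whole range of integration, so one Gaussian majorant serves both
  the centre and the tails.\<close>

lemma cmod_saddle_char_le_exp:
  assumes "\<bar>x\<bar> \<le> pi"
  shows "cmod (saddle_char x) \<le> exp (- saddle_decay * x\<^sup>2)"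
proof -
  have "2 * saddle / (1 + saddle)\<^sup>2 * (x\<^sup>2 / 12) \<le> 2 * saddle / (1 + saddle)\<^sup>2 * (1 - cos x)"
    using one_minus_cos_ge[OF assms] saddle(2) by (intro mult_left_mono) simp_all
  then have "1 - 2 * saddle / (1 + saddle)\<^sup>2 * (1 - cos x) \<le> 1 + (- 2 * saddle_decay * x\<^sup>2)"
    by (simp add: saddle_decay_def field_simps)
  also have "\<dots> \<le> exp (- 2 * saddle_decay * x\<^sup>2)" by (rule exp_ge_add_one_self)
  also have "\<dots> = (exp (- saddle_decay * x\<^sup>2))\<^sup>2" by (simp flip: exp_double)
  finally have "sqrt (1 - 2 * saddle / (1 + saddle)\<^sup>2 * (1 - cos x)) \<le> exp (- saddle_decay * x\<^sup>2)"
    by (intro real_le_lsqrt) simp_all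
  then show ?thesis using cmod_saddle_char[of x] by linarith
qed

lemma cmod_saddle_char_le_1: "cmod (saddle_char x) \<le> 1"
proof -
  have "2 * saddle / (1 + saddle)\<^sup>2 * (1 - cos x) \<ge> 0" using saddle(2) by (intro mult_nonneg_nonneg) simp_all
  then have "sqrt (1 - 2 * saddle / (1 + saddle)\<^sup>2 * (1 - cos x)) \<le> sqrt 1" by (intro real_sqrt_le_mono) linarith
  then show ?thesis using cmod_saddle_char[of x] unfolding real_sqrt_one by linarith
qed

text \<open>\<open>saddle_char\<close> is the characteristic function of a probability distribution on \<open>{-1, 0, 1, 2}\<close>, which
  is centred because \<open>saddle\<close> is a saddle point.\<close>

lemma saddle_char_second_order:
  "cmod (saddle_char x - (1 - saddle_variance * x\<^sup>2 / 2)) \<le> 10 * \<bar>x\<bar> ^ 3"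
proof -
  define w where "w = saddle_value"
  \<comment> \<open>The terms of \<open>1 + 5 * z + 8 * z\<^sup>2 + 4 * z ^ 3\<close> at
    \<open>z = saddle\<close>, divided by their sum: the probabilities of -1, 0, 1, 2.\<close>
  define p0 p1 p2 p3 where p: "p0 = 1 / w" "p1 = 5 * saddle / w" "p2 = 8 * saddle\<^sup>2 / w" "p3 = 4 * saddle ^ 3 / w"
  have w0: "w > 0" using saddle_value_pos by (simp add: w_def)
  have r2: "saddle\<^sup>2 = (1 - 2 * saddle) / 4" using saddle(1) by simp
  have "saddle ^ 3 = saddle * saddle\<^sup>2" by (simp add: power2_eq_square power3_eq_cube)
  also have "\<dots> = saddle * ((1 - 2 * saddle) / 4)" by (simp only: r2)
  also have "\<dots> = (saddle - 2 * saddle\<^sup>2) / 4" by (simp add: field_simps power2_eq_square)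
  also have "\<dots> = (4 * saddle - 1) / 8" by (simp only: r2) (simp add: field_simps)
  finally have r3: "saddle ^ 3 = (4 * saddle - 1) / 8" .
  have w: "w = 1 + 5 * saddle + 8 * saddle\<^sup>2 + 4 * saddle ^ 3"
    by (simp add: w_def saddle_value_def power2_eq_square power3_eq_cube algebra_simps)
  have "p0 + p1 + p2 + p3 = (1 + 5 * saddle + 8 * saddle\<^sup>2 + 4 * saddle ^ 3) / w"
    unfolding p by (simp add: add_divide_distrib)
  then have tot: "p0 + p1 + p2 + p3 = 1" using w0 unfolding w[symmetric] by simp
  have "- p0 + p2 + 2 * p3 = (- 1 + 8 * saddle\<^sup>2 + 8 * saddle ^ 3) / w"
    unfolding p by (simp add: add_divide_distrib diff_divide_distrib)
  \<comment> \<open>The saddle point equation makes the mean vanish, so no linear term in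
    \<open>x\<close> remains.\<close>
  moreover have "- 1 + 8 * saddle\<^sup>2 + 8 * saddle ^ 3 = 0"
    unfolding r2 r3 by (simp add: field_simps)
  ultimately have mean: "- p0 + p2 + 2 * p3 = 0" by simp
  have "p0 + p2 + 4 * p3 = (1 + 8 * saddle\<^sup>2 + 16 * saddle ^ 3) / w"
    unfolding p by (simp add: add_divide_distrib)
  also have "1 + 8 * saddle\<^sup>2 + 16 * saddle ^ 3 = sqrt 5"
    unfolding r2 r3 by (simp add: saddle_def field_simps)
  also have "w = (7 + 3 * sqrt 5) / 4"
    unfolding w r2 r3 by (simp add: saddle_def field_simps)
  also have "sqrt 5 / ((7 + 3 * sqrt 5) / 4) = saddle_variance"
  proof -
    have "(7 + 3 * sqrt 5) / 4 > 0" by (simp add: add_pos_pos)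
    then have "(7 + 3 * sqrt 5) / 4 \<noteq> 0" by (rule less_imp_neq[THEN not_sym])
    moreover have "sqrt 5 = saddle_variance * ((7 + 3 * sqrt 5) / 4)"
      by (simp add: saddle_variance_def algebra_simps)
    ultimately show ?thesis using nonzero_divide_eq_eq by blast
  qed
  finally have var: "p0 + p2 + 4 * p3 = saddle_variance" .
  have nn: "p0 \<ge> 0" "p1 \<ge> 0" "p2 \<ge> 0" "p3 \<ge> 0" using w0 saddle(2) by (simp_all add: p)
  have inv: "iexp (- x) * iexp x = 1" by (simp flip: exp_add)
  have dbl: "iexp (2 * x) = iexp x * iexp x"
    unfolding exp_add[symmetric] by (rule arg_cong[where f = exp]) (simp add: algebra_simps)
  have "saddle_char x = (1 + 5 * saddle * iexp x + 8 * saddle\<^sup>2 * (iexp x)\<^sup>2 + 4 * saddle ^ 3 * (iexp x) ^ 3) * iexp (- x) / w"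
    unfolding saddle_char_def w_def using saddle_value_pos inv
    by (simp add: exp_minus field_simps power2_eq_square power3_eq_cube)
  also have "\<dots> = p0 * iexp (- x) + p1 * (iexp (- x) * iexp x) + p2 * (iexp (- x) * iexp x) * iexp x +
       p3 * (iexp (- x) * iexp x) * (iexp x * iexp x)"
    unfolding p by (simp add: field_simps power2_eq_square power3_eq_cube add_divide_distrib)
  finally have sc: "saddle_char x = p0 * iexp (- x) + p1 + p2 * iexp x + p3 * iexp (2 * x)"
    unfolding inv dbl by simp
  define E where "E = (\<lambda>y::real. iexp y - (1 + \<i> * y - y\<^sup>2 / 2))"
  have E: "cmod (E y) \<le> \<bar>y\<bar> ^ 3 / 6" for y unfolding E_def by (rule iexp_second_order)
  have iexp: "iexp y = E y + (1 + \<i> * y - y\<^sup>2 / 2)" for y by (simp add: E_def)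
  have "saddle_char x = of_real (p0 + p1 + p2 + p3) + \<i> * x * of_real (- p0 + p2 + 2 * p3) -
     of_real (p0 + p2 + 4 * p3) * x\<^sup>2 / 2 + (p0 * E (- x) + p2 * E x + p3 * E (2 * x))"
    unfolding sc iexp by (simp add: algebra_simps power2_eq_square)
  then have "saddle_char x - (1 - saddle_variance * x\<^sup>2 / 2) = p0 * E (- x) + p2 * E x + p3 * E (2 * x)"
    unfolding tot mean var by simp
  also have "cmod \<dots> \<le> p0 * cmod (E (- x)) + p2 * cmod (E x) + p3 * cmod (E (2 * x))"
    using nn by (intro norm_triangle_le add_mono) (simp_all add: norm_mult)
  also have "\<dots> \<le> 1 * (\<bar>x\<bar> ^ 3 / 6) + 1 * (\<bar>x\<bar> ^ 3 / 6) + 1 * (8 * \<bar>x\<bar> ^ 3 / 6)"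
    using E[of "- x"] E[of x] E[of "2 * x"] nn tot
    by (intro add_mono mult_mono) (simp_all add: power_mult_distrib abs_mult)
  also have "\<dots> \<le> 10 * \<bar>x\<bar> ^ 3" by simp
  finally show ?thesis .
qed
text \<open>The factor \<open>13 + 16 * z\<close> of the integrand, together with
  \<open>iexp (3 * x)\<close>, which is due to the index \<open>n - 3\<close> of the
  coefficient.\<close>

definition saddle_weight :: "real \<Rightarrow> complex" where
  "saddle_weight x = (13 + 16 * saddle * iexp x) * iexp (3 * x)"

lemma cmod_saddle_weight: "cmod (saddle_weight x) \<le> 13 + 16 * saddle"
  using norm_triangle_ineq[of 13 "16 * saddle * iexp x"] saddle(2)
  by (simp add: saddle_weight_def norm_mult)

lemma continuous_saddle_weight: "continuous_on A saddle_weight"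
  unfolding saddle_weight_def by (intro continuous_intros)

lemma continuous_saddle_char: "continuous_on A saddle_char"
  unfolding saddle_char_def using saddle_value_pos by (intro continuous_intros) auto

text \<open>The central limit theorem in its classical form: \<open>saddle_char\<close> and, for
  large \<open>n\<close>, its quadratic approximation lie in the unit disc, so their
  \<open>n\<close>-th powers differ by at most \<open>n\<close> times their distance, which is of
  order \<open>1 / sqrt n\<close>.\<close>

lemma saddle_char_power_tendsto:
  "(\<lambda>n. saddle_char (x / sqrt n) ^ n) \<longlonglongrightarrow> of_real (exp (- saddle_variance * x\<^sup>2 / 2))"
proof -
  let ?b = "\<lambda>n::nat. 1 - saddle_variance * (x / sqrt n)\<^sup>2 / 2"
  define c where "c = - saddle_variance * x\<^sup>2 / 2"
  have b: "?b n = 1 + c / n" if "n > 0" for n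
    using that by (simp add: c_def power_divide)
  have "(\<lambda>n. c / real n) \<longlonglongrightarrow> 0" by (rule lim_const_over_n)
  then have "eventually (\<lambda>n. \<bar>c / real n\<bar> < 1) sequentially"
    using order_tendstoD(2)[OF tendsto_rabs] by fastforce
  then have ev: "eventually (\<lambda>n. cmod (saddle_char (x / sqrt n) ^ n - of_real (?b n) ^ n) \<le> 10 * \<bar>x\<bar> ^ 3 / sqrt n) sequentially"
    using eventually_gt_at_top[of 0]
  proof eventually_elim
    case (elim n)
    have "c \<le> 0" using saddle_variance_pos by (simp add: c_def)
    then have "c / real n \<le> 0" using elim by (simp add: divide_nonpos_pos)
    then have "\<bar>?b n\<bar> \<le> 1" unfolding b[OF elim(2)] using elim(1) by linarith
    then have "cmod (saddle_char (x / sqrt n) ^ n - of_real (?b n) ^ n) \<le> n * cmod (saddle_char (x / sqrt n) - of_real (?b n))"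
      by (intro norm_power_diff cmod_saddle_char_le_1) (simp only: norm_of_real)
    also have "cmod (saddle_char (x / sqrt n) - of_real (?b n)) \<le> 10 * \<bar>x / sqrt n\<bar> ^ 3"
      using saddle_char_second_order[of "x / sqrt n"] by simp
    also have "n * (10 * \<bar>x / sqrt n\<bar> ^ 3) = 10 * \<bar>x\<bar> ^ 3 * (n / sqrt n ^ 3)"
      by (simp add: abs_divide power_divide)
    also have "real n / sqrt n ^ 3 = 1 / sqrt n"
      using elim(2) by (simp add: power3_eq_cube field_simps)
    finally show ?case using elim(2) by (simp add: mult_left_mono)
  qed
  have "(\<lambda>n. 10 * \<bar>x\<bar> ^ 3 / sqrt (real n)) \<longlonglongrightarrow> 0"
    by (intro real_tendsto_divide_at_top[OF tendsto_const] filterlim_compose[OF sqrt_at_top] filterlim_real_sequentially)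
  from Lim_null_comparison[OF ev this]
  have diff: "(\<lambda>n. saddle_char (x / sqrt n) ^ n - of_real (?b n) ^ n) \<longlonglongrightarrow> 0" .
  have "(\<lambda>n. (1 + c / real n) ^ n) \<longlonglongrightarrow> exp c" by (rule tendsto_exp_limit_sequentially)
  then have "(\<lambda>n. ?b n ^ n) \<longlonglongrightarrow> exp c"
    by (rule Lim_transform_eventually) (use eventually_gt_at_top[of 0] in \<open>eventually_elim, simp only: b\<close>)
  then have "(\<lambda>n. complex_of_real (?b n ^ n)) \<longlonglongrightarrow> of_real (exp c)" by (rule tendsto_of_real)
  then have "(\<lambda>n. complex_of_real (?b n) ^ n) \<longlonglongrightarrow> of_real (exp c)" by (simp only: of_real_power)
  from tendsto_add[OF diff this] show ?thesis by (simp add: c_def)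
qed

lemma gaussian_integral:
  assumes "s > 0"
  shows "has_bochner_integral lborel (\<lambda>x. exp (- s * x\<^sup>2 / 2)) (sqrt (2 * pi / s))"
proof -
  have eq: "exp (- s * x\<^sup>2 / 2) = sqrt (2 * pi / s) * normal_density 0 (1 / sqrt s) x" for x
    using assms by (simp add: normal_density_def power_divide field_simps)
  have "has_bochner_integral lborel (normal_density 0 (1 / sqrt s)) 1"
    using assms by (simp add: has_bochner_integral_iff integral_normal_density integrable_normal_density)
  then show ?thesis
    unfolding eq using has_bochner_integral_mult_right[of "sqrt (2 * pi / s)"] by fastforce
qed

definition saddle_integral :: "nat \<Rightarrow> complex" where
  "saddle_integral n = (\<integral>x. indicator {- pi * sqrt n..pi * sqrt n} x *\<^sub>R
     (saddle_weight (x / sqrt n) * saddle_char (x / sqrt n) ^ n) \<partial>lborel)"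

text \<open>Dominated convergence with the majorant from \<open>cmod_saddle_char_le_exp\<close>; of
  the weight only its value \<open>13 + 16 * saddle\<close> at 0 survives.\<close>

lemma saddle_integral_tendsto:
  "saddle_integral \<longlonglongrightarrow> of_real ((13 + 16 * saddle) * sqrt (2 * pi / saddle_variance))"
proof -
  let ?f = "\<lambda>x. complex_of_real ((13 + 16 * saddle) * exp (- saddle_variance * x\<^sup>2 / 2))"
  \<comment> \<open>The shift to \<open>Suc n\<close> keeps the square root positive;
    \<open>LIMSEQ_imp_Suc\<close> undoes it at the end.\<close>
  let ?s = "\<lambda>n x. indicator {- pi * sqrt (Suc n)..pi * sqrt (Suc n)} x *\<^sub>R
     (saddle_weight (x / sqrt (Suc n)) * saddle_char (x / sqrt (Suc n)) ^ Suc n)"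
  let ?w = "\<lambda>x. (13 + 16 * saddle) * exp (- (2 * saddle_decay) * x\<^sup>2 / 2)"
  have [measurable]: "saddle_weight \<in> borel_measurable borel" "saddle_char \<in> borel_measurable borel"
    by (intro borel_measurable_continuous_onI continuous_saddle_weight continuous_saddle_char)+
  have f: "has_bochner_integral lborel ?f (of_real ((13 + 16 * saddle) * sqrt (2 * pi / saddle_variance)))"
    by (intro has_bochner_integral_of_real has_bochner_integral_mult_right gaussian_integral saddle_variance_pos)
  have "(\<lambda>n. integral\<^sup>L lborel (?s n)) \<longlonglongrightarrow> integral\<^sup>L lborel ?f"
  proof (rule integral_dominated_convergence[where w = ?w])
    show "?f \<in> borel_measurable lborel" by measurable
    show "?s n \<in> borel_measurable lborel" for n by measurable
    show "integrable lborel ?w"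
      using gaussian_integral[of "2 * saddle_decay"] saddle_decay_pos
      by (intro integrable_mult_right) (auto simp: has_bochner_integral_iff)
    show "AE x in lborel. (\<lambda>n. ?s n x) \<longlonglongrightarrow> ?f x"
    proof (rule AE_I2)
      fix x :: real
      have "(\<lambda>n. x / sqrt (real n)) \<longlonglongrightarrow> 0"
        by (intro real_tendsto_divide_at_top[OF tendsto_const] filterlim_compose[OF sqrt_at_top] filterlim_real_sequentially)
      moreover have "isCont saddle_weight 0"
        using continuous_saddle_weight[of UNIV] by (simp add: continuous_on_eq_continuous_at)
      ultimately have "(\<lambda>n. saddle_weight (x / sqrt (real n))) \<longlonglongrightarrow> saddle_weight 0"
        using isCont_tendsto_compose by blast
      then have "(\<lambda>n. saddle_weight (x / sqrt (real n)) * saddle_char (x / sqrt n) ^ n) \<longlonglongrightarrow>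
          saddle_weight 0 * of_real (exp (- saddle_variance * x\<^sup>2 / 2))"
        by (intro tendsto_mult saddle_char_power_tendsto)
      then have "(\<lambda>n. saddle_weight (x / sqrt (real n)) * saddle_char (x / sqrt n) ^ n) \<longlonglongrightarrow> ?f x"
        by (simp add: saddle_weight_def)
      then have lim: "(\<lambda>n. saddle_weight (x / sqrt (Suc n)) * saddle_char (x / sqrt (Suc n)) ^ Suc n) \<longlonglongrightarrow> ?f x"
        by (rule LIMSEQ_Suc)
      have "filterlim (\<lambda>n. pi * sqrt (real (Suc n))) at_top sequentially"
        by (intro filterlim_tendsto_pos_mult_at_top[OF tendsto_const pi_gt_zero]
            filterlim_compose[OF sqrt_at_top] filterlim_compose[OF filterlim_real_sequentially] filterlim_Suc)
      then have "eventually (\<lambda>n. \<bar>x\<bar> \<le> pi * sqrt (real (Suc n))) sequentially"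
        by (simp add: filterlim_at_top)
      then have "eventually (\<lambda>n. saddle_weight (x / sqrt (Suc n)) * saddle_char (x / sqrt (Suc n)) ^ Suc n = ?s n x) sequentially"
        by eventually_elim (auto simp: indicator_def abs_le_iff)
      with lim show "(\<lambda>n. ?s n x) \<longlonglongrightarrow> ?f x" by (rule Lim_transform_eventually)
    qed
    show "AE x in lborel. norm (?s n x) \<le> ?w x" for n
    proof (rule AE_I2)
      fix x :: real
      let ?m = "real (Suc n)"
      show "norm (?s n x) \<le> ?w x"
      proof (cases "x \<in> {- pi * sqrt ?m..pi * sqrt ?m}")
        case True
        have m: "sqrt ?m > 0" by simp
        have "\<bar>x\<bar> \<le> pi * sqrt ?m" using True by auto
        then have "\<bar>x / sqrt ?m\<bar> \<le> pi" using m by (simp only: abs_divide abs_of_pos pos_divide_le_eq)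
        then have "cmod (saddle_char (x / sqrt ?m)) ^ Suc n \<le> exp (- saddle_decay * (x / sqrt ?m)\<^sup>2) ^ Suc n"
          by (intro power_mono cmod_saddle_char_le_exp) simp_all
        also have "\<dots> = exp (?m * (- saddle_decay * (x / sqrt ?m)\<^sup>2))" by (rule exp_of_nat_mult[symmetric])
        also have "?m * (- saddle_decay * (x / sqrt ?m)\<^sup>2) = - saddle_decay * x\<^sup>2"
          by (simp add: power_divide del: of_nat_Suc)
        finally have "cmod (saddle_weight (x / sqrt ?m)) * cmod (saddle_char (x / sqrt ?m)) ^ Suc n \<le>
           (13 + 16 * saddle) * exp (- saddle_decay * x\<^sup>2)"
          using saddle(2) by (intro mult_mono cmod_saddle_weight) simp_all
        then show ?thesis using True by (simp add: norm_mult norm_power del: of_nat_Suc power_Suc)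
      next
        case False
        then show ?thesis using saddle(2) by simp
      qed
    qed
  qed
  then have "(\<lambda>n. saddle_integral (Suc n)) \<longlonglongrightarrow> of_real ((13 + 16 * saddle) * sqrt (2 * pi / saddle_variance))"
    unfolding saddle_integral_def has_bochner_integral_integral_eq[OF f] .
  then show ?thesis by (rule LIMSEQ_imp_Suc)
qed

text \<open>Cauchy's formula on the circle of radius \<open>saddle\<close>; the substitution of
  \<open>x / sqrt n\<close> for \<open>x\<close> supplies the factor
  \<open>1 / sqrt n\<close>.\<close>

lemma coeff_saddle_integral:
  assumes "n \<ge> 3"
  shows "coeff ([:13, 16:] * [:1, 5, 8, 4:] ^ n) (n - 3) =
     (saddle_value / saddle) ^ n * saddle ^ 3 / (2 * pi * sqrt n) * saddle_integral n"
proof -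
  let ?p = "[:13, 16:] * [:1, 5, 8, 4:] ^ n :: complex poly"
  let ?g = "\<lambda>x. indicator {- pi..pi} x *\<^sub>R (saddle_weight x * saddle_char x ^ n)"
  have n0: "sqrt (real n) > 0" using assms by simp
  have "poly ?p (saddle * iexp x) * iexp (- (real (n - 3) * x)) = saddle_value ^ n * (saddle_weight x * saddle_char x ^ n)" for x
  proof -
    have "poly [:1, 5, 8, 4:] z = (1 + z) * (1 + 2 * z)\<^sup>2" for z :: complex
      by (simp add: algebra_simps power2_eq_square)
    then have P: "poly ?p z = (13 + 16 * z) * ((1 + z) * (1 + 2 * z)\<^sup>2) ^ n" for z
      by (simp only: poly_mult poly_power) simp
    have "poly ?p (saddle * iexp x) = (13 + 16 * saddle * iexp x) * (saddle_value * iexp x * saddle_char x) ^ n"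
      unfolding P using saddle_value_pos by (simp add: saddle_char_def mult.assoc)
    moreover have "iexp x ^ n * iexp (- (real (n - 3) * x)) = iexp (3 * x)"
      using assms by (simp add: of_nat_diff algebra_simps flip: exp_of_nat_mult exp_add)
    ultimately show ?thesis
      by (simp add: saddle_weight_def power_mult_distrib mult_ac)
  qed
  then have "2 * pi * saddle ^ (n - 3) * coeff ?p (n - 3) = (\<integral>x. saddle_value ^ n * ?g x \<partial>lborel)"
    unfolding poly_coeff_integral[of ?p saddle "n - 3", symmetric] by simp
  also have "\<dots> = saddle_value ^ n * (\<integral>x. ?g x \<partial>lborel)"
    by (rule integral_mult_right_zero)
  also have "(\<integral>x. ?g x \<partial>lborel) = \<bar>1 / sqrt n\<bar> *\<^sub>R (\<integral>x. ?g (0 + 1 / sqrt n * x) \<partial>lborel)"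
    using n0 by (intro lborel_integral_real_affine) simp
  also have "(\<lambda>x. ?g (0 + 1 / sqrt n * x)) = (\<lambda>x. indicator {- pi * sqrt n..pi * sqrt n} x *\<^sub>R
     (saddle_weight (x / sqrt n) * saddle_char (x / sqrt n) ^ n))"
    using n0 by (intro ext) (simp add: indicator_def field_simps)
  finally have *: "2 * pi * saddle ^ (n - 3) * coeff ?p (n - 3) = saddle_value ^ n * (saddle_integral n / sqrt n)"
    using n0 by (simp add: saddle_integral_def scaleR_conv_of_real)
  have "saddle ^ n = saddle ^ (n - 3) * saddle ^ 3" using assms by (simp flip: power_add)
  then have r: "complex_of_real saddle ^ n = saddle ^ (n - 3) * saddle ^ 3" by (metis of_real_mult of_real_power)
  have "coeff ?p (n - 3) = saddle_value ^ n * (saddle_integral n / sqrt n) / (2 * pi * saddle ^ (n - 3))"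
    unfolding *[symmetric] using saddle(2) by simp
  also have "\<dots> = (saddle_value / saddle) ^ n * saddle ^ 3 / (2 * pi * sqrt n) * saddle_integral n"
    using saddle(2) by (simp add: power_divide r)
  finally show ?thesis .
qed

section \<open>Evaluation of the constants and the final estimate\<close>

lemma saddle_cube: "(13 + 16 * saddle) * saddle ^ 3 = (sqrt 5 + 2) / 8"
proof -
  have "saddle\<^sup>2 = (1 - 2 * saddle) / 4" using saddle(1) by simp
  moreover have "(13 + 16 * saddle) * saddle ^ 3 = saddle * (13 * saddle\<^sup>2 + 16 * saddle * saddle\<^sup>2)"
    by (simp add: algebra_simps power2_eq_square power3_eq_cube)
  ultimately have "(13 + 16 * saddle) * saddle ^ 3 = saddle * (13 * ((1 - 2 * saddle) / 4) + 16 * saddle * ((1 - 2 * saddle) / 4))"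
    by (simp only:)
  also have "\<dots> = (sqrt 5 + 2) / 8"
    by (simp add: saddle_def field_simps)
  finally show ?thesis .
qed

lemma saddle_quotient: "saddle_value / saddle = (11 + 5 * sqrt 5) / 2"
proof -
  have "saddle_value = (11 + 5 * sqrt 5) / 2 * saddle"
    by (simp add: saddle_value_def saddle_def field_simps power2_eq_square)
  then show ?thesis using saddle(2) by simp
qed

text \<open>Compares the limit of the rescaled integral with the claimed constant; the
  \<open>2 * pi\<close> on the right is that of Cauchy's formula.\<close>

lemma saddle_constant:
  "6 * saddle ^ 3 * ((13 + 16 * saddle) * sqrt (2 * pi / saddle_variance)) =
   2 * pi * (3 / 8 * sqrt ((275 + 123 * sqrt 5) / (10 * pi)))"
proof -
  have v: "20 * (9 + 4 * sqrt 5) = saddle_variance * (275 + 123 * sqrt 5)"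
    by (simp add: saddle_variance_def algebra_simps)
  have "(sqrt 5 + 2)\<^sup>2 = 9 + 4 * sqrt 5" by (simp add: power2_eq_square algebra_simps)
  then have "(sqrt 5 + 2)\<^sup>2 * (2 * pi / saddle_variance) = (20 * (9 + 4 * sqrt 5)) * (pi / (10 * saddle_variance))"
    using saddle_variance_pos by (simp add: field_simps)
  also have "\<dots> = pi\<^sup>2 * ((275 + 123 * sqrt 5) / (10 * pi))"
    unfolding v using saddle_variance_pos by (simp add: field_simps power2_eq_square)
  finally have "sqrt ((sqrt 5 + 2)\<^sup>2 * (2 * pi / saddle_variance)) = sqrt (pi\<^sup>2 * ((275 + 123 * sqrt 5) / (10 * pi)))"
    by (simp only:)
  then have eq: "(sqrt 5 + 2) * sqrt (2 * pi / saddle_variance) = pi * sqrt ((275 + 123 * sqrt 5) / (10 * pi))"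
    unfolding real_sqrt_mult by simp
  have "6 * saddle ^ 3 * ((13 + 16 * saddle) * sqrt (2 * pi / saddle_variance)) =
     6 * ((13 + 16 * saddle) * saddle ^ 3) * sqrt (2 * pi / saddle_variance)" by (simp only: mult_ac)
  also have "\<dots> = 6 / 8 * ((sqrt 5 + 2) * sqrt (2 * pi / saddle_variance))"
    unfolding saddle_cube by simp
  also have "\<dots> = 2 * pi * (3 / 8 * sqrt ((275 + 123 * sqrt 5) / (10 * pi)))"
    unfolding eq by simp
  finally show ?thesis .
qed

lemma num_intervals_saddle:
  assumes "n \<ge> 3"
  shows "real n * (real n - 1) * (real n - 2) * real (num_intervals n) =
    6 * saddle ^ 3 / (2 * pi * sqrt n) * ((11 + 5 * sqrt 5) / 2) ^ n * Re (saddle_integral n)"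
proof -
  have "fps_of_poly ([:13, 16:] * [:1, 5, 8, 4:] ^ n) =
     (13 + 16 * fps_X) * ((1 + fps_X) * (1 + 2 * fps_X) ^ 2) ^ n" for n
    unfolding fps_of_poly_mult fps_of_poly_power
    by (simp add: fps_of_poly_pCons algebra_simps power2_eq_square flip: numeral_fps_const)
  then have "fps_nth ((13 + 16 * fps_X) * ((1 + fps_X) * (1 + 2 * fps_X) ^ 2) ^ n) (n - 3) =
     coeff ([:13, 16:] * [:1, 5, 8, 4:] ^ n :: complex poly) (n - 3)"
    by (metis fps_of_poly_nth)
  then have "of_nat (n * (n - 1) * (n - 2) * num_intervals n) =
     6 * ((saddle_value / saddle) ^ n * saddle ^ 3 / (2 * pi * sqrt n) * saddle_integral n)"
    using num_intervals_coeff[OF assms] coeff_saddle_integral[OF assms] by (simp only:)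
  moreover define C where "C = 6 * ((saddle_value / saddle) ^ n * saddle ^ 3 / (2 * pi * sqrt n))"
  ultimately have "complex_of_nat (n * (n - 1) * (n - 2) * num_intervals n) = of_real C * saddle_integral n"
    by simp
  moreover have "Re (of_real C * saddle_integral n) = C * Re (saddle_integral n)" by simp
  ultimately have "real (n * (n - 1) * (n - 2) * num_intervals n) = C * Re (saddle_integral n)"
    by (metis complex_Re_of_nat)
  moreover have "real (n - 1) = real n - 1" "real (n - 2) = real n - 2" using assms by simp_all
  ultimately show ?thesis unfolding C_def saddle_quotient by (simp add: mult_ac)
qed

text \<open>The exponent \<open>- 7 / 2\<close> consists of -3 from the factor
  \<open>n * (n - 1) * (n - 2)\<close> and \<open>- 1 / 2\<close> from rescaling the
  integral.\<close>

lemma num_intervals_asymp_equiv: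
  defines "\<mu> \<equiv> (11 + 5 * sqrt 5) / 2 :: real" and "\<kappa> \<equiv> 3 / 8 * sqrt ((275 + 123 * sqrt 5) / (10 * pi))"
  shows "(\<lambda>n. real (num_intervals n)) \<sim>[at_top] (\<lambda>n. \<kappa> * \<mu> ^ n * real n powr (- 7 / 2))"
proof (rule asymp_equivI')
  have \<mu>: "\<mu> > 0" by (simp add: \<mu>_def add_pos_pos)
  have \<kappa>: "\<kappa> > 0" by (simp add: \<kappa>_def add_pos_pos)
  let ?c = "6 * saddle ^ 3 / (2 * pi * \<kappa>)"
  let ?h = "\<lambda>n::nat. real n powr (7 / 2) / (sqrt n * (real n * (real n - 1) * (real n - 2)))"
  have "(\<lambda>n. Re (saddle_integral n)) \<longlonglongrightarrow> Re (of_real ((13 + 16 * saddle) * sqrt (2 * pi / saddle_variance)))"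
    by (intro tendsto_Re saddle_integral_tendsto)
  moreover have "?h \<longlonglongrightarrow> 1" by real_asymp
  ultimately have "(\<lambda>n. ?c * Re (saddle_integral n) * ?h n) \<longlonglongrightarrow>
     ?c * Re (of_real ((13 + 16 * saddle) * sqrt (2 * pi / saddle_variance))) * 1"
    by (intro tendsto_mult tendsto_const)
  also have "?c * Re (of_real ((13 + 16 * saddle) * sqrt (2 * pi / saddle_variance))) * 1 = 1"
  proof -
    have "?c * Re (of_real ((13 + 16 * saddle) * sqrt (2 * pi / saddle_variance))) * 1 =
       (6 * saddle ^ 3 * ((13 + 16 * saddle) * sqrt (2 * pi / saddle_variance))) / (2 * pi * \<kappa>)"
      by simp
    also have "6 * saddle ^ 3 * ((13 + 16 * saddle) * sqrt (2 * pi / saddle_variance)) = 2 * pi * \<kappa>"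
      unfolding \<kappa>_def by (rule saddle_constant)
    also have "2 * pi * \<kappa> / (2 * pi * \<kappa>) = 1" using \<kappa> by simp
    finally show ?thesis .
  qed
  finally have lim: "(\<lambda>n. ?c * Re (saddle_integral n) * ?h n) \<longlonglongrightarrow> 1" .
  have "eventually (\<lambda>n. ?c * Re (saddle_integral n) * ?h n =
     real (num_intervals n) / (\<kappa> * \<mu> ^ n * real n powr (- 7 / 2))) sequentially"
    using eventually_ge_at_top[of 3]
  proof eventually_elim
    case (elim n)
    define d where "d = real n * (real n - 1) * (real n - 2)"
    have d: "d > 0" unfolding d_def using elim by (intro mult_pos_pos) simp_all
    have "real (num_intervals n) = 6 * saddle ^ 3 / (2 * pi * sqrt n) * \<mu> ^ n * Re (saddle_integral n) / d"
      using num_intervals_saddle[OF elim] d unfolding d_def[symmetric] \<mu>_def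
      by (metis less_irrefl nonzero_mult_div_cancel_left)
    moreover have "real n powr (- 7 / 2) = 1 / real n powr (7 / 2)"
      by (simp add: powr_minus_divide)
    ultimately show ?case
      unfolding d_def[symmetric] using d \<mu> \<kappa> elim by (simp add: field_simps)
  qed
  with lim show "(\<lambda>n. real (num_intervals n) / (\<kappa> * \<mu> ^ n * real n powr (- 7 / 2))) \<longlonglongrightarrow> 1"
    by (rule Lim_transform_eventually)
qed

theorem theorem1p1:
  shows "(\<exists>!Z :: rat fps. fps_nth Z 0 = 0 \<and> Z = fps_X * (1 + Z) * (1 + 2 * Z) ^ 2)
    \<and> (\<forall>Z :: rat fps. fps_nth Z 0 = 0 \<and> Z = fps_X * (1 + Z) * (1 + 2 * Z) ^ 2
         \<longrightarrow> interval_gf = Z * (1 - 2 * Z + 2 * Z ^ 3))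
    \<and> algebraic_of_degree rational_fls (fps_to_fls interval_gf) 3
    \<and> (let \<mu> = (11 + 5 * sqrt 5) / 2 :: real;
           \<kappa> = 3 / 8 * sqrt ((275 + 123 * sqrt 5) / (10 * pi))
       in (\<lambda>n. real (num_intervals n)) \<sim>[at_top] (\<lambda>n. \<kappa> * \<mu> ^ n * real n powr (- 7 / 2)))"
proof (intro conjI)
  show "\<exists>!Z :: rat fps. fps_nth Z 0 = 0 \<and> Z = fps_X * (1 + Z) * (1 + 2 * Z) ^ 2"
    unfolding fps_eq_iff_param_inverse by simp
  show "\<forall>Z :: rat fps. fps_nth Z 0 = 0 \<and> Z = fps_X * (1 + Z) * (1 + 2 * Z) ^ 2
         \<longrightarrow> interval_gf = Z * (1 - 2 * Z + 2 * Z ^ 3)"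
    using interval_gf_eq by blast
  show "algebraic_of_degree rational_fls (fps_to_fls interval_gf) 3"
    by (rule interval_gf_degree)
  show "let \<mu> = (11 + 5 * sqrt 5) / 2 :: real;
           \<kappa> = 3 / 8 * sqrt ((275 + 123 * sqrt 5) / (10 * pi))
       in (\<lambda>n. real (num_intervals n)) \<sim>[at_top] (\<lambda>n. \<kappa> * \<mu> ^ n * real n powr (- 7 / 2))"
    unfolding Let_def by (rule num_intervals_asymp_equiv)
qed

end
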